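(* Let $0<\alpha<\beta$, $\rho=\alpha/\beta$, and let $\tau=A_{N-1}$ be the duration of the Hawkes process cluster with exponential excitation kernel $g(x)=\alpha e^{-\beta x}$, $x\ge0$ (the Markovian Hawkes process). Let $N\sim\mathsf{Borel}(\rho)$ and, given $N$, let $\pi$ be a uniformly random parking function of length $N-1$. Then $$\tau\stackrel{\mathsf{D}}{=}\frac{1}{\beta}\sum_{i=1}^{N-1}T_{\pi,i},$$ where, given $\pi$, the random variables $T_{\pi,i}$, $1\le i\le N-1$, are conditionally independent with $$T_{\pi,i}\sim\mathsf{Exp}\Bigl(i+1-\sum_{j=N-i}^{N-1}\kappa_j(\pi)\Bigr),$$ and $\kappa_i(\pi)=|\{j\mid\pi_j=i\}|$. (The sum is $0$ when $N=1$.)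
   Context: Hawkes process cluster with excitation kernel $g:[0,\infty)\to[0,\infty)$, $\int_0^\infty g(t)\,\mathrm{d}t<1$: a point process $(N_t)_{t\ge0}$ with natural filtration $(\mathcal{F}_t)$, started with one event at time $A_0=0$ (which is counted by $N_t$), with epochs $A_0<A_1<\cdots$, such that as $\delta\downarrow 0$, $\mathrm{P}(N_{t+\delta}-N_t=1\mid\mathcal{F}_t)=\lambda_t\delta+o(\delta)$, $\mathrm{P}(N_{t+\delta}-N_t=0\mid\mathcal{F}_t)=1-\lambda_t\delta+o(\delta)$, $\mathrm{P}(N_{t+\delta}-N_t>1\mid\mathcal{F}_t)=o(\delta)$, where the conditional intensity is $\lambda_t=\sum_{i=0}^{N_t-1}g(t-A_i)$ (no exogenous baseline intensity). Equivalently (Hawkes and Oakes), starting from the time-$0$ event, each event at time $s$ independently generates direct offspring according to an inhomogeneous Poisson process with rate $g(t-s)$, $t>s$, and the cluster consists of the initial event and all its descendants. The cluster size is $\lim_{t\to\infty}N_t$, almost surely finite, and the duration $\tau$ is the time of the last event in the cluster ($\tau=0$ if the cluster contains only the initial event). $\mathsf{Borel}(\rho)$ is the distribution on the positive integers with $\mathrm{P}(N=k)=\frac{e^{-\rho k}}{k!}(\rho k)^{k-1}$. $\mathsf{Exp}(r)$ is the exponential distribution with rate $r$ (mean $1/r$). Parking function of length $k$: a vector $\pi$ of $k$ positive integers whose increasingly sorted entries $\pi_{(1)}\le\dots\le\pi_{(k)}$ satisfy $\pi_{(i)}\le i$ for each $i\in\{1,\dots,k\}$. *)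

theory Defs
  imports "HOL-Probability.Probability"
begin

section \<open>Hawkes process clusters\<close>

text \<open>
  A cluster is given by its epochs \<open>A 0 < A 1 < \<dots>\<close>, with \<open>A i \<omega> = \<infinity>\<close> meaning that there
  is no event number \<open>i\<close>.
\<close>

definition event_count :: "(nat \<Rightarrow> 'a \<Rightarrow> ereal) \<Rightarrow> real \<Rightarrow> 'a \<Rightarrow> nat" where
  "event_count A t \<omega> = card {i. A i \<omega> \<le> ereal t}"

definition natural_filtration :: "'a measure \<Rightarrow> (nat \<Rightarrow> 'a \<Rightarrow> ereal) \<Rightarrow> real \<Rightarrow> 'a measure" where
  "natural_filtration M A t =
     sigma (space M) {{\<omega> \<in> space M. event_count A s \<omega> = k} | s k. 0 \<le> s \<and> s \<le> t}"

definition hawkes_intensity :: "(real \<Rightarrow> real) \<Rightarrow> (nat \<Rightarrow> 'a \<Rightarrow> ereal) \<Rightarrow> real \<Rightarrow> 'a \<Rightarrow> real" where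
  "hawkes_intensity g A t \<omega> =
     (\<Sum>i<event_count A t \<omega>. g (t - real_of_ereal (A i \<omega>)))"

definition increment_prob ::
    "'a measure \<Rightarrow> (nat \<Rightarrow> 'a \<Rightarrow> ereal) \<Rightarrow> (nat \<Rightarrow> bool) \<Rightarrow> real \<Rightarrow> real \<Rightarrow> 'a \<Rightarrow> real" where
  "increment_prob M A Q t \<delta> =
     real_cond_exp M (natural_filtration M A t)
       (indicator {\<omega> \<in> space M. Q (event_count A (t + \<delta>) \<omega> - event_count A t \<omega>)})"

text \<open>
  The remainders \<open>o(\<delta>)\<close> in the infinitesimal description of a point process are random and
  depend on the time \<open>t\<close>.  They are read in the mean (\<open>L\<^sup>1\<close>), locally uniformly in \<open>t\<close>.
  Some uniformity is indispensable: with \<open>\<delta> \<down> 0\<close> separately for each \<open>t\<close>, an additional event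
  at time \<open>1\<close> would go unnoticed, and with merely almost sure convergence for each \<open>t\<close> so would
  events that are driven by a singular compensator.  Under the present reading, which suits
  kernels that are continuous on \<open>[0,\<infinity>)\<close>, the conditions determine the law of the process.
\<close>

definition mean_small_o :: "'a measure \<Rightarrow> (real \<Rightarrow> real \<Rightarrow> 'a \<Rightarrow> real) \<Rightarrow> bool" where
  "mean_small_o M R \<longleftrightarrow>
     (\<forall>u\<ge>0. \<forall>\<epsilon>>0. \<forall>\<^sub>F \<delta> in at_right 0. \<forall>t\<in>{0..u}.
        (\<integral>\<^sup>+ \<omega>. ennreal \<bar>R t \<delta> \<omega>\<bar> \<partial>M) \<le> ennreal (\<epsilon> * \<delta>))"

locale hawkes_cluster = prob_space M for M :: "'a measure" +
  fixes A :: "nat \<Rightarrow> 'a \<Rightarrow> ereal" and g :: "real \<Rightarrow> real"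
  assumes kernel_nonneg: "\<And>x. x \<ge> 0 \<Longrightarrow> g x \<ge> 0"
    and kernel_measurable: "set_borel_measurable lborel {0..} g"
    and kernel_subcritical: "(\<integral>\<^sup>+ x\<in>{0..}. ennreal (g x) \<partial>lborel) < 1"
    and epoch_measurable: "\<And>i. A i \<in> borel_measurable M"
    and epoch_0: "\<And>\<omega>. \<omega> \<in> space M \<Longrightarrow> A 0 \<omega> = 0"
    and epoch_less: "\<And>\<omega> i. \<omega> \<in> space M \<Longrightarrow> A i \<omega> < \<infinity> \<Longrightarrow> A i \<omega> < A (Suc i) \<omega>"
    and epoch_infinite: "\<And>\<omega> i. \<omega> \<in> space M \<Longrightarrow> A i \<omega> = \<infinity> \<Longrightarrow> A (Suc i) \<omega> = \<infinity>"
    and locally_finite: "\<And>\<omega> t. \<omega> \<in> space M \<Longrightarrow> finite {i. A i \<omega> \<le> ereal t}"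
    and one_event: "mean_small_o M (\<lambda>t \<delta> \<omega>.
          increment_prob M A (\<lambda>n. n = 1) t \<delta> \<omega> - hawkes_intensity g A t \<omega> * \<delta>)"
    and no_event: "mean_small_o M (\<lambda>t \<delta> \<omega>.
          increment_prob M A (\<lambda>n. n = 0) t \<delta> \<omega> - (1 - hawkes_intensity g A t \<omega> * \<delta>))"
    and several_events: "mean_small_o M (increment_prob M A (\<lambda>n. n > 1))"

definition cluster_size :: "(nat \<Rightarrow> 'a \<Rightarrow> ereal) \<Rightarrow> 'a \<Rightarrow> nat" where
  "cluster_size A \<omega> = Lim at_top (\<lambda>t. event_count A t \<omega>)"

definition cluster_duration :: "(nat \<Rightarrow> 'a \<Rightarrow> ereal) \<Rightarrow> 'a \<Rightarrow> real" where
  "cluster_duration A \<omega> = real_of_ereal (A (cluster_size A \<omega> - 1) \<omega>)"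


section \<open>Borel and exponential distributions\<close>

definition borel_distribution :: "real \<Rightarrow> nat measure" where
  "borel_distribution \<rho> =
     density (count_space {1..})
       (\<lambda>k. ennreal (exp (- \<rho> * real k) / fact k * (\<rho> * real k) ^ (k - 1)))"

definition exp_distribution :: "real \<Rightarrow> real measure" where
  "exp_distribution r = density lborel (\<lambda>x. ennreal (exponential_density r x))"


section \<open>Parking functions\<close>

text \<open>The entry \<open>\<pi>\<^sub>j\<close> of a vector \<open>\<pi>\<close> is \<open>\<pi> ! (j - 1)\<close>, as list positions start at \<open>0\<close>.\<close>

definition parking_functions :: "nat \<Rightarrow> nat list set" where
  "parking_functions k =
     {\<pi>. length \<pi> = k \<and> (\<forall>x\<in>set \<pi>. x > 0) \<and> (\<forall>i\<in>{1..k}. sort \<pi> ! (i - 1) \<le> i)}"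

definition kappa :: "nat \<Rightarrow> nat list \<Rightarrow> nat" where
  "kappa i \<pi> = card {j \<in> {1..length \<pi>}. \<pi> ! (j - 1) = i}"

lemma finite_parking_functions: "finite (parking_functions k)"
proof (rule finite_subset)
  show "parking_functions k \<subseteq> {\<pi>. set \<pi> \<subseteq> {..k} \<and> length \<pi> = k}"
  proof
    fix \<pi> assume p: "\<pi> \<in> parking_functions k"
    have "x \<le> k" if "x \<in> set \<pi>" for x
    proof -
      have "x \<in> set (sort \<pi>)" using that by simp
      then obtain i where i: "i < length (sort \<pi>)" "sort \<pi> ! i = x"
        by (metis in_set_conv_nth)
      have "Suc i \<in> {1..k}" using i p by (simp add: parking_functions_def)
      then have "sort \<pi> ! (Suc i - 1) \<le> Suc i"
        using p unfolding parking_functions_def by blast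
      with i p show ?thesis by (simp add: parking_functions_def)
    qed
    with p show "\<pi> \<in> {\<pi>. set \<pi> \<subseteq> {..k} \<and> length \<pi> = k}"
      by (auto simp: parking_functions_def)
  qed
qed (simp add: finite_lists_length_eq)

lemma parking_functions_nonempty: "parking_functions k \<noteq> {}"
proof -
  have "sorted (replicate k (1::nat))" by (simp add: sorted_iff_nth_mono)
  then have "sort (replicate k (1::nat)) = replicate k 1" by (rule sort_key_id_if_sorted[of "\<lambda>x. x", simplified])
  then have "replicate k 1 \<in> parking_functions k"
    by (auto simp: parking_functions_def)
  then show ?thesis by blast
qed

definition uniform_parking_function :: "nat \<Rightarrow> nat list pmf" where
  "uniform_parking_function k = pmf_of_set (parking_functions k)"


section \<open>Sums of exponential variables driven by a random parking function\<close>

definition parking_rate :: "nat \<Rightarrow> nat list \<Rightarrow> nat \<Rightarrow> real" where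
  "parking_rate n \<pi> i = real (i + 1) - (\<Sum>j = n - i..n - 1. real (kappa j \<pi>))"

text \<open>
  Law of \<open>c * (\<Sum>i = 1..N - 1. T i)\<close>, where \<open>N\<close> has the Borel distribution, \<open>\<pi>\<close> given \<open>N\<close> is a
  uniform parking function of length \<open>N - 1\<close>, and \<open>T\<close> given \<open>N\<close> and \<open>\<pi>\<close> has the product law that
  makes its coordinates independent and exponential with the rates above.
\<close>

definition parking_exp_sum_law :: "real \<Rightarrow> real \<Rightarrow> real measure" where
  "parking_exp_sum_law \<rho> c =
     borel_distribution \<rho> \<bind> (\<lambda>n.
     measure_pmf (uniform_parking_function (n - 1)) \<bind> (\<lambda>\<pi>.
     distr (\<Pi>\<^sub>M i\<in>{1..n - 1}. exp_distribution (parking_rate n \<pi> i)) borel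
       (\<lambda>T. c * (\<Sum>i = 1..n - 1. T i))))"

end

theory Submission
  imports Defs "HOL-Combinatorics.Multiset_Permutations"
begin

text \<open>
  Write \<open>N\<close> for the number of events so far and \<open>X\<close> for the intensity divided by \<open>\<beta>\<close>.  Call an
  individual active if its parent is born and it is not; given the past, the number of active
  individuals is Poisson with mean \<open>X\<close>.  So \<open>p k a = E (exp (- X) * X ^ a / fact a; N = k)\<close> is the
  probability of \<open>k\<close> births and \<open>a\<close> active individuals, and these probabilities satisfy the Kolmogorov
  equations of the chain in which each active individual is born at rate \<open>\<beta>\<close> and then has
  Poisson(\<open>\<rho>\<close>) children.  The conditions on the increments give the increments of \<open>p\<close> up to an error
  \<open>o(\<delta>)\<close> uniformly in \<open>t\<close>, hence the differential equations.  Their solution is a sum over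
  the sequences of numbers of children, each contributing the distribution function of a sum of
  independent exponential variables whose rates are the numbers of active individuals; these
  sequences are the content vectors of parking functions, counted by multinomial coefficients.
  Finally \<open>p k 0 t\<close> is the probability that the cluster has size \<open>k\<close> and duration at most \<open>t\<close>.
\<close>

section \<open>Differential equations and hypoexponential distribution functions\<close>

text \<open>The hypotheses describe only the counts given the past; no branching structure is at
  hand, so active individuals are never constructed. They enter through test functions. On
  \<open>N t = k\<close>, the evolution of \<open>f (X t)\<close> has the outflow \<beta> x (f' + f)
  and the inflow \<beta> x f (x + \<rho>). For the Poisson weights the first becomes multiplication
  by \<beta> a and the second a finite combination of Poisson weights. This replaces the continuous
  state \<open>X\<close> by a discrete one, and the resulting system is triangular in
  \<open>k\<close>. Two obstacles remain. Increments are controlled only to the right of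
  \<open>t\<close>, so left derivatives need uniformity in \<open>t\<close> and a right side already
  known to be continuous. And \<open>p k 0 t\<close> by itself says nothing about the future: that
  no event follows, and that almost every cluster is finite, has to be derived from the
  infinitesimal conditions.\<close>

lemma increments_continuous:
  fixes u v :: "real \<Rightarrow> real"
  assumes expansion: "\<And>T \<epsilon>. \<epsilon> > 0 \<Longrightarrow>
      \<forall>\<^sub>F \<delta> in at_right 0. \<forall>t\<in>{a..T}. \<bar>u (t + \<delta>) - u t - \<delta> * v t\<bar> \<le> \<epsilon> * \<delta>"
    and bounded: "\<And>t. a \<le> t \<Longrightarrow> \<bar>v t\<bar> \<le> C"
  shows "continuous_on {a..} u"
  unfolding continuous_on_iff
proof (intro ballI allI impI)
  fix x e :: real assume x: "x \<in> {a..}" and e: "e > 0"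
  have "C \<ge> 0" using bounded[of a] by auto
  obtain b where b: "b > 0" "\<And>\<delta> t. 0 < \<delta> \<Longrightarrow> \<delta> < b \<Longrightarrow> t \<in> {a..x+1} \<Longrightarrow>
      \<bar>u (t + \<delta>) - u t - \<delta> * v t\<bar> \<le> 1 * \<delta>"
    using expansion[of 1 "x + 1"] unfolding eventually_at_right_field by auto
  \<comment> \<open>The expansion starts at the smaller of the two points, so it also controls
    increments to the left of \<open>x\<close>.\<close>
  have lip: "\<bar>u z - u y\<bar> \<le> (C + 1) * (z - y)" if "a \<le> y" "y < z" "z - y < b" "y \<le> x + 1" for y z
  proof -
    have "\<bar>u z - u y - (z - y) * v y\<bar> \<le> z - y" using b(2)[of "z - y" y] that by simp
    moreover have "\<bar>(z - y) * v y\<bar> \<le> (z - y) * C"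
      using bounded[of y] that by (simp add: abs_mult)
    ultimately show ?thesis by (simp add: algebra_simps)
  qed
  define d where "d = min b (min 1 (e / (C + 1)))"
  have "d > 0" using b e \<open>C \<ge> 0\<close> by (simp add: d_def)
  moreover have "dist (u y) (u x) < e" if y: "y \<in> {a..}" "dist y x < d" for y
  proof (cases "y = x")
    case False
    then have "\<bar>u y - u x\<bar> \<le> (C + 1) * \<bar>y - x\<bar>"
      using lip[of y x] lip[of x y] x y by (auto simp: d_def dist_real_def abs_if split: if_splits)
    also have "\<dots> < (C + 1) * (e / (C + 1))"
      using y \<open>C \<ge> 0\<close> by (intro mult_strict_left_mono) (auto simp: d_def dist_real_def)
    also have "\<dots> = e" using \<open>C \<ge> 0\<close> by simp
    finally show ?thesis by (simp add: dist_real_def)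
  qed (use e in simp)
  ultimately show "\<exists>d>0. \<forall>x'\<in>{a..}. dist x' x < d \<longrightarrow> dist (u x') (u x) < e" by blast
qed

text \<open>For \<open>y < x\<close> the expansion starts at \<open>y\<close> and has slope
  \<open>v y\<close>, which continuity of \<open>v\<close> replaces by \<open>v x\<close>.
  Uniformity in \<open>t\<close> provides one step size for all such \<open>y\<close>.\<close>

lemma increments_derivative:
  fixes u v :: "real \<Rightarrow> real"
  assumes expansion: "\<And>T \<epsilon>. \<epsilon> > 0 \<Longrightarrow>
      \<forall>\<^sub>F \<delta> in at_right 0. \<forall>t\<in>{a..T}. \<bar>u (t + \<delta>) - u t - \<delta> * v t\<bar> \<le> \<epsilon> * \<delta>"
    and cont: "continuous_on {a..} v" and x: "a \<le> x"
  shows "(u has_real_derivative v x) (at x within {a..})"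
  unfolding has_field_derivative_def has_derivative_within_alt
proof (intro conjI allI impI)
  show "bounded_linear ((*) (v x))" by (rule bounded_linear_mult_right)
  fix e :: real assume e: "e > 0"
  obtain b where b: "b > 0" "\<And>\<delta> t. 0 < \<delta> \<Longrightarrow> \<delta> < b \<Longrightarrow> t \<in> {a..x} \<Longrightarrow>
      \<bar>u (t + \<delta>) - u t - \<delta> * v t\<bar> \<le> (e / 2) * \<delta>"
    using expansion[of "e/2" x] e unfolding eventually_at_right_field by auto
  obtain d where d: "d > 0" "\<And>y. a \<le> y \<Longrightarrow> \<bar>y - x\<bar> < d \<Longrightarrow> \<bar>v y - v x\<bar> < e / 2"
    using cont x e unfolding continuous_on_iff dist_real_def
    by (metis atLeast_iff half_gt_zero)
  have "norm (u y - u x - v x * (y - x)) \<le> e * norm (y - x)"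
    if y: "y \<in> {a..}" "norm (y - x) < min b d" for y
  proof -
    consider "y = x" | "y > x" | "y < x" by linarith
    then show ?thesis
    proof cases
      case 2
      then have "\<bar>u y - u x - (y - x) * v x\<bar> \<le> (e / 2) * (y - x)" using b(2)[of "y - x" x] y x by simp
      also have "\<dots> \<le> e * (y - x)" using e 2 by (intro mult_right_mono) auto
      finally show ?thesis using 2 by (simp add: algebra_simps)
    next
      case 3
      then have 1: "\<bar>u x - u y - (x - y) * v y\<bar> \<le> (e / 2) * (x - y)" using b(2)[of "x - y" y] y x by simp
      have "\<bar>(x - y) * (v y - v x)\<bar> \<le> (x - y) * (e / 2)"
        using d(2)[of y] y 3 by (auto simp: abs_mult)
      have "\<bar>u x - u y - (x - y) * v x\<bar> = \<bar>(u x - u y - (x - y) * v y) + (x - y) * (v y - v x)\<bar>"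
        by (simp add: algebra_simps)
      also have "\<dots> \<le> (e / 2) * (x - y) + (x - y) * (e / 2)"
        using 1 \<open>\<bar>(x - y) * (v y - v x)\<bar> \<le> (x - y) * (e / 2)\<close> by linarith
      finally have "\<bar>u x - u y - (x - y) * v x\<bar> \<le> e * (x - y)" by (simp add: field_simps)
      then show ?thesis using 3 by (simp add: algebra_simps abs_if split: if_splits)
    qed simp
  qed
  then show "\<exists>d>0. \<forall>y\<in>{a..}. norm (y - x) < d \<longrightarrow> norm (u y - u x - v x * (y - x)) \<le> e * norm (y - x)"
    using b(1) d(1) by (intro exI[of _ "min b d"]) auto
qed

text \<open>The difference of two solutions, times the integrating factor
  \<open>exp (r * t)\<close>, has derivative zero.\<close>

lemma linear_ode_unique:
  fixes y z h :: "real \<Rightarrow> real"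
  assumes y: "\<And>t. t \<ge> 0 \<Longrightarrow> (y has_real_derivative h t - r * y t) (at t within {0..})"
    and z: "\<And>t. t \<ge> 0 \<Longrightarrow> (z has_real_derivative h t - r * z t) (at t within {0..})"
    and init: "y 0 = z 0" and t: "t \<ge> 0"
  shows "y t = z t"
proof -
  have "((\<lambda>t. exp (r * t) * (y t - z t)) has_real_derivative 0) (at s within {0..})" if "s \<in> {0..}" for s
    using that by (auto intro!: derivative_eq_intros y z simp: algebra_simps)
  then obtain c where "\<And>s. s \<ge> 0 \<Longrightarrow> exp (r * s) * (y s - z s) = c"
    using has_field_derivative_zero_constant[of "{0::real..}" "\<lambda>t. exp (r * t) * (y t - z t)"]
    by (metis atLeast_iff convex_real_interval(1))
  from this[of 0] this[of t] init t show ?thesis by simp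
qed

text \<open>The distribution function on \<open>[0, \<infinity>)\<close> of a sum of independent
  exponential variables with these rates, written as the variation of constants solution of
  \<open>y' = r * (hypoexp_cdf rs - y)\<close>, \<open>y 0 = 0\<close>. A rate \<open>0\<close>
  gives a stage that never ends.\<close>

fun hypoexp_cdf :: "real list \<Rightarrow> real \<Rightarrow> real" where
  "hypoexp_cdf [] t = 1"
| "hypoexp_cdf (r # rs) t = r * exp (- r * t) * integral {0..t} (\<lambda>s. exp (r * s) * hypoexp_cdf rs s)"

lemma hypoexp_Cons_derivative:
  assumes cont: "continuous_on {0..} (hypoexp_cdf rs)" and t: "t \<ge> 0"
  shows "(hypoexp_cdf (r # rs) has_real_derivative r * (hypoexp_cdf rs t - hypoexp_cdf (r # rs) t)) (at t within {0..})"
proof -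
  let ?I = "\<lambda>t. integral {0..t} (\<lambda>s. exp (r * s) * hypoexp_cdf rs s)"
  have "continuous_on {0..t+1} (\<lambda>s. exp (r * s) * hypoexp_cdf rs s)"
    using continuous_on_subset[OF cont, of "{0..t+1}"] by (auto intro!: continuous_intros)
  then have "(?I has_real_derivative exp (r * t) * hypoexp_cdf rs t) (at t within {0..t+1})"
    using t by (intro integral_has_real_derivative) auto
  moreover have "at t within {0..t+1} = at t within {0..}"
    using t by (intro at_within_nhd[of _ "{..<t+1}"]) auto
  ultimately have I: "(?I has_real_derivative exp (r * t) * hypoexp_cdf rs t) (at t within {0..})" by simp
  have "((\<lambda>t. r * exp (- r * t)) has_real_derivative - r * (r * exp (- r * t))) (at t within {0..})"
    by (auto intro!: derivative_eq_intros)
  from DERIV_mult[OF this I]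
  have "(hypoexp_cdf (r # rs) has_real_derivative
      - r * (r * exp (- r * t)) * ?I t + exp (r * t) * hypoexp_cdf rs t * (r * exp (- r * t))) (at t within {0..})"
    unfolding hypoexp_cdf.simps(2)[abs_def] .
  moreover have "- r * (r * exp (- r * t)) * ?I t + exp (r * t) * hypoexp_cdf rs t * (r * exp (- r * t))
      = r * (hypoexp_cdf rs t - hypoexp_cdf (r # rs) t)"
    by (simp add: exp_minus right_diff_distrib mult.assoc)
  ultimately show ?thesis by simp
qed

lemma hypoexp_continuous: "continuous_on {0..} (hypoexp_cdf rs)"
proof (induction rs)
  case (Cons r rs)
  show ?case by (rule DERIV_continuous_on, rule hypoexp_Cons_derivative[OF Cons]) simp
qed simp

lemmas hypoexp_derivative = hypoexp_Cons_derivative[OF hypoexp_continuous]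

lemma hypoexp_0 [simp]: "hypoexp_cdf (r # rs) 0 = 0"
  by simp

lemma hypoexp_zero_rate [simp]: "hypoexp_cdf (0 # rs) t = 0"
  by simp

declare hypoexp_cdf.simps(2) [simp del]

section \<open>Offspring sequences and parking functions\<close>

text \<open>
  \<open>paths k a\<close> holds the numbers of children of the first \<open>k\<close> individuals, in the order of birth and
  listed backwards, for which somebody is active before each birth and \<open>a\<close> individuals are active at
  the end.  Initially only the root is active.  \<open>active_counts\<close> lists the numbers of active individuals after each birth.
\<close>

fun paths :: "nat \<Rightarrow> nat \<Rightarrow> nat list set" where
  "paths 0 a = (if a = 1 then {[]} else {})"
| "paths (Suc k) a = (\<Union>b\<in>{1..a+1}. (#) (a + 1 - b) ` paths k b)"

fun active_counts :: "nat list \<Rightarrow> nat list" where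
  "active_counts [] = []"
| "active_counts (d # c) = (d + sum_list c - length c) # active_counts c"

lemma finite_paths [simp]: "finite (paths k a)"
  by (induction k arbitrary: a) auto

text \<open>As the list runs backwards, \<open>drop i c\<close> belongs to the first
  \<open>k - i\<close> individuals. After their births
  \<open>sum_list (drop i c) + 1 - (k - i)\<close> individuals are active: the root and all
  children, less one for each birth. The inequalities say that this number is positive before each
  birth.\<close>

lemma paths_iff: "c \<in> paths k a \<longleftrightarrow>
    length c = k \<and> sum_list c + 1 = a + k \<and> (\<forall>i\<in>{1..k}. k - i \<le> sum_list (drop i c))"
proof (induction k arbitrary: c a)
  case (Suc k)
  show ?case
  proof (cases c)
    case (Cons d c')
    have all: "(\<forall>i\<in>{1..Suc k}. Suc k - i \<le> sum_list (drop i c)) \<longleftrightarrow>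
        k \<le> sum_list c' \<and> (\<forall>i\<in>{1..k}. k - i \<le> sum_list (drop i c'))" (is "?l \<longleftrightarrow> ?r")
    proof
      assume ?l
      then have l: "Suc k - i \<le> sum_list (drop i c)" if "1 \<le> i" "i \<le> Suc k" for i using that by simp
      show ?r using l[of 1] l[of "Suc _"] by (auto simp: Cons)
    next
      assume r: ?r
      show ?l
      proof
        fix i assume i: "i \<in> {1..Suc k}"
        show "Suc k - i \<le> sum_list (drop i c)"
          using r i by (cases i; cases "i = 1") (auto simp: Cons)
      qed
    qed
    have "c \<in> paths (Suc k) a \<longleftrightarrow> (\<exists>b\<in>{1..a+1}. d = a + 1 - b \<and> c' \<in> paths k b)"
      by (auto simp: Cons image_iff)
    also have "\<dots> \<longleftrightarrow> length c' = k \<and> d + sum_list c' + 1 = a + Suc k \<and> k \<le> sum_list c' \<and>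
        (\<forall>i\<in>{1..k}. k - i \<le> sum_list (drop i c'))" (is "?L \<longleftrightarrow> ?R")
    proof
      assume ?L then show ?R using Suc.IH[of c'] by auto
    next
      assume R: ?R
      \<comment> \<open>The witness is the number of individuals active before the last birth; it is
        positive by \<open>k \<le> sum_list c'\<close>.\<close>
      then have "sum_list c' + 1 - k \<in> {1..a+1} \<and> d = a + 1 - (sum_list c' + 1 - k)
          \<and> c' \<in> paths k (sum_list c' + 1 - k)"
        unfolding Suc.IH[of c'] by auto
      then show ?L by blast
    qed
    finally show ?thesis unfolding all by (auto simp: Cons)
  qed auto
qed auto

lemma sum_paths_Suc:
  "(\<Sum>c\<in>paths (Suc k) a. f c) = (\<Sum>b=1..a+1. \<Sum>c\<in>paths k b. f ((a + 1 - b) # c))"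
proof -
  have "(\<Sum>c\<in>paths (Suc k) a. f c) = (\<Sum>b=1..a+1. sum f ((#) (a + 1 - b) ` paths k b))"
    unfolding paths.simps by (rule sum.UNION_disjoint) auto
  also have "\<dots> = (\<Sum>b=1..a+1. \<Sum>c\<in>paths k b. f ((a + 1 - b) # c))"
    by (simp add: sum.reindex)
  finally show ?thesis .
qed

section \<open>Total weight of the offspring sequences of given length\<close>

text \<open>What remains of a product of Poisson offspring probabilities once the factors that
  depend only on the length and the sum of the sequence are taken out.\<close>

definition weight :: "nat list \<Rightarrow> real" where
  "weight c = (\<Prod>d\<leftarrow>c. 1 / fact d)"

lemma weight_simps [simp]: "weight [] = 1" "weight (d # c) = weight c / fact d"
  by (auto simp: weight_def)

text \<open>Total weight of the ways to get in \<open>k\<close> births from \<open>s\<close> active individuals to none for the first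
  time, by the hitting time theorem.\<close>

definition hitting_weight :: "nat \<Rightarrow> nat \<Rightarrow> real" where
  "hitting_weight k s = (if k = 0 then 1 else real s * real k ^ (k - s) / (real k * fact (k - s)))"

text \<open>First step decomposition: one birth with \<open>b + 1 - s\<close> children leads from
  \<open>s\<close> to \<open>b\<close> active individuals, and at most \<open>k\<close> of them can
  be used up by \<open>k\<close> further births. Putting \<open>b = k - d\<close> leaves a binomial
  sum minus its derivative.\<close>

lemma hitting_weight_Suc:
  assumes "1 \<le> s" "s \<le> Suc k"
  shows "(\<Sum>b=s-1..k. hitting_weight k b / fact (b + 1 - s)) = hitting_weight (Suc k) s"
proof (cases "k = 0")
  case True
  then show ?thesis using assms by (auto simp: hitting_weight_def)
next
  case False
  define m where "m = Suc k - s"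
  have s: "s = Suc k - m" "m \<le> k" using assms by (auto simp: m_def)
  have "(\<Sum>b=s-1..k. hitting_weight k b / fact (b + 1 - s))
      = (\<Sum>d\<le>m. hitting_weight k (k - d) / fact (m - d))"
    by (rule sum.reindex_bij_witness[of _ "\<lambda>d. k - d" "\<lambda>b. k - b"])
      (use s(2) in \<open>auto simp: s(1) Suc_diff_le add.commute\<close>)
  also have "\<dots> = (\<Sum>d\<le>m. (real k ^ d * real (m choose d) - real d * real (m choose d) * real k ^ (d - 1)) / fact m)"
  proof (rule sum.cong)
    fix d assume d: "d \<in> {..m}"
    have "real (m choose d) = fact m / (fact d * fact (m - d))"
      using d by (simp add: binomial_fact)
    then have choose: "1 / (fact d * fact (m - d)) = real (m choose d) / fact m" by simp
    have power: "real d * real k ^ d / real k = real d * real k ^ (d - 1)" using False by (cases d) auto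
    have "hitting_weight k (k - d) / fact (m - d)
        = (real k ^ d - real d * real k ^ d / real k) * (1 / (fact d * fact (m - d)))"
      using d s False by (simp add: hitting_weight_def field_simps of_nat_diff)
    also have "\<dots> = (real k ^ d * real (m choose d) - real d * real (m choose d) * real k ^ (d - 1)) / fact m"
      unfolding choose power by (simp add: algebra_simps diff_divide_distrib)
    finally show "hitting_weight k (k - d) / fact (m - d) =
        (real k ^ d * real (m choose d) - real d * real (m choose d) * real k ^ (d - 1)) / fact m" .
  qed simp
  also have "\<dots> = ((real k + 1) ^ m - real m * (real k + 1) ^ (m - 1)) / fact m"
  proof -
    have 1: "(\<Sum>d\<le>m. real k ^ d * real (m choose d)) = (real k + 1) ^ m"
      by (subst binomial_ring) (simp add: mult.commute)
    \<comment> \<open>The derivative of the binomial theorem, in the form of the absorption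
      identity.\<close>
    have "(\<Sum>d\<le>m. real d * real (m choose d) * real k ^ (d - 1)) = real m * (real k + 1) ^ (m - 1)"
    proof (cases m)
      case (Suc l)
      have "(\<Sum>d\<le>m. real d * real (m choose d) * real k ^ (d - 1))
          = (\<Sum>d\<le>l. real (Suc d * (Suc l choose Suc d)) * real k ^ d)"
        unfolding Suc by (subst sum.atMost_Suc_shift) (simp add: distrib_right del: binomial_Suc_Suc)
      also have "\<dots> = (\<Sum>d\<le>l. real (Suc l) * (real (l choose d) * real k ^ d))"
        by (intro sum.cong refl) (simp only: Suc_times_binomial of_nat_mult mult.assoc)
      also have "\<dots> = real (Suc l) * (real k + 1) ^ l"
        by (subst binomial_ring) (simp add: sum_distrib_left)
      finally show ?thesis by (simp add: Suc)
    qed simp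
    with 1 show ?thesis by (simp add: sum_subtractf flip: sum_divide_distrib)
  qed
  also have "\<dots> = hitting_weight (Suc k) s"
  proof -
    have hw: "hitting_weight (Suc k) s = real s * (real k + 1) ^ m / ((real k + 1) * fact m)"
      using s by (simp add: hitting_weight_def add.commute)
    have "real s * (real k + 1) ^ m / (real k + 1) = (real k + 1) ^ m - real m * (real k + 1) ^ (m - 1)"
    proof (cases m)
      case (Suc l)
      have "real s = real k + 1 - real m" using s by (simp add: of_nat_diff)
      moreover have "(real k + 1) ^ m / (real k + 1) = (real k + 1) ^ l" by (simp add: Suc)
      ultimately have "real s * (real k + 1) ^ m / (real k + 1) = (real k + 1 - real m) * (real k + 1) ^ l"
        by (simp flip: times_divide_eq_right)
      then show ?thesis by (simp add: Suc algebra_simps)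
    qed (simp add: s add.commute)
    then show ?thesis unfolding hw by (simp flip: divide_divide_eq_left)
  qed
  finally show ?thesis .
qed

text \<open>The recursion for \<open>paths\<close> splits off the last birth, that for
  \<open>hitting_weight\<close> the first. The sum of
  \<open>Q (n - k) b * hitting_weight k b\<close> over \<open>b\<close> cuts a sequence after
  \<open>n - k\<close> births and does not depend on \<open>k\<close>: each step moves one birth
  across the cut. The values \<open>k = 0\<close> and \<open>k = n\<close> give the two
  sides.\<close>

lemma sum_weight_paths:
  assumes "n \<ge> 1"
  shows "(\<Sum>c\<in>paths n 0. weight c) = real n ^ (n - 1) / (real n * fact (n - 1))"
proof -
  define Q where "Q j b = (\<Sum>c\<in>paths j b. weight c)" for j b
  have Q_Suc: "Q (Suc j) b = (\<Sum>b'=1..b+1. Q j b' / fact (b + 1 - b'))" for j b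
    unfolding Q_def sum_paths_Suc by (simp add: sum_divide_distrib)
  have step: "(\<Sum>b\<le>k. Q (Suc j) b * hitting_weight k b) = (\<Sum>b\<le>Suc k. Q j b * hitting_weight (Suc k) b)" for j k
  proof -
    have "(\<Sum>b\<le>k. Q (Suc j) b * hitting_weight k b)
        = (\<Sum>b\<le>k. \<Sum>b'=1..b+1. Q j b' * (hitting_weight k b / fact (b + 1 - b')))"
      by (simp only: Q_Suc sum_distrib_right times_divide_eq_left times_divide_eq_right)
    also have "\<dots> = (\<Sum>(b, b')\<in>(SIGMA b:{..k}. {1..b+1}). Q j b' * (hitting_weight k b / fact (b + 1 - b')))"
      by (subst sum.Sigma) auto
    also have "\<dots> = (\<Sum>(b', b)\<in>(SIGMA b':{1..Suc k}. {b'-1..k}). Q j b' * (hitting_weight k b / fact (b + 1 - b')))"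
      by (rule sum.reindex_bij_witness[of _ "\<lambda>(a, b). (b, a)" "\<lambda>(a, b). (b, a)"]) auto
    also have "\<dots> = (\<Sum>b'=1..Suc k. \<Sum>b=b'-1..k. Q j b' * (hitting_weight k b / fact (b + 1 - b')))"
      by (subst sum.Sigma) auto
    also have "\<dots> = (\<Sum>b'=1..Suc k. Q j b' * hitting_weight (Suc k) b')"
      unfolding sum_distrib_left[symmetric] by (intro sum.cong refl) (simp only: hitting_weight_Suc atLeastAtMost_iff)
    also have "\<dots> = (\<Sum>b\<le>Suc k. Q j b * hitting_weight (Suc k) b)"
      by (rule sum.mono_neutral_left) (auto simp: hitting_weight_def)
    finally show ?thesis .
  qed
  have "(\<Sum>b\<le>k. Q (n - k) b * hitting_weight k b) = Q n 0" if "k \<le> n" for k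
    using that
  proof (induction k)
    case 0 then show ?case by (simp add: hitting_weight_def)
  next
    case (Suc k)
    then have "n - k = Suc (n - Suc k)" by simp
    with Suc step[of "n - Suc k" k] show ?case by simp
  qed
  from this[of n] have "Q n 0 = (\<Sum>b\<le>n. Q 0 b * hitting_weight n b)" by simp
  also have "\<dots> = (\<Sum>b\<in>{1}. Q 0 b * hitting_weight n b)"
    using assms by (intro sum.mono_neutral_right) (auto simp: Q_def)
  finally show ?thesis using assms by (simp add: Q_def hitting_weight_def)
qed

section \<open>Parking functions through their content vectors\<close>

lemma sorted_nth_le_iff:
  fixes xs :: "nat list"
  assumes "sorted xs" "1 \<le> i" "i \<le> length xs"
  shows "xs ! (i - 1) \<le> x \<longleftrightarrow> i \<le> length (filter (\<lambda>y. y \<le> x) xs)"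
proof
  assume "xs ! (i - 1) \<le> x"
  then have "xs ! j \<le> x" if "j < i" for j
    using sorted_nth_mono[OF assms(1), of j "i - 1"] assms that by fastforce
  then have "{..<i} \<subseteq> {j. j < length xs \<and> xs ! j \<le> x}" using assms by auto
  from card_mono[OF _ this] show "i \<le> length (filter (\<lambda>y. y \<le> x) xs)" by (simp add: length_filter_conv_card)
next
  assume i: "i \<le> length (filter (\<lambda>y. y \<le> x) xs)"
  show "xs ! (i - 1) \<le> x"
  proof (rule ccontr)
    assume n: "\<not> xs ! (i - 1) \<le> x"
    have "j < i - 1" if "j < length xs" "xs ! j \<le> x" for j
      using sorted_nth_mono[OF assms(1), of "i - 1" j] n that by (meson leI le_trans)
    then have "{j. j < length xs \<and> xs ! j \<le> x} \<subseteq> {..<i - 1}" by auto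
    from card_mono[OF _ this] i assms show False by (simp add: length_filter_conv_card)
  qed
qed

lemma kappa_eq_count: "kappa j \<pi> = count (mset \<pi>) j"
proof -
  have "kappa j \<pi> = card {i. i < length \<pi> \<and> \<pi> ! i = j}"
    unfolding kappa_def
    by (rule bij_betw_same_card[of "\<lambda>i. i - 1"], rule bij_betw_byWitness[of _ Suc]) auto
  also have "\<dots> = count (mset \<pi>) j"
    by (simp add: count_mset count_list_eq_length_filter length_filter_conv_card eq_commute)
  finally show ?thesis .
qed

lemma sum_kappa:
  assumes "\<forall>x\<in>set \<pi>. x > 0"
  shows "(\<Sum>j=1..i. kappa j \<pi>) = length (filter (\<lambda>x. x \<le> i) \<pi>)"
  using assms
proof (induction \<pi>)
  case (Cons x \<pi>)
  have "kappa j (x # \<pi>) = kappa j \<pi> + of_bool (j = x)" for j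
    by (auto simp: kappa_eq_count)
  with Cons show ?case by (auto simp: sum.distrib)
qed (auto simp: kappa_eq_count)

text \<open>The \<open>i\<close>-th smallest entry is at most \<open>i\<close> exactly when at least
  \<open>i\<close> entries are. In this form the condition depends on the content alone and matches
  the inequalities of \<open>paths_iff\<close>.\<close>

lemma parking_functions_iff:
  "\<pi> \<in> parking_functions k \<longleftrightarrow> length \<pi> = k \<and> (\<forall>x\<in>set \<pi>. x > 0) \<and> (\<forall>i\<in>{1..k}. i \<le> (\<Sum>j=1..i. kappa j \<pi>))"
proof -
  have "length (filter P (sort \<pi>)) = length (filter P \<pi>)" for P
    by (metis mset_filter mset_sort size_mset)
  then show ?thesis
    unfolding parking_functions_def using sorted_nth_le_iff[of "sort \<pi>"] sum_kappa[of \<pi>]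
    by auto
qed

text \<open>The condition at \<open>i = k\<close> counts \<open>k\<close> entries that are at most
  \<open>k\<close>, hence all of them.\<close>

lemma parking_functions_le:
  assumes "\<pi> \<in> parking_functions k" "x \<in> set \<pi>"
  shows "1 \<le> x" "x \<le> k"
proof -
  have p: "length \<pi> = k" "\<forall>x\<in>set \<pi>. x > 0" "\<forall>i\<in>{1..k}. i \<le> (\<Sum>j=1..i. kappa j \<pi>)"
    using assms by (auto simp: parking_functions_iff)
  show "1 \<le> x" using p assms by (simp add: Suc_leI)
  have "k \<ge> 1" using p assms(2) by (cases \<pi>) auto
  then have "k \<le> (\<Sum>j=1..k. kappa j \<pi>)" using p(3) by auto
  then have "length \<pi> \<le> length (filter (\<lambda>x. x \<le> k) \<pi>)"
    unfolding sum_kappa[OF p(2)] using p(1) by simp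
  then have "length (filter (\<lambda>x. x \<le> k) \<pi>) = length \<pi>" using length_filter_le le_antisym by blast
  then show "x \<le> k" using assms(2) by (metis length_filter_less linorder_not_less order_less_irrefl)
qed

text \<open>The \<open>j\<close>-th individual gets \<open>kappa j \<pi>\<close> children, listed
  backwards as in \<open>paths\<close>. For a parking function of length \<open>n - 1\<close> the
  leading entry \<open>kappa n \<pi>\<close> is \<open>0\<close>: the last individual is
  childless.\<close>

definition offspring_counts :: "nat \<Rightarrow> nat list \<Rightarrow> nat list" where
  "offspring_counts n \<pi> = map (\<lambda>i. kappa (n - i) \<pi>) [0..<n]"

lemma length_offspring_counts [simp]: "length (offspring_counts n \<pi>) = n"
  by (simp add: offspring_counts_def)

lemma sum_list_drop_offspring_counts:
  "i \<le> n \<Longrightarrow> sum_list (drop i (offspring_counts n \<pi>)) = (\<Sum>j=1..n-i. kappa j \<pi>)"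
proof -
  assume "i \<le> n"
  have "sum_list (drop i (offspring_counts n \<pi>)) = (\<Sum>l=i..<n. kappa (n - l) \<pi>)"
    by (simp add: offspring_counts_def drop_map sum_list_distinct_conv_sum_set)
  also have "\<dots> = (\<Sum>j=1..n-i. kappa j \<pi>)"
    by (rule sum.reindex_bij_witness[of _ "\<lambda>j. n - j" "\<lambda>j. n - j"]) (use \<open>i \<le> n\<close> in auto)
  finally show ?thesis .
qed

lemma sum_kappa_parking:
  assumes "\<pi> \<in> parking_functions k" "k \<le> i"
  shows "(\<Sum>j=1..i. kappa j \<pi>) = k"
proof -
  have "(\<Sum>j=1..i. kappa j \<pi>) = length (filter (\<lambda>x. x \<le> i) \<pi>)"
    using assms by (intro sum_kappa) (auto simp: parking_functions_iff)
  also have "filter (\<lambda>x. x \<le> i) \<pi> = \<pi>"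
    using parking_functions_le[OF assms(1)] assms(2) by (auto simp: filter_id_conv intro: order_trans)
  finally show ?thesis using assms by (auto simp: parking_functions_iff)
qed

lemma offspring_counts_paths:
  assumes "n \<ge> 1" "\<pi> \<in> parking_functions (n - 1)"
  shows "offspring_counts n \<pi> \<in> paths n 0"
proof -
  have "n - i \<le> (\<Sum>j=1..n-i. kappa j \<pi>)" if "i \<in> {1..n}" for i
  proof (cases "i = n")
    case False
    then have "n - i \<in> {1..n-1}" using that by auto
    then show ?thesis using assms(2) by (auto simp: parking_functions_iff)
  qed simp
  moreover have "sum_list (offspring_counts n \<pi>) = n - 1"
    using sum_list_drop_offspring_counts[of 0 n \<pi>] sum_kappa_parking[OF assms(2), of n] by simp
  ultimately show ?thesis using assms by (auto simp: paths_iff sum_list_drop_offspring_counts)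
qed

text \<open>Since the parking condition depends on the content alone, the parking functions with
  content \<open>c\<close> are all arrangements of one multiset, and their number is a multinomial
  coefficient.\<close>

lemma card_offspring_counts:
  assumes n: "n \<ge> 1" and c: "c \<in> paths n 0"
  shows "real (card {\<pi> \<in> parking_functions (n - 1). offspring_counts n \<pi> = c}) = fact (n - 1) * weight c"
proof -
  define A where "A = (\<Sum>j=1..n. replicate_mset (c ! (n - j)) j)"
  have c': "length c = n" "sum_list c + 1 = n" "\<And>i. 1 \<le> i \<Longrightarrow> i \<le> n \<Longrightarrow> n - i \<le> sum_list (drop i c)"
    using c by (auto simp: paths_iff)
  have count_A: "count A x = (if x \<in> {1..n} then c ! (n - x) else 0)" for x
    unfolding A_def count_sum by (simp add: sum.delta)
  have sub: "set_mset A \<subseteq> {1..n}" by (auto simp: count_A simp flip: count_greater_zero_iff split: if_splits)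
  have "size A = (\<Sum>x=1..n. count A x)"
    unfolding size_multiset_overloaded_eq by (rule sum.mono_neutral_left) (use sub in \<open>auto simp: not_in_iff\<close>)
  also have "\<dots> = (\<Sum>i<n. c ! i)"
    by (rule sum.reindex_bij_witness[of _ "\<lambda>j. n - j" "\<lambda>j. n - j"]) (auto simp: count_A)
  also have "\<dots> = n - 1" using c' by (simp add: sum_list_sum_nth atLeast0LessThan)
  finally have size_A: "size A = n - 1" .
  have "{\<pi> \<in> parking_functions (n - 1). offspring_counts n \<pi> = c} = permutations_of_multiset A"
  proof (intro equalityI subsetI)
    fix \<pi> assume "\<pi> \<in> {\<pi> \<in> parking_functions (n - 1). offspring_counts n \<pi> = c}"
    then have p: "\<pi> \<in> parking_functions (n - 1)" "offspring_counts n \<pi> = c" by auto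
    have "count (mset \<pi>) x = count A x" for x
    proof (cases "x \<in> {1..n}")
      case True
      then have "c ! (n - x) = kappa x \<pi>" unfolding p(2)[symmetric] offspring_counts_def by simp
      then show ?thesis using True by (simp add: count_A kappa_eq_count)
    next
      case False
      then have "x \<notin> set \<pi>" using parking_functions_le[OF p(1), of x] by auto
      then show ?thesis using False by (auto simp: count_A count_eq_zero_iff)
    qed
    then show "\<pi> \<in> permutations_of_multiset A"
      by (auto simp: permutations_of_multiset_def intro: multiset_eqI)
  next
    fix \<pi> assume "\<pi> \<in> permutations_of_multiset A"
    then have m: "mset \<pi> = A" by (simp add: permutations_of_multiset_def)
    have b: "offspring_counts n \<pi> = c"
      by (rule nth_equalityI) (auto simp: c' offspring_counts_def kappa_eq_count m count_A)
    have "\<forall>x\<in>set \<pi>. x > 0" using sub m by (metis Suc_le_eq One_nat_def atLeastAtMost_iff set_mset_mset subset_iff)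
    moreover have "length \<pi> = n - 1" using m size_A by (metis size_mset)
    moreover have "i \<le> (\<Sum>j=1..i. kappa j \<pi>)" if "i \<in> {1..n-1}" for i
    proof -
      have "i = n - (n - i)" "1 \<le> n - i" using that by auto
      then show ?thesis using c'(3)[of "n - i"] sum_list_drop_offspring_counts[of "n - i" n \<pi>] b by simp
    qed
    ultimately show "\<pi> \<in> {\<pi> \<in> parking_functions (n - 1). offspring_counts n \<pi> = c}"
      using b by (simp add: parking_functions_iff)
  qed
  moreover have "real (card (permutations_of_multiset A)) = fact (n - 1) / real (\<Prod>x\<in>set_mset A. fact (count A x))"
    using card_permutations_of_multiset[of A] by (simp add: size_A real_of_nat_div)
  moreover have "(\<Prod>x\<in>set_mset A. fact (count A x)) = (\<Prod>i<n. fact (c ! i) :: nat)"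
  proof -
    have "(\<Prod>x\<in>set_mset A. fact (count A x)) = (\<Prod>x=1..n. fact (count A x) :: nat)"
      by (rule prod.mono_neutral_left) (use sub in \<open>auto simp: not_in_iff\<close>)
    also have "\<dots> = (\<Prod>i<n. fact (c ! i))"
      by (rule prod.reindex_bij_witness[of _ "\<lambda>j. n - j" "\<lambda>j. n - j"]) (auto simp: count_A)
    finally show ?thesis .
  qed
  moreover have "weight c = 1 / real (\<Prod>i<n. fact (c ! i))"
  proof -
    have "weight c = 1 / real (\<Prod>d\<leftarrow>c. fact d)" by (induction c) auto
    then show ?thesis using c' by (simp add: prod.list_conv_set_nth atLeast0LessThan)
  qed
  ultimately show ?thesis by (simp only:) simp
qed

lemma sum_parking_functions:
  fixes h :: "nat list \<Rightarrow> real"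
  assumes "n \<ge> 1"
  shows "(\<Sum>\<pi>\<in>parking_functions (n - 1). h (offspring_counts n \<pi>)) = fact (n - 1) * (\<Sum>c\<in>paths n 0. weight c * h c)"
proof -
  have "(\<Sum>\<pi>\<in>parking_functions (n - 1). h (offspring_counts n \<pi>))
      = (\<Sum>c\<in>paths n 0. \<Sum>\<pi>\<in>{\<pi> \<in> parking_functions (n - 1). offspring_counts n \<pi> = c}. h (offspring_counts n \<pi>))"
    using offspring_counts_paths[OF assms] by (intro sum.group[symmetric] finite_parking_functions) auto
  also have "\<dots> = (\<Sum>c\<in>paths n 0. \<Sum>\<pi>\<in>{\<pi> \<in> parking_functions (n - 1). offspring_counts n \<pi> = c}. h c)"
    by (intro sum.cong refl) auto
  also have "\<dots> = (\<Sum>c\<in>paths n 0. fact (n - 1) * weight c * h c)"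
    by (intro sum.cong refl) (simp add: card_offspring_counts[OF assms, simplified])
  finally show ?thesis by (simp add: sum_distrib_left mult.assoc)
qed

text \<open>The classical count \<open>(k + 1) ^ (k - 1)\<close> for length
  \<open>k = n - 1\<close>, written as a quotient because the exponent \<open>n - 2\<close> is
  truncated at \<open>n = 1\<close>.\<close>

lemma card_parking_functions:
  "n \<ge> 1 \<Longrightarrow> real (card (parking_functions (n - 1))) = real n ^ (n - 1) / real n"
  using sum_parking_functions[of n "\<lambda>_. 1"] by (simp add: sum_weight_paths)

lemma length_active_counts [simp]: "length (active_counts c) = length c"
  by (induction c) auto

lemma nth_active_counts: "i < length c \<Longrightarrow> active_counts c ! i = sum_list (drop i c) - (length c - Suc i)"
  by (induction c arbitrary: i) (auto simp: nth_Cons split: nat.splits)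

lemma active_counts_Cons: "c \<in> paths (Suc k) a \<Longrightarrow> active_counts c = a # active_counts (tl c)"
  by (cases c) (auto simp: paths_iff)

text \<open>The rates of the theorem are the numbers of active individuals up to a cyclic shift.\<close>

lemma parking_rate_eq_active_counts:
  assumes n: "n \<ge> 2" and p: "\<pi> \<in> parking_functions (n - 1)"
  shows "map (parking_rate n \<pi>) ((n - 1) # [1..<n-1]) = map real (active_counts (tl (offspring_counts n \<pi>)))"
    and "i \<in> {1..n-1} \<Longrightarrow> parking_rate n \<pi> i \<ge> 1"
proof -
  let ?c = "offspring_counts n \<pi>"
  have counts_nth: "active_counts (tl ?c) ! i = (\<Sum>j=1..n-Suc i. kappa j \<pi>) - (n - Suc (Suc i))" if "i < n - 1" for i
    using that by (subst nth_active_counts) (auto simp: drop_Suc[symmetric] sum_list_drop_offspring_counts numeral_2_eq_2)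
  \<comment> \<open>Rate \<open>i\<close> is the number of active individuals after
    \<open>n - 1 - i\<close> births, so the rates cover \<open>0\<close> to \<open>n - 2\<close>
    births, whereas the waiting times between events need \<open>1\<close> to \<open>n - 1\<close>.
    The counts after \<open>0\<close> and after \<open>n - 1\<close> births are both
    \<open>1\<close>, which allows the shift.\<close>
  have first: "parking_rate n \<pi> (n - 1) = 1"
  proof -
    have "(\<Sum>j=1..n-1. real (kappa j \<pi>)) = real (n - 1)"
      using sum_kappa_parking[OF p order_refl] by (metis of_nat_sum)
    then show ?thesis using n by (simp add: parking_rate_def)
  qed
  have rate: "parking_rate n \<pi> i = real ((\<Sum>j=1..n-Suc i. kappa j \<pi>) - (n - Suc (Suc i))) \<and>
      n - Suc (Suc i) < (\<Sum>j=1..n-Suc i. kappa j \<pi>)" if i: "1 \<le> i" "i < n - 1" for i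
  proof -
    have "n - Suc i \<in> {1..n-1}" using i by auto
    then have le: "n - Suc i \<le> (\<Sum>j=1..n-Suc i. kappa j \<pi>)" using p by (auto simp: parking_functions_iff)
    \<comment> \<open>The rate subtracts the contents of the last \<open>i\<close> positions; the
      total \<open>n - 1\<close> converts this into a partial sum from the left.\<close>
    have "{1..n-1} = {1..n-Suc i} \<union> {n-i..n-1}" "{1..n-Suc i} \<inter> {n-i..n-1} = {}" using i by auto
    then have "(\<Sum>j=1..n-1. kappa j \<pi>) = (\<Sum>j=1..n-Suc i. kappa j \<pi>) + (\<Sum>j=n-i..n-1. kappa j \<pi>)"
      by (simp add: sum.union_disjoint)
    then have "real (n - 1) = real (\<Sum>j=1..n-Suc i. kappa j \<pi>) + (\<Sum>j=n-i..n-1. real (kappa j \<pi>))"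
      using sum_kappa_parking[OF p order_refl] by (metis of_nat_add of_nat_sum)
    then show ?thesis using le i n by (auto simp: parking_rate_def of_nat_diff)
  qed
  show "map (parking_rate n \<pi>) ((n - 1) # [1..<n-1]) = map real (active_counts (tl ?c))"
  proof (rule nth_equalityI)
    fix i assume "i < length (map (parking_rate n \<pi>) ((n - 1) # [1..<n-1]))"
    then have i: "i < n - 1" using n by simp
    show "map (parking_rate n \<pi>) ((n - 1) # [1..<n-1]) ! i = map real (active_counts (tl ?c)) ! i"
    proof (cases i)
      case 0
      then show ?thesis using first i counts_nth[of 0] sum_kappa_parking[OF p order_refl] n by simp
    next
      case (Suc l)
      then show ?thesis using i rate[of i] counts_nth[of i] by simp
    qed
  qed (use n in simp)
  show "parking_rate n \<pi> i \<ge> 1" if "i \<in> {1..n-1}"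
    using that rate[of i] first by (cases "i = n - 1") auto
qed

section \<open>The law of the parking sum\<close>

lemma hypoexp_nonneg:
  assumes "\<forall>r\<in>set rs. r \<ge> 0" "t \<ge> 0"
  shows "hypoexp_cdf rs t \<ge> 0"
  using assms
proof (induction rs arbitrary: t)
  case (Cons r rs)
  have "continuous_on {0..t} (\<lambda>s. exp (r * s) * hypoexp_cdf rs s)"
    using continuous_on_subset[OF hypoexp_continuous, of "{0..t}"] by (auto intro!: continuous_intros)
  then have "integral {0..t} (\<lambda>s. exp (r * s) * hypoexp_cdf rs s) \<ge> 0"
    using Cons by (intro integral_nonneg integrable_continuous_real) auto
  then show ?case using Cons by (simp add: hypoexp_cdf.simps(2))
qed simp

text \<open>The convolution form of the recursion: first stage of length \<open>y\<close>, the
  others within \<open>t - y\<close>. In the derivative of the primitive \<open>F\<close> the terms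
  with \<open>hypoexp_cdf (r # rs)\<close> cancel.\<close>

lemma has_integral_hypoexp_Cons:
  assumes t: "t \<ge> 0"
  shows "((\<lambda>y. r * exp (- y * r) * hypoexp_cdf rs (t - y)) has_integral hypoexp_cdf (r # rs) t) {0..t}"
proof -
  define F where "F y = - exp (- y * r) * hypoexp_cdf (r # rs) (t - y)" for y
  have "(F has_vector_derivative r * exp (- y * r) * hypoexp_cdf rs (t - y)) (at y within {0..t})"
    if y: "y \<in> {0..t}" for y
  proof -
    have "(hypoexp_cdf (r # rs) has_real_derivative r * (hypoexp_cdf rs (t - y) - hypoexp_cdf (r # rs) (t - y)))
        (at (t - y) within (\<lambda>y. t - y) ` {0..t})"
      using y by (intro DERIV_subset[OF hypoexp_derivative]) auto
    moreover have "((\<lambda>y. t - y) has_real_derivative -1) (at y within {0..t})"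
      by (auto intro!: derivative_eq_intros)
    ultimately have "((\<lambda>y. hypoexp_cdf (r # rs) (t - y)) has_real_derivative
        r * (hypoexp_cdf rs (t - y) - hypoexp_cdf (r # rs) (t - y)) * -1) (at y within {0..t})"
      using DERIV_image_chain[of "hypoexp_cdf (r # rs)" _ "\<lambda>y. t - y" y "{0..t}" "-1"] by (simp add: o_def)
    moreover have "((\<lambda>y. - exp (- y * r)) has_real_derivative r * exp (- y * r)) (at y within {0..t})"
      by (auto intro!: derivative_eq_intros)
    ultimately have "(F has_real_derivative r * exp (- y * r) * hypoexp_cdf (r # rs) (t - y)
        + r * (hypoexp_cdf rs (t - y) - hypoexp_cdf (r # rs) (t - y)) * -1 * - exp (- y * r)) (at y within {0..t})"
      unfolding F_def[abs_def] by (rule DERIV_mult[rotated])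
    also have "r * exp (- y * r) * hypoexp_cdf (r # rs) (t - y)
        + r * (hypoexp_cdf rs (t - y) - hypoexp_cdf (r # rs) (t - y)) * -1 * - exp (- y * r)
        = r * exp (- y * r) * hypoexp_cdf rs (t - y)" by (simp add: algebra_simps)
    finally show ?thesis by (simp add: has_real_derivative_iff_has_vector_derivative)
  qed
  from fundamental_theorem_of_calculus[OF t this] show ?thesis by (simp add: F_def)
qed

section \<open>Exponential laws and their products\<close>

lemma sets_exp_distribution [measurable_cong, simp]: "sets (exp_distribution r) = sets borel"
  by (simp add: exp_distribution_def)

lemma prob_space_exp_distribution: "r > 0 \<Longrightarrow> prob_space (exp_distribution r)"
  unfolding exp_distribution_def by (rule prob_space_exponential_density)

text \<open>The density is then nonpositive, and \<open>ennreal\<close> cuts it off at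
  \<open>0\<close>.\<close>

lemma exp_distribution_null: "r \<le> 0 \<Longrightarrow> emeasure (exp_distribution r) B = 0"
proof -
  assume "r \<le> 0"
  then have "ennreal (exponential_density r x) = 0" for x
    by (auto simp: exponential_density_def ennreal_neg mult_nonpos_nonneg)
  then show ?thesis
    by (cases "B \<in> sets borel") (simp_all add: exp_distribution_def emeasure_density emeasure_notin_sets)
qed

text \<open>The law of the theorem binds over all lists, not only parking functions, so nonpositive rates
  occur in measurability obligations; there \<open>exp_distribution\<close> is the null measure.\<close>

lemma subprob_space_exp_distribution: "subprob_space (exp_distribution r)"
proof (cases "r > 0")
  case True
  then show ?thesis using prob_space_exp_distribution prob_space_imp_subprob_space by blast
next
  case False
  then show ?thesis
    by (intro subprob_spaceI) (auto simp: exp_distribution_null, simp add: exp_distribution_def)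
qed

lemma subprob_space_PiM_exp_distribution:
  assumes "finite I"
  shows "subprob_space (\<Pi>\<^sub>M i\<in>I. exp_distribution (r i))"
proof
  interpret product_sigma_finite "\<lambda>i. exp_distribution (r i)"
    using subprob_space_exp_distribution subprob_space_imp_sigma_finite by (auto simp: product_sigma_finite_def)
  have "emeasure (\<Pi>\<^sub>M i\<in>I. exp_distribution (r i)) (space (\<Pi>\<^sub>M i\<in>I. exp_distribution (r i)))
      = (\<Prod>i\<in>I. emeasure (exp_distribution (r i)) (space (exp_distribution (r i))))"
    unfolding space_PiM using assms by (intro emeasure_PiM sets.top) 
  also have "\<dots> \<le> 1"
    by (intro prod_le_1) (auto intro!: subprob_space.emeasure_space_le_1 subprob_space_exp_distribution)
  finally show "emeasure (\<Pi>\<^sub>M i\<in>I. exp_distribution (r i)) (space (\<Pi>\<^sub>M i\<in>I. exp_distribution (r i))) \<le> 1" .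
  show "space (\<Pi>\<^sub>M i\<in>I. exp_distribution (r i)) \<noteq> {}"
    by (auto simp: space_PiM exp_distribution_def PiE_eq_empty_iff)
qed

text \<open>Integrating out one coordinate at a time yields the convolution recursion. The left side
  depends only on the index set, so the rates may be enumerated in any order; this absorbs the
  cyclic shift.\<close>

lemma nn_integral_PiM_exp_sum:
  assumes r: "\<And>i. r i > 0" and "distinct xs"
  shows "(\<integral>\<^sup>+ T. indicator {..t} (\<Sum>i\<in>set xs. T i) \<partial>(\<Pi>\<^sub>M i\<in>set xs. exp_distribution (r i)))
    = (if t \<ge> 0 then ennreal (hypoexp_cdf (map r xs) t) else 0)"
  using \<open>distinct xs\<close>
proof (induction xs arbitrary: t)
  case Nil
  then show ?case by (simp add: PiM_empty nn_integral_count_space_finite)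
next
  case (Cons i xs)
  interpret product_sigma_finite "\<lambda>i. exp_distribution (r i)"
    using subprob_space_exp_distribution subprob_space_imp_sigma_finite by (auto simp: product_sigma_finite_def)
  have i: "i \<notin> set xs" using Cons.prems by simp
  have "(\<integral>\<^sup>+ T. indicator {..t} (\<Sum>i\<in>set (i # xs). T i) \<partial>(\<Pi>\<^sub>M i\<in>set (i # xs). exp_distribution (r i)))
      = (\<integral>\<^sup>+ y. (\<integral>\<^sup>+ T. indicator {..t} (\<Sum>j\<in>insert i (set xs). (T(i := y)) j)
          \<partial>(\<Pi>\<^sub>M i\<in>set xs. exp_distribution (r i))) \<partial>exp_distribution (r i))"
    using i by (simp only: set_simps, intro product_nn_integral_insert_rev) simp_all
  also have "\<dots> = (\<integral>\<^sup>+ y. (\<integral>\<^sup>+ T. indicator {..t - y} (\<Sum>j\<in>set xs. T j)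
          \<partial>(\<Pi>\<^sub>M i\<in>set xs. exp_distribution (r i))) \<partial>exp_distribution (r i))"
  proof (intro nn_integral_cong)
    fix y :: real and T :: "_ \<Rightarrow> real"
    have "(\<Sum>j\<in>insert i (set xs). (T(i := y)) j) = y + (\<Sum>j\<in>set xs. T j)"
      using i by (subst sum.insert) (auto intro!: sum.cong arg_cong[where f = "(+) y"])
    then show "(indicator {..t} (\<Sum>j\<in>insert i (set xs). (T(i := y)) j) :: ennreal) = indicator {..t - y} (\<Sum>j\<in>set xs. T j)"
      by (auto split: split_indicator)
  qed
  also have "\<dots> = (\<integral>\<^sup>+ y. (if t - y \<ge> 0 then ennreal (hypoexp_cdf (map r xs) (t - y)) else 0) \<partial>exp_distribution (r i))"
    using Cons by simp
  also have "\<dots> = (\<integral>\<^sup>+ y. ennreal (r i * exp (- y * r i) * hypoexp_cdf (map r xs) (t - y)) * indicator {0..t} y \<partial>lborel)"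
  proof -
    \<comment> \<open>\<open>hypoexp_cdf\<close> is known to be continuous only on
      \<open>{0..}\<close>, so measurability is obtained after restriction to
      \<open>y \<le> t\<close>.\<close>
    have "(\<lambda>y. indicator {..t} y *\<^sub>R hypoexp_cdf (map r xs) (t - y)) \<in> borel_measurable borel"
      by (intro borel_measurable_continuous_on_indicator continuous_on_compose2[OF hypoexp_continuous])
        (auto intro!: continuous_intros)
    then have "(\<lambda>y. ennreal (indicator {..t} y *\<^sub>R hypoexp_cdf (map r xs) (t - y))) \<in> borel_measurable borel" by simp
    also have "(\<lambda>y. ennreal (indicator {..t} y *\<^sub>R hypoexp_cdf (map r xs) (t - y)))
        = (\<lambda>y. if y \<le> t then ennreal (hypoexp_cdf (map r xs) (t - y)) else 0)"
      by (auto simp: fun_eq_iff)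
    finally have [measurable]: "(\<lambda>y. if y \<le> t then ennreal (hypoexp_cdf (map r xs) (t - y)) else 0) \<in> borel_measurable borel" .
    show ?thesis
      unfolding exp_distribution_def
      using hypoexp_nonneg[of "map r xs"] r
      by (subst nn_integral_density)
        (auto intro!: nn_integral_cong simp: exponential_density_def ennreal_mult' less_imp_le
          split: split_indicator)
  qed
  also have "\<dots> = (if t \<ge> 0 then ennreal (hypoexp_cdf (map r (i # xs)) t) else 0)"
  proof (cases "t \<ge> 0")
    case True
    have "(\<integral>\<^sup>+ y. ennreal (r i * exp (- y * r i) * hypoexp_cdf (map r xs) (t - y)) * indicator {0..t} y \<partial>lborel)
        = ennreal (hypoexp_cdf (r i # map r xs) t)"
      using hypoexp_nonneg[of "map r xs"] r has_integral_hypoexp_Cons[OF True]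
      by (intro nn_integral_has_integral_lebesgue') (auto simp: less_imp_le)
    then show ?thesis using True by simp
  qed simp
  finally show ?case .
qed

lemma emeasure_parking_sum:
  assumes n: "n \<ge> 1" and p: "\<pi> \<in> parking_functions (n - 1)" and c: "c > 0"
  shows "emeasure (distr (\<Pi>\<^sub>M i\<in>{1..n - 1}. exp_distribution (parking_rate n \<pi> i)) borel
       (\<lambda>T. c * (\<Sum>i = 1..n - 1. T i))) {..t}
    = (if t \<ge> 0 then ennreal (hypoexp_cdf (map real (active_counts (tl (offspring_counts n \<pi>)))) (t / c)) else 0)"
proof -
  obtain xs where xs: "distinct xs" "set xs = {1..n-1}"
      "map (parking_rate n \<pi>) xs = map real (active_counts (tl (offspring_counts n \<pi>)))"
  proof (cases "n = 1")
    case True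
    then have "tl (offspring_counts n \<pi>) = []" by (simp add: offspring_counts_def)
    then show ?thesis using that[of "[]"] True by simp
  next
    case False
    show ?thesis
      by (rule that[of "(n - 1) # [1..<n-1]"]) (use n False parking_rate_eq_active_counts(1)[OF _ p] in auto)
  qed
  \<comment> \<open>The value \<open>1\<close> outside the index set makes all rates positive, as
    the product formula asks.\<close>
  define r where "r i = (if i \<in> {1..n-1} then parking_rate n \<pi> i else 1)" for i
  have r: "r i > 0" for i
    using parking_rate_eq_active_counts(2)[OF _ p, of i] by (force simp: r_def)
  have P: "(\<Pi>\<^sub>M i\<in>{1..n - 1}. exp_distribution (parking_rate n \<pi> i)) = (\<Pi>\<^sub>M i\<in>set xs. exp_distribution (r i))"
    using xs by (intro PiM_cong) (auto simp: r_def)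
  have "emeasure (distr (\<Pi>\<^sub>M i\<in>{1..n - 1}. exp_distribution (parking_rate n \<pi> i)) borel
       (\<lambda>T. c * (\<Sum>i = 1..n - 1. T i))) {..t} =
     (\<integral>\<^sup>+ T. indicator {..t} (c * (\<Sum>i = 1..n - 1. T i)) \<partial>(\<Pi>\<^sub>M i\<in>{1..n - 1}. exp_distribution (parking_rate n \<pi> i)))"
    by (subst nn_integral_indicator[symmetric], simp, subst nn_integral_distr) simp_all
  also have "\<dots> = (\<integral>\<^sup>+ T. indicator {..t / c} (\<Sum>i\<in>set xs. T i) \<partial>(\<Pi>\<^sub>M i\<in>set xs. exp_distribution (r i)))"
    unfolding P using c xs by (intro nn_integral_cong) (auto simp: field_simps split: split_indicator)
  also have "\<dots> = (if t / c \<ge> 0 then ennreal (hypoexp_cdf (map r xs) (t / c)) else 0)"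
    by (rule nn_integral_PiM_exp_sum) (use r xs in auto)
  also have "map r xs = map real (active_counts (tl (offspring_counts n \<pi>)))"
    unfolding xs(3)[symmetric] using xs(2) by (auto simp: r_def)
  finally show ?thesis using c by (simp add: zero_le_divide_iff)
qed

lemma weight_nonneg: "weight c \<ge> 0"
  by (induction c) auto

text \<open>The joint law of \<open>N\<close> and the sum, evaluated at \<open>N = n\<close> and \<open>{..t}\<close>, with the factor \<open>1 / \<beta>\<close> left out.\<close>

definition parking_cdf :: "real \<Rightarrow> nat \<Rightarrow> real \<Rightarrow> real" where
  "parking_cdf \<rho> n t = exp (- \<rho> * real n) * \<rho> ^ (n - 1) *
     (\<Sum>c\<in>paths n 0. weight c * hypoexp_cdf (map real (active_counts (tl c))) t)"

text \<open>The Borel weight contributes \<open>n ^ (n - 1) / fact n\<close>, the uniform law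
  divides by \<open>n ^ (n - 1) / n\<close>, and grouping by content contributes
  \<open>fact (n - 1)\<close>. These factors cancel.\<close>

lemma emeasure_parking_exp_sum_law:
  assumes \<rho>: "\<rho> > 0" and c: "c > 0"
  shows "emeasure (parking_exp_sum_law \<rho> c) {..t} =
      (if t \<ge> 0 then \<Sum>n. ennreal (parking_cdf \<rho> (Suc n) (t / c)) else 0)"
    and "sets (parking_exp_sum_law \<rho> c) = sets borel"
proof -
  define D where "D n \<pi> = distr (\<Pi>\<^sub>M i\<in>{1..n - 1}. exp_distribution (parking_rate n \<pi> i)) borel
       (\<lambda>T. c * (\<Sum>i = 1..n - 1. T i))" for n \<pi>
  define K where "K n = measure_pmf (uniform_parking_function (n - 1)) \<bind> D n" for n
  have D: "D n \<in> measurable (measure_pmf q) (subprob_algebra borel)" for n q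
    unfolding D_def[abs_def]
    by (auto simp: space_subprob_algebra intro!: subprob_space.subprob_space_distr subprob_space_PiM_exp_distribution)
  have K: "K \<in> measurable (borel_distribution \<rho>) (subprob_algebra borel)"
    unfolding K_def[abs_def] borel_distribution_def
    by (auto intro!: subprob_space.bind_in_space D measure_pmf.subprob_space_axioms)
  have ne: "space (borel_distribution \<rho>) \<noteq> {}"
    by (auto simp: borel_distribution_def)
  have law: "parking_exp_sum_law \<rho> c = borel_distribution \<rho> \<bind> K"
    by (simp add: parking_exp_sum_law_def K_def[abs_def] D_def[abs_def])
  show "sets (parking_exp_sum_law \<rho> c) = sets borel"
    unfolding law using K ne by (rule sets_bind_measurable)
  have emeasure_K: "ennreal (exp (- \<rho> * real n) / fact n * (\<rho> * real n) ^ (n - 1)) * emeasure (K n) {..t}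
      = (if t \<ge> 0 then ennreal (parking_cdf \<rho> n (t / c)) else 0)" if n: "n \<ge> 1" for n
  proof -
    have "emeasure (K n) {..t} = (\<integral>\<^sup>+ \<pi>. emeasure (D n \<pi>) {..t} \<partial>measure_pmf (uniform_parking_function (n - 1)))"
      unfolding K_def by (rule emeasure_bind[OF _ D]) auto
    also have "\<dots> = (\<Sum>\<pi>\<in>parking_functions (n - 1). emeasure (D n \<pi>) {..t}) / real (card (parking_functions (n - 1)))"
      unfolding uniform_parking_function_def
      by (simp add: nn_integral_pmf_of_set[OF parking_functions_nonempty finite_parking_functions]
          ennreal_of_nat_eq_real_of_nat)
    finally have K_eq: "emeasure (K n) {..t} = \<dots>" .
    show ?thesis
    proof (cases "t \<ge> 0")
      case False
      then show ?thesis unfolding K_eq D_def using emeasure_parking_sum[OF n _ c] by simp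
    next
      case True
      define h where "h b = hypoexp_cdf (map real (active_counts (tl b))) (t / c)" for b
      have h: "h b \<ge> 0" for b using True c by (auto simp: h_def intro!: hypoexp_nonneg)
      have card: "card (parking_functions (n - 1)) > 0"
        using parking_functions_nonempty finite_parking_functions by (simp add: card_gt_0_iff)
      have "(\<Sum>\<pi>\<in>parking_functions (n - 1). emeasure (D n \<pi>) {..t})
          = ennreal (\<Sum>\<pi>\<in>parking_functions (n - 1). h (offspring_counts n \<pi>))"
        using emeasure_parking_sum[OF n _ c] True h by (simp add: D_def h_def)
      also have "\<dots> = ennreal (fact (n - 1) * (\<Sum>b\<in>paths n 0. weight b * h b))"
        using sum_parking_functions[OF n, of h] by simp
      finally have "emeasure (K n) {..t} =
          ennreal (fact (n - 1) * (\<Sum>b\<in>paths n 0. weight b * h b) / real (card (parking_functions (n - 1))))"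
        unfolding K_eq using card h
        by (subst divide_ennreal[symmetric])
          (auto intro!: sum_nonneg mult_nonneg_nonneg simp: weight_nonneg)
      also have "fact (n - 1) * (\<Sum>b\<in>paths n 0. weight b * h b) / real (card (parking_functions (n - 1)))
          = fact n * (\<Sum>b\<in>paths n 0. weight b * h b) / real n ^ (n - 1)"
        using n unfolding card_parking_functions[OF n] by (cases n) auto
      also have "ennreal (exp (- \<rho> * real n) / fact n * (\<rho> * real n) ^ (n - 1)) * ennreal \<dots> =
          ennreal ((exp (- \<rho> * real n) / fact n * (\<rho> * real n) ^ (n - 1)) *
            (fact n * (\<Sum>b\<in>paths n 0. weight b * h b) / real n ^ (n - 1)))"
        using \<rho> by (subst ennreal_mult') auto
      also have "(exp (- \<rho> * real n) / fact n * (\<rho> * real n) ^ (n - 1)) *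
            (fact n * (\<Sum>b\<in>paths n 0. weight b * h b) / real n ^ (n - 1)) = parking_cdf \<rho> n (t / c)"
        using n by (simp add: parking_cdf_def h_def power_mult_distrib)
      finally show ?thesis using True by simp
    qed
  qed
  have "emeasure (parking_exp_sum_law \<rho> c) {..t} = (\<integral>\<^sup>+ n. emeasure (K n) {..t} \<partial>borel_distribution \<rho>)"
    unfolding law by (rule emeasure_bind[OF ne K]) simp
  also have "\<dots> = (\<integral>\<^sup>+ n. ennreal (exp (- \<rho> * real n) / fact n * (\<rho> * real n) ^ (n - 1)) * emeasure (K n) {..t}
      \<partial>count_space {1..})"
    unfolding borel_distribution_def by (subst nn_integral_density) simp_all
  also have "\<dots> = (\<integral>\<^sup>+ n. (if t \<ge> 0 then ennreal (parking_cdf \<rho> n (t / c)) else 0) \<partial>count_space {1..})"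
    by (intro nn_integral_cong emeasure_K) simp
  also have "\<dots> = (\<integral>\<^sup>+ n. (if t \<ge> 0 then ennreal (parking_cdf \<rho> (Suc n) (t / c)) else 0) \<partial>count_space UNIV)"
    by (rule nn_integral_bij_count_space[symmetric], rule bij_betw_byWitness[of _ "\<lambda>n. n - 1"]) auto
  also have "\<dots> = (if t \<ge> 0 then \<Sum>n. ennreal (parking_cdf \<rho> (Suc n) (t / c)) else 0)"
    by (simp add: nn_integral_count_space_nat)
  finally show "emeasure (parking_exp_sum_law \<rho> c) {..t} =
      (if t \<ge> 0 then \<Sum>n. ennreal (parking_cdf \<rho> (Suc n) (t / c)) else 0)" .
qed

section \<open>Increments of Hawkes clusters\<close>

text \<open>First order expansion along the decay of the intensity between events. The flow stays
  inside the compact interval, so applying the mean value theorem twice gives an error uniform in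
  \<open>x\<close>.\<close>

lemma decay_expansion:
  fixes f f1 f2 :: "real \<Rightarrow> real"
  assumes f: "\<And>x. (f has_real_derivative f1 x) (at x)"
    and f1: "\<And>x. (f1 has_real_derivative f2 x) (at x)"
    and f2: "continuous_on UNIV f2"
  obtains c where "c \<ge> 0"
    "\<And>x h. 0 \<le> x \<Longrightarrow> x \<le> K \<Longrightarrow> 0 \<le> h \<Longrightarrow> \<bar>f (exp (- h) * x) - f x + h * (x * f1 x)\<bar> \<le> c * h\<^sup>2"
proof -
  \<comment> \<open>\<open>g (exp (- s) * x)\<close> is the second derivative of
    \<open>f (exp (- s) * x)\<close> in \<open>s\<close>.\<close>
  define g where "g y = (f1 y + y * f2 y) * y" for y
  have c1: "continuous_on {0..K} f1"
    by (intro DERIV_continuous_on) (use f1 in \<open>auto intro: has_field_derivative_at_within\<close>)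
  have "continuous_on {0..K} g"
    unfolding g_def by (intro continuous_intros c1 continuous_on_subset[OF f2]) auto
  then have "compact (g ` {0..K})" by (intro compact_continuous_image) auto
  then obtain c where c: "c \<ge> 0" "\<And>y. y \<in> {0..K} \<Longrightarrow> \<bar>g y\<bar> \<le> c"
    using compact_imp_bounded bounded_pos by (metis bounded_iff imageI less_imp_le real_norm_def)
  show ?thesis
  proof (rule that[OF c(1)])
    fix x h :: real assume x: "0 \<le> x" "x \<le> K" and h: "0 \<le> h"
    have range: "exp (- s) * x \<in> {0..K}" if "s \<ge> 0" for s
      using that x mult_left_le_one_le[of x "exp (- s)"] by auto
    define \<phi> where "\<phi> s = exp (- s) * x * f1 (exp (- s) * x)" for s
    have \<phi>': "(\<phi> has_real_derivative - g (exp (- s) * x)) (at s)" for s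
      unfolding \<phi>_def g_def
      by (auto intro!: derivative_eq_intros DERIV_chain2[OF f1] simp: algebra_simps)
    have \<phi>_lip: "\<bar>\<phi> s - \<phi> 0\<bar> \<le> c * s" if s: "s > 0" for s
    proof -
      obtain z where z: "0 < z" "z < s" "\<phi> s - \<phi> 0 = (s - 0) * - g (exp (- z) * x)"
        using MVT2[OF s, of \<phi> "\<lambda>s. - g (exp (- s) * x)"] \<phi>' by blast
      have "\<bar>\<phi> s - \<phi> 0\<bar> = s * \<bar>g (exp (- z) * x)\<bar>" using z s by (simp add: abs_mult)
      also have "\<dots> \<le> s * c" using c(2)[OF range[of z]] z s by (intro mult_left_mono) auto
      finally show ?thesis by (simp add: mult.commute)
    qed
    show "\<bar>f (exp (- h) * x) - f x + h * (x * f1 x)\<bar> \<le> c * h\<^sup>2"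
    proof (cases "h = 0")
      case False
      then have h: "h > 0" using h by simp
      define \<psi> where "\<psi> s = f (exp (- s) * x) + s * \<phi> 0" for s
      have \<psi>': "(\<psi> has_real_derivative - \<phi> s + \<phi> 0) (at s)" for s
        unfolding \<psi>_def \<phi>_def
        by (auto intro!: derivative_eq_intros DERIV_chain2[OF f])
      obtain z where z: "0 < z" "z < h" "\<psi> h - \<psi> 0 = (h - 0) * (- \<phi> z + \<phi> 0)"
        using MVT2[OF h, of \<psi> "\<lambda>s. - \<phi> s + \<phi> 0"] \<psi>' by blast
      have "\<bar>\<psi> h - \<psi> 0\<bar> = h * \<bar>\<phi> z - \<phi> 0\<bar>" using z h by (simp add: abs_mult abs_minus_commute)
      also have "\<dots> \<le> h * (c * z)" using \<phi>_lip[OF z(1)] h by (intro mult_left_mono) auto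
      also have "\<dots> \<le> h * (c * h)" using z h c by (intro mult_left_mono) auto
      finally show ?thesis by (simp add: \<psi>_def \<phi>_def power2_eq_square algebra_simps)
    qed simp
  qed
qed

lemma lipschitz_on_interval:
  fixes f f1 :: "real \<Rightarrow> real"
  assumes f: "\<And>x. (f has_real_derivative f1 x) (at x)" and f1: "continuous_on UNIV f1"
  obtains c where "c \<ge> 0" "\<And>x y. x \<in> {0..K} \<Longrightarrow> y \<in> {0..K} \<Longrightarrow> \<bar>f x - f y\<bar> \<le> c * \<bar>x - y\<bar>"
proof -
  have "compact (f1 ` {0..K})" by (intro compact_continuous_image continuous_on_subset[OF f1]) auto
  then obtain c where c: "c \<ge> 0" "\<And>y. y \<in> {0..K} \<Longrightarrow> \<bar>f1 y\<bar> \<le> c"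
    using compact_imp_bounded bounded_pos by (metis bounded_iff imageI less_imp_le real_norm_def)
  have "\<bar>f x - f y\<bar> \<le> c * \<bar>x - y\<bar>" if "x \<in> {0..K}" "y \<in> {0..K}" for x y
    using field_differentiable_bound[of "{0..K}" f f1 c y x] has_field_derivative_at_within[OF f] c that
    by (simp add: abs_minus_commute)
  with c show ?thesis using that by blast
qed

lemma bounded_on_interval:
  fixes f :: "real \<Rightarrow> real"
  assumes f: "continuous_on UNIV f"
  obtains c where "c \<ge> 0" "\<And>x. 0 \<le> x \<Longrightarrow> x \<le> K \<Longrightarrow> \<bar>f x\<bar> \<le> c"
proof -
  have "compact (f ` {0..K})" by (intro compact_continuous_image continuous_on_subset[OF f]) auto
  then obtain c where c: "c \<ge> 0" "\<And>y. y \<in> {0..K} \<Longrightarrow> \<bar>f y\<bar> \<le> c"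
    using compact_imp_bounded bounded_pos by (metis bounded_iff imageI less_imp_le real_norm_def)
  then show ?thesis using that by auto
qed

lemma down_closed_nat_set:
  fixes S :: "nat set"
  assumes "finite S" and closed: "\<And>i j. i \<in> S \<Longrightarrow> j \<le> i \<Longrightarrow> j \<in> S"
  shows "i \<in> S \<longleftrightarrow> i < card S"
proof
  assume "i \<in> S"
  then have "{..i} \<subseteq> S" using closed by auto
  from card_mono[OF assms(1) this] show "i < card S" by simp
next
  assume i: "i < card S"
  show "i \<in> S"
  proof (rule ccontr)
    assume "i \<notin> S"
    then have "S \<subseteq> {..<i}" using closed by (metis lessThan_iff not_le subsetI)
    from card_mono[OF _ this] i show False by simp
  qed
qed

context hawkes_cluster
begin

section \<open>Epochs, counts and the natural filtration\<close>

lemma epoch_mono: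
  assumes "\<omega> \<in> space M" "i \<le> j"
  shows "A i \<omega> \<le> A j \<omega>"
  using \<open>i \<le> j\<close>
proof (rule lift_Suc_mono_le[of "\<lambda>i. A i \<omega>", rotated])
  show "A n \<omega> \<le> A (Suc n) \<omega>" for n
    using epoch_less[OF assms(1), of n] epoch_infinite[OF assms(1), of n]
    by (cases "A n \<omega> = \<infinity>") (auto simp: less_imp_le)
qed

lemma epoch_nonneg: "\<omega> \<in> space M \<Longrightarrow> 0 \<le> A i \<omega>"
  using epoch_mono[of \<omega> 0 i] epoch_0 by simp

text \<open>The epochs are monotone, so the indices counted by time \<open>t\<close> form an initial
  segment of the naturals, which its cardinality determines.\<close>

lemma less_event_count_iff: "\<omega> \<in> space M \<Longrightarrow> i < event_count A t \<omega> \<longleftrightarrow> A i \<omega> \<le> ereal t"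
  unfolding event_count_def
  using down_closed_nat_set[OF locally_finite, of \<omega> t i] epoch_mono[of \<omega>]
  by (auto intro: order_trans)

lemma event_count_mono: "\<omega> \<in> space M \<Longrightarrow> s \<le> t \<Longrightarrow> event_count A s \<omega> \<le> event_count A t \<omega>"
  using less_event_count_iff[of \<omega> _ s] less_event_count_iff[of \<omega> _ t]
  by (meson ereal_less_eq(3) leI less_irrefl order_trans)

lemma event_count_pos: "\<omega> \<in> space M \<Longrightarrow> 0 \<le> t \<Longrightarrow> 0 < event_count A t \<omega>"
  using less_event_count_iff[of \<omega> 0 t] epoch_0 by simp

lemma event_count_0: "\<omega> \<in> space M \<Longrightarrow> event_count A 0 \<omega> = 1"
  using less_event_count_iff[of \<omega> 0 0] less_event_count_iff[of \<omega> 1 0] epoch_0[of \<omega>] epoch_less[of \<omega> 0]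
  by (auto simp: not_less intro: le_antisym simp flip: zero_ereal_def)

lemma event_count_eq_iff:
  assumes "\<omega> \<in> space M"
  shows "event_count A t \<omega> = k \<longleftrightarrow> (k = 0 \<or> A (k - 1) \<omega> \<le> ereal t) \<and> \<not> A k \<omega> \<le> ereal t"
  using less_event_count_iff[OF assms, of "k - 1" t] less_event_count_iff[OF assms, of k t] by auto

lemma event_count_measurable [measurable]: "event_count A t \<in> measurable M (count_space UNIV)"
proof (subst measurable_count_space_eq2_countable, intro conjI ballI)
  fix k
  note epoch_measurable [measurable]
  have "event_count A t -` {k} \<inter> space M = {\<omega> \<in> space M. (k = 0 \<or> A (k - 1) \<omega> \<le> ereal t) \<and> \<not> A k \<omega> \<le> ereal t}"
    using event_count_eq_iff by auto
  also have "\<dots> \<in> sets M" by measurable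
  finally show "event_count A t -` {k} \<inter> space M \<in> sets M" .
qed auto

abbreviation "\<F> \<equiv> natural_filtration M A"

lemma space_filtration [simp]: "space (\<F> t) = space M"
  by (auto simp: natural_filtration_def space_measure_of_conv)

lemma sets_filtration:
  "sets (\<F> t) = sigma_sets (space M) {{\<omega> \<in> space M. event_count A s \<omega> = k} | s k. 0 \<le> s \<and> s \<le> t}"
  unfolding natural_filtration_def by (rule sets_measure_of) auto

lemma subalgebra_filtration: "subalgebra M (\<F> t)"
proof -
  have "sets (\<F> t) \<subseteq> sets M"
    unfolding sets_filtration by (rule sets.sigma_sets_subset) auto
  then show ?thesis by (simp add: subalgebra_def)
qed

lemma filtration_mono: "s \<le> t \<Longrightarrow> sets (\<F> s) \<subseteq> sets (\<F> t)"
  unfolding sets_filtration by (intro sigma_sets_mono') force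

lemma event_count_filtration_measurable:
  assumes "0 \<le> s" "s \<le> t"
  shows "event_count A s \<in> measurable (\<F> t) (count_space UNIV)"
proof (subst measurable_count_space_eq2_countable, intro conjI ballI)
  fix k
  have "event_count A s -` {k} \<inter> space (\<F> t) = {\<omega> \<in> space M. event_count A s \<omega> = k}" by auto
  also have "\<dots> \<in> sets (\<F> t)" unfolding sets_filtration using assms by (intro sigma_sets.Basic) auto
  finally show "event_count A s -` {k} \<inter> space (\<F> t) \<in> sets (\<F> t)" .
qed auto

text \<open>At time \<open>t\<close> an epoch is observable only as far as it lies before
  \<open>t\<close>: for \<open>y < t\<close> the event is a statement about the count at
  \<open>y\<close>, and for \<open>y \<ge> t\<close> the cut-off makes it trivial.\<close>

lemma stopped_epoch_measurable:
  assumes "0 \<le> t"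
  shows "(\<lambda>\<omega>. real_of_ereal (min (A i \<omega>) (ereal t))) \<in> borel_measurable (\<F> t)"
proof (rule borel_measurableI_le)
  fix y
  have range: "\<exists>r. A i \<omega> = ereal r \<and> 0 \<le> r \<or> A i \<omega> = \<infinity>" if "\<omega> \<in> space M" for \<omega>
    using epoch_nonneg[OF that, of i] by (cases "A i \<omega>") auto
  consider "y < 0" | "0 \<le> y" "y < t" | "y \<ge> t" by linarith
  then show "{\<omega> \<in> space (\<F> t). real_of_ereal (min (A i \<omega>) (ereal t)) \<le> y} \<in> sets (\<F> t)"
  proof cases
    case 1
    have "real_of_ereal (min (A i \<omega>) (ereal t)) \<ge> 0" if "\<omega> \<in> space M" for \<omega>
      using assms range[OF that] by (auto simp: min_def)
    then have "{\<omega> \<in> space M. real_of_ereal (min (A i \<omega>) (ereal t)) \<le> y} = {}"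
      using 1 by force
    then show ?thesis by (simp only: space_filtration sets.empty_sets)
  next
    case 2
    have [measurable]: "event_count A y \<in> measurable (\<F> t) (count_space UNIV)"
      using 2 by (intro event_count_filtration_measurable) auto
    have "real_of_ereal (min (A i \<omega>) (ereal t)) \<le> y \<longleftrightarrow> i < event_count A y \<omega>" if "\<omega> \<in> space M" for \<omega>
      unfolding less_event_count_iff[OF that]
      using 2 range[OF that] by (auto simp: min_def split: if_splits)
    then have "{\<omega> \<in> space (\<F> t). real_of_ereal (min (A i \<omega>) (ereal t)) \<le> y} = {\<omega> \<in> space (\<F> t). i < event_count A y \<omega>}"
      by auto
    also have "\<dots> \<in> sets (\<F> t)" using 2 by measurable
    finally show ?thesis .
  next
    case 3
    have "real_of_ereal (min (A i \<omega>) (ereal t)) \<le> y" if "\<omega> \<in> space M" for \<omega>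
      using 3 range[OF that] by (auto simp: min_def split: if_splits)
    then have "{\<omega> \<in> space (\<F> t). real_of_ereal (min (A i \<omega>) (ereal t)) \<le> y} = space (\<F> t)" by auto
    then show ?thesis by (simp only: sets.top)
  qed
qed

section \<open>Conditional probabilities tested against bounded variables\<close>

lemma bounded_integrable:
  fixes Y :: "'a \<Rightarrow> real"
  assumes "Y \<in> borel_measurable M" "\<And>\<omega>. \<omega> \<in> space M \<Longrightarrow> \<bar>Y \<omega>\<bar> \<le> C"
  shows "integrable M Y"
  using assms by (intro integrable_const_bound[where B = C]) auto

text \<open>This covers nonintegrable \<open>Y\<close> too, whose integral is \<open>0\<close> by
  convention; \<open>C\<close> is nonnegative because the space is nonempty.\<close>

lemma abs_expectation_le:
  fixes Y :: "'a \<Rightarrow> real"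
  assumes "\<And>\<omega>. \<omega> \<in> space M \<Longrightarrow> \<bar>Y \<omega>\<bar> \<le> C"
  shows "\<bar>expectation Y\<bar> \<le> C"
proof -
  have "C \<ge> 0" using assms not_empty by fastforce
  show ?thesis
  proof (cases "integrable M Y")
    case True
    have "\<bar>expectation Y\<bar> \<le> expectation (\<lambda>\<omega>. \<bar>Y \<omega>\<bar>)" by simp
    also have "\<dots> \<le> expectation (\<lambda>_. C)" using True assms by (intro integral_mono) auto
    finally show ?thesis by (simp add: prob_space)
  qed (use \<open>C \<ge> 0\<close> in \<open>simp add: not_integrable_integral_eq\<close>)
qed

text \<open>Here the reading of the remainders in the mean is used: a \<open>Y\<close> known at time
  \<open>t\<close> passes through the conditional expectation, and an \<open>L\<^sup>1\<close> error
  \<open>e\<close> costs at most \<open>C * e\<close>.\<close>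

lemma expectation_increment:
  fixes Y L :: "'a \<Rightarrow> real"
  assumes Y: "Y \<in> borel_measurable (\<F> t)" "\<And>\<omega>. \<omega> \<in> space M \<Longrightarrow> \<bar>Y \<omega>\<bar> \<le> C"
    and L: "L \<in> borel_measurable M" "\<And>\<omega>. \<omega> \<in> space M \<Longrightarrow> \<bar>Y \<omega> * L \<omega>\<bar> \<le> D"
    and R: "(\<integral>\<^sup>+ \<omega>. ennreal \<bar>increment_prob M A Q t \<delta> \<omega> - L \<omega>\<bar> \<partial>M) \<le> ennreal e" and e: "e \<ge> 0"
  shows "\<bar>expectation (\<lambda>\<omega>. Y \<omega> * of_bool (Q (event_count A (t + \<delta>) \<omega> - event_count A t \<omega>)))
      - expectation (\<lambda>\<omega>. Y \<omega> * L \<omega>)\<bar> \<le> C * e"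
proof -
  interpret F: finite_measure_subalgebra M "\<F> t"
    by unfold_locales (rule subalgebra_filtration)
  have Y_M [measurable]: "Y \<in> borel_measurable M"
    using measurable_from_subalg[OF subalgebra_filtration Y(1)] .
  note [measurable] = L(1)
  define E where "E = {\<omega> \<in> space M. Q (event_count A (t + \<delta>) \<omega> - event_count A t \<omega>)}"
  have [measurable]: "E \<in> sets M" unfolding E_def by measurable
  define P where "P = increment_prob M A Q t \<delta>"
  have P_def': "P = real_cond_exp M (\<F> t) (indicator E)"
    by (simp add: P_def increment_prob_def E_def)
  have [measurable]: "P \<in> borel_measurable M" unfolding P_def' by (rule borel_measurable_cond_exp2)
  have int_E: "integrable M (\<lambda>\<omega>. Y \<omega> * indicator E \<omega>)"
    using Y(2) by (intro bounded_integrable[where C = C]) (auto split: split_indicator intro: order_trans[OF abs_ge_zero])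
  have R': "integrable M (\<lambda>\<omega>. P \<omega> - L \<omega>)"
    using R unfolding P_def[symmetric] by (intro integrableI_bounded) (auto intro: le_less_trans)
  have "C \<ge> 0" using Y(2) not_empty by fastforce
  have int_P: "integrable M (\<lambda>\<omega>. Y \<omega> * P \<omega>)" "expectation (\<lambda>\<omega>. Y \<omega> * P \<omega>) = expectation (\<lambda>\<omega>. Y \<omega> * indicator E \<omega>)"
    unfolding P_def' using F.real_cond_exp_intg[OF int_E Y(1)] by auto
  have int_L: "integrable M (\<lambda>\<omega>. Y \<omega> * L \<omega>)" using L by (intro bounded_integrable[where C = D]) auto
  have "expectation (\<lambda>\<omega>. Y \<omega> * of_bool (Q (event_count A (t + \<delta>) \<omega> - event_count A t \<omega>)))
      = expectation (\<lambda>\<omega>. Y \<omega> * indicator E \<omega>)"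
    by (intro Bochner_Integration.integral_cong refl) (auto simp: E_def split: split_indicator)
  then have "\<bar>expectation (\<lambda>\<omega>. Y \<omega> * of_bool (Q (event_count A (t + \<delta>) \<omega> - event_count A t \<omega>)))
      - expectation (\<lambda>\<omega>. Y \<omega> * L \<omega>)\<bar> = \<bar>expectation (\<lambda>\<omega>. Y \<omega> * P \<omega> - Y \<omega> * L \<omega>)\<bar>"
    using int_P int_L by (simp add: Bochner_Integration.integral_diff)
  also have "\<dots> \<le> expectation (\<lambda>\<omega>. \<bar>Y \<omega> * P \<omega> - Y \<omega> * L \<omega>\<bar>)" by simp
  also have "\<dots> \<le> expectation (\<lambda>\<omega>. C * \<bar>P \<omega> - L \<omega>\<bar>)"
  proof (rule integral_mono)
    show "integrable M (\<lambda>\<omega>. \<bar>Y \<omega> * P \<omega> - Y \<omega> * L \<omega>\<bar>)" using int_P(1) int_L by simp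
    show "integrable M (\<lambda>\<omega>. C * \<bar>P \<omega> - L \<omega>\<bar>)" using R' by simp
    show "\<bar>Y \<omega> * P \<omega> - Y \<omega> * L \<omega>\<bar> \<le> C * \<bar>P \<omega> - L \<omega>\<bar>" if "\<omega> \<in> space M" for \<omega>
      using Y(2)[OF that] by (simp add: abs_mult mult_right_mono flip: right_diff_distrib)
  qed
  also have "\<dots> = C * expectation (\<lambda>\<omega>. \<bar>P \<omega> - L \<omega>\<bar>)" by simp
  also have "\<dots> \<le> C * e"
  proof (rule mult_left_mono[OF _ \<open>C \<ge> 0\<close>])
    have "ennreal (expectation (\<lambda>\<omega>. \<bar>P \<omega> - L \<omega>\<bar>)) = (\<integral>\<^sup>+ \<omega>. ennreal \<bar>P \<omega> - L \<omega>\<bar> \<partial>M)"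
      using R' by (intro nn_integral_eq_integral[symmetric]) auto
    then show "expectation (\<lambda>\<omega>. \<bar>P \<omega> - L \<omega>\<bar>) \<le> e"
      using R e unfolding P_def[symmetric] by (metis ennreal_le_iff)
  qed
  finally show ?thesis .
qed

end

section \<open>The Markovian cluster\<close>

locale exponential_hawkes_cluster = hawkes_cluster M A "\<lambda>x. \<alpha> * exp (- \<beta> * x)"
  for M :: "'a measure" and A \<alpha> \<beta> +
  assumes alpha_pos: "0 < \<alpha>" and alpha_less_beta: "\<alpha> < \<beta>"
begin

definition \<rho> :: real where "\<rho> = \<alpha> / \<beta>"

abbreviation N :: "real \<Rightarrow> 'a \<Rightarrow> nat" where "N \<equiv> event_count A"

definition X :: "real \<Rightarrow> 'a \<Rightarrow> real" where
  "X t \<omega> = (\<Sum>i<N t \<omega>. \<rho> * exp (- \<beta> * (t - real_of_ereal (A i \<omega>))))"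

lemma beta_pos: "0 < \<beta>" using alpha_pos alpha_less_beta by simp
lemma rho_pos: "0 < \<rho>" using alpha_pos beta_pos by (simp add: \<rho>_def)
lemma rho_less_1: "\<rho> < 1" using alpha_less_beta beta_pos by (simp add: \<rho>_def)

lemma intensity_eq: "hawkes_intensity (\<lambda>x. \<alpha> * exp (- \<beta> * x)) A t \<omega> = \<beta> * X t \<omega>"
  using beta_pos by (simp add: hawkes_intensity_def X_def sum_distrib_left \<rho>_def)

lemma X_nonneg: "0 \<le> X t \<omega>"
  using rho_pos by (auto simp: X_def intro!: sum_nonneg)

lemma epoch_real:
  assumes "\<omega> \<in> space M" "i < N t \<omega>"
  obtains r where "A i \<omega> = ereal r" "0 \<le> r" "r \<le> t"
  using assms epoch_nonneg[of \<omega> i] by (cases "A i \<omega>") (auto simp: less_event_count_iff)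

lemma X_le: 
  assumes "\<omega> \<in> space M"
  shows "X t \<omega> \<le> \<rho> * real (N t \<omega>)"
proof -
  have "\<rho> * exp (- \<beta> * (t - real_of_ereal (A i \<omega>))) \<le> \<rho>" if i: "i < N t \<omega>" for i
  proof -
    obtain r where "A i \<omega> = ereal r" "0 \<le> r" "r \<le> t" by (rule epoch_real[OF assms i])
    then have "exp (- \<beta> * (t - real_of_ereal (A i \<omega>))) \<le> 1" using beta_pos by simp
    then show ?thesis using rho_pos by (simp add: mult_left_le)
  qed
  then have "X t \<omega> \<le> (\<Sum>i<N t \<omega>. \<rho>)" unfolding X_def by (intro sum_mono) auto
  then show ?thesis by (simp add: mult.commute)
qed

lemma X_filtration_measurable:
  assumes "0 \<le> t"
  shows "X t \<in> borel_measurable (\<F> t)"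
proof -
  \<comment> \<open>Only epochs up to \<open>t\<close> enter \<open>X t\<close>; cutting them off at
    \<open>t\<close> does not change them and makes each term observable.\<close>
  define a where "a i \<omega> = real_of_ereal (min (A i \<omega>) (ereal t))" for i \<omega>
  have [measurable]: "a i \<in> borel_measurable (\<F> t)" for i
    unfolding a_def[abs_def] by (rule stopped_epoch_measurable[OF assms])
  have [measurable]: "N t \<in> measurable (\<F> t) (count_space UNIV)"
    using assms by (intro event_count_filtration_measurable) auto
  have "(\<lambda>\<omega>. \<Sum>i<N t \<omega>. \<rho> * exp (- \<beta> * (t - a i \<omega>))) \<in> borel_measurable (\<F> t)"
    by (rule measurable_compose_countable[of "\<lambda>n \<omega>. \<Sum>i<n. \<rho> * exp (- \<beta> * (t - a i \<omega>))"]) measurable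
  also have "?this \<longleftrightarrow> ?thesis"
  proof (rule measurable_cong)
    fix \<omega> assume "\<omega> \<in> space (\<F> t)"
    then have "a i \<omega> = real_of_ereal (A i \<omega>)" if "i < N t \<omega>" for i
      using that by (simp add: a_def less_event_count_iff min_absorb1)
    then show "(\<Sum>i<N t \<omega>. \<rho> * exp (- \<beta> * (t - a i \<omega>))) = X t \<omega>" by (simp add: X_def)
  qed
  finally show ?thesis .
qed

lemma X_measurable [measurable]:
  assumes "0 \<le> t"
  shows "X t \<in> borel_measurable M"
  using measurable_from_subalg[OF subalgebra_filtration X_filtration_measurable[OF assms]] .

lemma X_0: "\<omega> \<in> space M \<Longrightarrow> X 0 \<omega> = \<rho>"
  by (simp add: X_def event_count_0 epoch_0)

lemma X_no_event:
  assumes "N (t + \<delta>) \<omega> = N t \<omega>"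
  shows "X (t + \<delta>) \<omega> = exp (- (\<beta> * \<delta>)) * X t \<omega>"
  unfolding X_def assms sum_distrib_left
  by (intro sum.cong refl) (simp add: algebra_simps flip: exp_add)

text \<open>Wherever in the interval the event falls, the old value and the new summand \<rho> are
  each multiplied by a factor between \<open>1 - \<beta> * \<delta>\<close> and
  \<open>1\<close>.\<close>

lemma X_one_event:
  assumes \<omega>: "\<omega> \<in> space M" and \<delta>: "0 < \<delta>" and one: "N (t + \<delta>) \<omega> = Suc (N t \<omega>)"
  shows "\<bar>X (t + \<delta>) \<omega> - (X t \<omega> + \<rho>)\<bar> \<le> \<beta> * \<delta> * (X t \<omega> + \<rho>)"
    and "X (t + \<delta>) \<omega> \<le> X t \<omega> + \<rho>"
proof -
  let ?n = "N t \<omega>"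
  obtain r where r: "A ?n \<omega> = ereal r" "r \<le> t + \<delta>"
    using epoch_real[OF \<omega>, of ?n "t + \<delta>"] one by auto
  have "t < r" using less_event_count_iff[OF \<omega>, of ?n t] r by auto
  define e where "e = exp (- \<beta> * (t + \<delta> - r))"
  have e: "1 - \<beta> * \<delta> \<le> e" "e \<le> 1"
  proof -
    have "\<beta> * (t + \<delta> - r) \<le> \<beta> * \<delta>" using beta_pos \<open>t < r\<close> by (intro mult_left_mono) auto
    then show "1 - \<beta> * \<delta> \<le> e" unfolding e_def using exp_ge_add_one_self[of "- \<beta> * (t + \<delta> - r)"] by simp
    show "e \<le> 1" using beta_pos r by (simp add: e_def)
  qed
  have d: "1 - \<beta> * \<delta> \<le> exp (- (\<beta> * \<delta>))" "exp (- (\<beta> * \<delta>)) \<le> 1"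
    using exp_ge_add_one_self[of "- (\<beta> * \<delta>)"] beta_pos \<delta> by auto
  have "X (t + \<delta>) \<omega> = exp (- (\<beta> * \<delta>)) * X t \<omega> + \<rho> * e"
    unfolding X_def one sum_distrib_left
    using r by (simp add: e_def algebra_simps flip: exp_add)
  moreover have "exp (- (\<beta> * \<delta>)) * X t \<omega> \<le> X t \<omega>" "\<rho> * e \<le> \<rho>"
    using d e X_nonneg rho_pos by (auto intro: mult_left_le_one_le mult_left_le)
  moreover have "(1 - \<beta> * \<delta>) * X t \<omega> \<le> exp (- (\<beta> * \<delta>)) * X t \<omega>" "\<rho> * (1 - \<beta> * \<delta>) \<le> \<rho> * e"
    using d e X_nonneg rho_pos by (auto intro: mult_right_mono mult_left_mono)
  ultimately show "\<bar>X (t + \<delta>) \<omega> - (X t \<omega> + \<rho>)\<bar> \<le> \<beta> * \<delta> * (X t \<omega> + \<rho>)" "X (t + \<delta>) \<omega> \<le> X t \<omega> + \<rho>"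
    by (simp_all add: algebra_simps)
qed

section \<open>Increments of restricted expectations\<close>

text \<open>On \<open>N t = k\<close> the variable \<open>X t\<close> lies in the compact interval
  from \<open>0\<close> to \<open>\<rho> * k\<close>, so unbounded continuous \<open>f\<close> are
  admissible. \<open>B\<close> is the whole space in the Kolmogorov equations, and a value of the
  count at a fixed time in the study of extinction.\<close>

definition U :: "'a set \<Rightarrow> nat \<Rightarrow> (real \<Rightarrow> real) \<Rightarrow> real \<Rightarrow> real" where
  "U B k f t = expectation (\<lambda>\<omega>. if \<omega> \<in> B \<and> N t \<omega> = k then f (X t \<omega>) else 0)"

lemma restricted_measurable:
  assumes "0 \<le> t0" "t0 \<le> t" "B \<in> sets (\<F> t0)" "f \<in> borel_measurable borel"
  shows "(\<lambda>\<omega>. if \<omega> \<in> B \<and> N t \<omega> = k then f (X t \<omega>) else 0) \<in> borel_measurable (\<F> t)"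
    and "(\<lambda>\<omega>. if \<omega> \<in> B \<and> N t \<omega> = k then f (X t \<omega>) else 0) \<in> borel_measurable M"
proof -
  have [measurable]: "N t \<in> measurable (\<F> t) (count_space UNIV)" "X t \<in> borel_measurable (\<F> t)"
    "B \<in> sets (\<F> t)" "f \<in> borel_measurable borel"
    using assms event_count_filtration_measurable[of t t] X_filtration_measurable[of t] filtration_mono[of t0 t] by auto
  show *: "(\<lambda>\<omega>. if \<omega> \<in> B \<and> N t \<omega> = k then f (X t \<omega>) else 0) \<in> borel_measurable (\<F> t)"
    by measurable
  show "(\<lambda>\<omega>. if \<omega> \<in> B \<and> N t \<omega> = k then f (X t \<omega>) else 0) \<in> borel_measurable M"
    by (rule measurable_from_subalg[OF subalgebra_filtration *])
qed

lemma U_bounded: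
  assumes "continuous_on UNIV f"
  obtains C where "\<And>t B. \<bar>U B k f t\<bar> \<le> C"
proof -
  obtain c where c: "c \<ge> 0" "\<And>x. 0 \<le> x \<Longrightarrow> x \<le> \<rho> * real k \<Longrightarrow> \<bar>f x\<bar> \<le> c"
    using bounded_on_interval[OF assms, of "\<rho> * real k"] by blast
  have "\<bar>U B k f t\<bar> \<le> c" for t B
    unfolding U_def using c X_le[of _ t] X_nonneg by (intro abs_expectation_le) auto
  then show ?thesis using that by blast
qed

lemma remainder_bounds:
  assumes "\<epsilon> > 0"
  shows "\<forall>\<^sub>F \<delta> in at_right 0. \<forall>t\<in>{0..u}.
    (\<integral>\<^sup>+ \<omega>. ennreal \<bar>increment_prob M A (\<lambda>n. n = 1) t \<delta> \<omega> - \<beta> * X t \<omega> * \<delta>\<bar> \<partial>M) \<le> ennreal (\<epsilon> * \<delta>) \<and>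
    (\<integral>\<^sup>+ \<omega>. ennreal \<bar>increment_prob M A (\<lambda>n. n = 0) t \<delta> \<omega> - (1 - \<beta> * X t \<omega> * \<delta>)\<bar> \<partial>M) \<le> ennreal (\<epsilon> * \<delta>) \<and>
    (\<integral>\<^sup>+ \<omega>. ennreal \<bar>increment_prob M A (\<lambda>n. n > 1) t \<delta> \<omega> - 0\<bar> \<partial>M) \<le> ennreal (\<epsilon> * \<delta>)"
proof (cases "u \<ge> 0")
  case True
  have "\<forall>\<^sub>F \<delta> in at_right 0. \<forall>t\<in>{0..u}.
      (\<integral>\<^sup>+ \<omega>. ennreal \<bar>increment_prob M A (\<lambda>n. n = 1) t \<delta> \<omega> - \<beta> * X t \<omega> * \<delta>\<bar> \<partial>M) \<le> ennreal (\<epsilon> * \<delta>)"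
    using one_event True assms unfolding mean_small_o_def intensity_eq by auto
  moreover have "\<forall>\<^sub>F \<delta> in at_right 0. \<forall>t\<in>{0..u}.
      (\<integral>\<^sup>+ \<omega>. ennreal \<bar>increment_prob M A (\<lambda>n. n = 0) t \<delta> \<omega> - (1 - \<beta> * X t \<omega> * \<delta>)\<bar> \<partial>M) \<le> ennreal (\<epsilon> * \<delta>)"
    using no_event True assms unfolding mean_small_o_def intensity_eq by auto
  moreover have "\<forall>\<^sub>F \<delta> in at_right 0. \<forall>t\<in>{0..u}.
      (\<integral>\<^sup>+ \<omega>. ennreal \<bar>increment_prob M A (\<lambda>n. n > 1) t \<delta> \<omega> - 0\<bar> \<partial>M) \<le> ennreal (\<epsilon> * \<delta>)"
    using several_events True assms unfolding mean_small_o_def by auto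
  ultimately show ?thesis by eventually_elim auto
qed auto

text \<open>The number of events in the interval is distinguished. No event: decay gives the term
  with \<open>f1\<close>, and the probability of an event gives the loss with \<open>f\<close>. One
  event: the count rises from \<open>j\<close> and \<open>X\<close> by about \<rho>. Several events:
  small probability and bounded \<open>f\<close>. As \<open>C\<close> and \<open>D\<close> depend on
  neither \<open>t\<close>, \<delta> nor \<epsilon>, uniformity in \<open>t\<close>
  survives.\<close>

lemma U_increment_bound:
  fixes f f1 f2 :: "real \<Rightarrow> real"
  assumes t0: "0 \<le> t0" and B: "B \<in> sets (\<F> t0)"
    and f: "\<And>x. (f has_real_derivative f1 x) (at x)"
    and f1: "\<And>x. (f1 has_real_derivative f2 x) (at x)"
    and f2: "continuous_on UNIV f2"
  obtains C D where "C \<ge> 0" "D \<ge> 0"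
    "\<And>t \<delta> \<epsilon>. t0 \<le> t \<Longrightarrow> 0 < \<delta> \<Longrightarrow> \<epsilon> \<ge> 0 \<Longrightarrow>
      (\<integral>\<^sup>+ \<omega>. ennreal \<bar>increment_prob M A (\<lambda>n. n = 1) t \<delta> \<omega> - \<beta> * X t \<omega> * \<delta>\<bar> \<partial>M) \<le> ennreal (\<epsilon> * \<delta>) \<Longrightarrow>
      (\<integral>\<^sup>+ \<omega>. ennreal \<bar>increment_prob M A (\<lambda>n. n = 0) t \<delta> \<omega> - (1 - \<beta> * X t \<omega> * \<delta>)\<bar> \<partial>M) \<le> ennreal (\<epsilon> * \<delta>) \<Longrightarrow>
      (\<integral>\<^sup>+ \<omega>. ennreal \<bar>increment_prob M A (\<lambda>n. n > 1) t \<delta> \<omega> - 0\<bar> \<partial>M) \<le> ennreal (\<epsilon> * \<delta>) \<Longrightarrow>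
      \<bar>U B (Suc j) f (t + \<delta>) - U B (Suc j) f t
        - \<delta> * (U B (Suc j) (\<lambda>x. - \<beta> * x * (f1 x + f x)) t + U B j (\<lambda>x. \<beta> * x * f (x + \<rho>)) t)\<bar>
      \<le> C * (\<epsilon> * \<delta>) + D * \<delta>\<^sup>2 * (1 + \<epsilon>)"
proof -
  define K where "K = \<rho> * real (Suc j)"
  have K: "K > 0" "\<rho> * real j + \<rho> = K" "\<rho> * real j \<le> K"
  proof -
    show "K > 0" unfolding K_def using rho_pos by (intro mult_pos_pos) auto
    show K_eq: "\<rho> * real j + \<rho> = K" by (simp add: K_def algebra_simps)
    then show "\<rho> * real j \<le> K" using rho_pos by linarith
  qed
  have cont_f1: "continuous_on UNIV f1" by (rule DERIV_continuous_on[where D = f2]) (simp add: f1)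
  have cont_f: "continuous_on UNIV f" by (rule DERIV_continuous_on[where D = f1]) (simp add: f)
  have [measurable]: "f \<in> borel_measurable borel" "f1 \<in> borel_measurable borel"
    using cont_f cont_f1 by (auto intro: borel_measurable_continuous_onI)
  obtain c1 where c1: "c1 \<ge> 0" "\<And>x h. 0 \<le> x \<Longrightarrow> x \<le> K \<Longrightarrow> 0 \<le> h \<Longrightarrow> \<bar>f (exp (- h) * x) - f x + h * (x * f1 x)\<bar> \<le> c1 * h\<^sup>2"
    using decay_expansion[OF f f1 f2] by blast
  obtain c2 where c2: "c2 \<ge> 0" "\<And>x y. x \<in> {0..K} \<Longrightarrow> y \<in> {0..K} \<Longrightarrow> \<bar>f x - f y\<bar> \<le> c2 * \<bar>x - y\<bar>"
    using lipschitz_on_interval[OF f cont_f1] by blast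
  obtain C where C: "C \<ge> 0" "\<And>x. 0 \<le> x \<Longrightarrow> x \<le> K \<Longrightarrow> \<bar>f x\<bar> \<le> C"
    using bounded_on_interval[OF cont_f] by blast
  obtain C1 where C1: "C1 \<ge> 0" "\<And>x. 0 \<le> x \<Longrightarrow> x \<le> K \<Longrightarrow> \<bar>f1 x\<bar> \<le> C1"
    using bounded_on_interval[OF cont_f1] by blast
  \<comment> \<open>The second order terms: curvature of the decay, decay combined with the
    probability of an event, and the unknown position of the event inside the interval.\<close>
  define D where "D = c1 * \<beta>\<^sup>2 + \<beta> * K * c2 * K * \<beta> + c2 * \<beta> * K * (\<beta> * K + 1)"
  have D: "D \<ge> 0" using c1 c2 beta_pos K by (simp add: D_def)
  \<comment> \<open>One \<open>C\<close> for each of the three remainders.\<close>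
  show ?thesis
  proof (rule that[of "3 * C" D])
    fix t \<delta> \<epsilon> :: real
    assume t: "t0 \<le> t" and \<delta>: "0 < \<delta>" and \<epsilon>: "\<epsilon> \<ge> 0"
      and R1: "(\<integral>\<^sup>+ \<omega>. ennreal \<bar>increment_prob M A (\<lambda>n. n = 1) t \<delta> \<omega> - \<beta> * X t \<omega> * \<delta>\<bar> \<partial>M) \<le> ennreal (\<epsilon> * \<delta>)"
      and R0: "(\<integral>\<^sup>+ \<omega>. ennreal \<bar>increment_prob M A (\<lambda>n. n = 0) t \<delta> \<omega> - (1 - \<beta> * X t \<omega> * \<delta>)\<bar> \<partial>M) \<le> ennreal (\<epsilon> * \<delta>)"
      and R2: "(\<integral>\<^sup>+ \<omega>. ennreal \<bar>increment_prob M A (\<lambda>n. n > 1) t \<delta> \<omega> - 0\<bar> \<partial>M) \<le> ennreal (\<epsilon> * \<delta>)"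
    have t_nonneg: "0 \<le> t" "0 \<le> t + \<delta>" using t t0 \<delta> by auto
    note [measurable] = X_measurable[OF t_nonneg(1)] X_measurable[OF t_nonneg(2)]
    define e where "e = \<epsilon> * \<delta>"
    have e: "e \<ge> 0" using \<epsilon> \<delta> by (simp add: e_def)
    define q where "q = exp (- (\<beta> * \<delta>))"
    have q: "0 < q" "q \<le> 1" "1 - q \<le> \<beta> * \<delta>"
      using exp_ge_add_one_self[of "- (\<beta> * \<delta>)"] beta_pos \<delta> by (auto simp: q_def)
    have X_K: "X t \<omega> \<in> {0..K}" "q * X t \<omega> \<in> {0..K}" if "\<omega> \<in> space M" "N t \<omega> = Suc j" for \<omega>
    proof -
      show "X t \<omega> \<in> {0..K}" using X_le[OF that(1), of t] X_nonneg[of t \<omega>] that by (simp add: K_def)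
      moreover have "0 \<le> q * X t \<omega>" "q * X t \<omega> \<le> X t \<omega>"
        using q X_nonneg[of t \<omega>] by (auto intro: mult_left_le_one_le)
      ultimately show "q * X t \<omega> \<in> {0..K}" by auto
    qed
    have X_j: "X t \<omega> + \<rho> \<in> {0..K}" "X t \<omega> \<in> {0..K}" if "\<omega> \<in> space M" "N t \<omega> = j" for \<omega>
      using X_le[OF that(1), of t] X_nonneg[of t \<omega>] that K rho_pos by auto
    \<comment> \<open>\<open>Y0\<close> and \<open>Y1\<close> predict \<open>W\<close> in the cases
      of no event and of one event. Unlike \<open>W\<close> they are known at time \<open>t\<close>,
      so \<open>expectation_increment\<close> applies. \<open>Y2\<close> marks where
      \<open>Y1\<close> can be inexact.\<close>
    define Y0 where "Y0 \<omega> = (if \<omega> \<in> B \<and> N t \<omega> = Suc j then f (q * X t \<omega>) else 0)" for \<omega>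
    define Y1 where "Y1 \<omega> = (if \<omega> \<in> B \<and> N t \<omega> = j then f (X t \<omega> + \<rho>) else 0)" for \<omega>
    define Y2 where "Y2 \<omega> = (if \<omega> \<in> B \<and> N t \<omega> = j then 1 else 0 :: real)" for \<omega>
    define I where "I Q \<omega> = (of_bool (Q (N (t + \<delta>) \<omega> - N t \<omega>)) :: real)" for Q \<omega>
    define W where "W \<omega> = (if \<omega> \<in> B \<and> N (t + \<delta>) \<omega> = Suc j then f (X (t + \<delta>) \<omega>) else 0)" for \<omega>
    define V where "V \<omega> = (if \<omega> \<in> B \<and> N t \<omega> = Suc j then f (X t \<omega>) else 0)" for \<omega>
    define V' where "V' \<omega> = (if \<omega> \<in> B \<and> N t \<omega> = Suc j then - \<beta> * X t \<omega> * (f1 (X t \<omega>) + f (X t \<omega>)) else 0)" for \<omega>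
    have Y0_F: "Y0 \<in> borel_measurable (\<F> t)"
      unfolding Y0_def[abs_def] by (rule restricted_measurable(1)[OF t0 t B, of "\<lambda>x. f (q * x)"]) measurable
    have Y1_F: "Y1 \<in> borel_measurable (\<F> t)"
      unfolding Y1_def[abs_def] by (rule restricted_measurable(1)[OF t0 t B, of "\<lambda>x. f (x + \<rho>)"]) measurable
    have Y2_F: "Y2 \<in> borel_measurable (\<F> t)"
      unfolding Y2_def[abs_def] by (rule restricted_measurable(1)[OF t0 t B, of "\<lambda>x. 1"]) measurable
    note [measurable] = Y0_F[THEN measurable_from_subalg[OF subalgebra_filtration]]
      Y1_F[THEN measurable_from_subalg[OF subalgebra_filtration]]
      Y2_F[THEN measurable_from_subalg[OF subalgebra_filtration]]
    have [measurable]: "W \<in> borel_measurable M"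
      unfolding W_def[abs_def] using t \<delta> by (intro restricted_measurable(2)[OF t0 _ B]) auto
    have [measurable]: "V \<in> borel_measurable M"
      unfolding V_def[abs_def] by (rule restricted_measurable(2)[OF t0 t B]) measurable
    have [measurable]: "V' \<in> borel_measurable M"
      unfolding V'_def[abs_def]
      by (rule restricted_measurable(2)[OF t0 t B, of "\<lambda>x. - \<beta> * x * (f1 x + f x)"]) measurable
    have [measurable]: "I Q \<in> borel_measurable M" for Q unfolding I_def[abs_def] by measurable
    have Y0_C: "\<bar>Y0 \<omega>\<bar> \<le> C" if "\<omega> \<in> space M" for \<omega>
      using that C X_K[OF that] by (auto simp: Y0_def)
    have Y1_C: "\<bar>Y1 \<omega>\<bar> \<le> C" if "\<omega> \<in> space M" for \<omega>
      using that C X_j[OF that] by (auto simp: Y1_def)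
    have Y2_1: "\<bar>Y2 \<omega>\<bar> \<le> 1" for \<omega> by (auto simp: Y2_def)
    have I_1: "\<bar>I Q \<omega>\<bar> \<le> 1" "0 \<le> I Q \<omega>" for Q \<omega> by (auto simp: I_def)
    have Y0_L: "\<bar>Y0 \<omega> * (\<beta> * X t \<omega> * \<delta>)\<bar> \<le> C * (\<beta> * K * \<delta>)" if "\<omega> \<in> space M" for \<omega>
    proof (cases "\<omega> \<in> B \<and> N t \<omega> = Suc j")
      case True
      then have "\<bar>Y0 \<omega>\<bar> * (\<beta> * X t \<omega> * \<delta>) \<le> C * (\<beta> * K * \<delta>)"
        using X_K[OF that] Y0_C[OF that] beta_pos \<delta> C by (intro mult_mono) auto
      then show ?thesis using X_K[OF that] True beta_pos \<delta> by (simp add: abs_mult)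
    qed (use C beta_pos K \<delta> in \<open>auto simp: Y0_def\<close>)
    have Y_L: "\<bar>Y \<omega> * (\<beta> * X t \<omega> * \<delta>)\<bar> \<le> c * (\<beta> * K * \<delta>)"
      if "\<omega> \<in> space M" "\<bar>Y \<omega>\<bar> \<le> c" "\<not> (\<omega> \<in> B \<and> N t \<omega> = j) \<Longrightarrow> Y \<omega> = 0" for \<omega> Y c
    proof (cases "\<omega> \<in> B \<and> N t \<omega> = j")
      case True
      then have "\<bar>Y \<omega>\<bar> * (\<beta> * X t \<omega> * \<delta>) \<le> c * (\<beta> * K * \<delta>)"
        using X_j[OF that(1)] that(2) beta_pos \<delta> by (intro mult_mono) auto
      then show ?thesis using X_j[OF that(1)] True beta_pos \<delta> by (simp add: abs_mult)
    qed (use that beta_pos K \<delta> in auto)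
    have Y2_L: "\<bar>Y2 \<omega> * (\<beta> * X t \<omega> * \<delta>)\<bar> \<le> 1 * (\<beta> * K * \<delta>)" if "\<omega> \<in> space M" for \<omega>
      using Y_L[of \<omega> Y2 1] that by (auto simp: Y2_def)
    have Y1_L: "\<bar>Y1 \<omega> * (\<beta> * X t \<omega> * \<delta>)\<bar> \<le> C * (\<beta> * K * \<delta>)" if "\<omega> \<in> space M" for \<omega>
      using Y_L[of \<omega> Y1 C] Y1_C[OF that] that by (auto simp: Y1_def)
    have int: "integrable M Y0" "integrable M (\<lambda>\<omega>. Y0 \<omega> * I Q \<omega>)" "integrable M Y1" "integrable M (\<lambda>\<omega>. Y1 \<omega> * I Q \<omega>)"
      "integrable M (\<lambda>\<omega>. Y2 \<omega> * I Q \<omega>)" "integrable M (\<lambda>\<omega>. Y0 \<omega> * (\<beta> * X t \<omega> * \<delta>))" "integrable M (I Q)" for Q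
    proof -
      show "integrable M (I Q)" by (rule bounded_integrable[where C = 1]) (auto simp: I_def)
      show "integrable M Y0" using Y0_C by (rule bounded_integrable[rotated]) measurable
      show "integrable M Y1" using Y1_C by (rule bounded_integrable[rotated]) measurable
      show "integrable M (\<lambda>\<omega>. Y0 \<omega> * I Q \<omega>)"
        using Y0_C C by (intro bounded_integrable[where C = C]) (auto simp: I_def)
      show "integrable M (\<lambda>\<omega>. Y1 \<omega> * I Q \<omega>)"
        using Y1_C C by (intro bounded_integrable[where C = C]) (auto simp: I_def)
      show "integrable M (\<lambda>\<omega>. Y2 \<omega> * I Q \<omega>)"
        using Y2_1 by (intro bounded_integrable[where C = 1]) (auto simp: I_def)
      show "integrable M (\<lambda>\<omega>. Y0 \<omega> * (\<beta> * X t \<omega> * \<delta>))"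
        using Y0_L by (rule bounded_integrable[rotated]) measurable
    qed
    have W_C: "\<bar>W \<omega>\<bar> \<le> C" if "\<omega> \<in> space M" for \<omega>
      using that C(1) X_le[OF that, of "t + \<delta>"] X_nonneg[of "t + \<delta>" \<omega>] by (auto simp: W_def K_def intro!: C(2))
    have int_W: "integrable M W" using W_C by (rule bounded_integrable[rotated]) measurable
    have int_V: "integrable M V"
      using X_K C by (intro bounded_integrable[where C = C]) (auto simp: V_def)
    have "\<exists>c. \<forall>\<omega>\<in>space M. \<bar>V' \<omega>\<bar> \<le> c"
    proof -
      have "continuous_on UNIV (\<lambda>x. - \<beta> * x * (f1 x + f x))"
        by (intro continuous_intros cont_f cont_f1)
      from bounded_on_interval[OF this, of K] obtain c where
        "c \<ge> 0" "\<And>x. 0 \<le> x \<Longrightarrow> x \<le> K \<Longrightarrow> \<bar>- \<beta> * x * (f1 x + f x)\<bar> \<le> c" by blast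
      then show ?thesis using X_K by (intro exI[of _ c]) (auto simp: V'_def)
    qed
    then have int_V': "integrable M V'" by (auto intro: bounded_integrable)

    \<comment> \<open>The prediction is exact without an event, off by a Lipschitz error after one
      event, and replaced by the bound \<open>C\<close> after several.\<close>
    have "\<bar>W \<omega> - Y0 \<omega> * I (\<lambda>n. n = 0) \<omega> - Y1 \<omega> * I (\<lambda>n. n = 1) \<omega>\<bar>
        \<le> c2 * (\<beta> * \<delta> * K) * (Y2 \<omega> * I (\<lambda>n. n = 1) \<omega>) + C * I (\<lambda>n. n > 1) \<omega>" (is "?l \<le> ?r")
      if \<omega>: "\<omega> \<in> space M" for \<omega>
    proof -
      have mono: "N t \<omega> \<le> N (t + \<delta>) \<omega>" using event_count_mono[OF \<omega>] \<delta> by simp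
      have r: "?r \<ge> 0" using c2 beta_pos \<delta> K C I_1 by (auto intro!: add_nonneg_nonneg mult_nonneg_nonneg simp: Y2_def)
      consider "N (t + \<delta>) \<omega> = N t \<omega>" | "N (t + \<delta>) \<omega> = Suc (N t \<omega>)" | "N (t + \<delta>) \<omega> > Suc (N t \<omega>)"
        using mono by linarith
      then show ?thesis
      proof cases
        case 1
        then have "?l = 0" using X_no_event[OF 1] by (auto simp: W_def Y0_def I_def q_def)
        then show ?thesis using r by simp
      next
        case 2
        show ?thesis
        proof (cases "\<omega> \<in> B \<and> N t \<omega> = j")
          case True
          have "X (t + \<delta>) \<omega> \<in> {0..K}"
            using X_one_event(2)[OF \<omega> \<delta> 2] X_j[OF \<omega>] True X_nonneg[of "t + \<delta>" \<omega>] by auto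
          then have "\<bar>f (X (t + \<delta>) \<omega>) - f (X t \<omega> + \<rho>)\<bar> \<le> c2 * \<bar>X (t + \<delta>) \<omega> - (X t \<omega> + \<rho>)\<bar>"
            using X_j[OF \<omega>] True by (intro c2) auto
          also have "\<dots> \<le> c2 * (\<beta> * \<delta> * (X t \<omega> + \<rho>))"
            using X_one_event(1)[OF \<omega> \<delta> 2] c2 by (intro mult_left_mono) auto
          also have "\<dots> \<le> c2 * (\<beta> * \<delta> * K)"
            using X_j[OF \<omega>] True c2 beta_pos \<delta> by (intro mult_left_mono) auto
          finally show ?thesis using 2 True by (simp add: W_def Y0_def Y1_def Y2_def I_def)
        next
          case False
          then have "?l = 0" using 2 by (auto simp: W_def Y0_def Y1_def I_def)
          then show ?thesis using r by simp
        qed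
      next
        case 3
        then have "I (\<lambda>n. n = 0) \<omega> = 0" "I (\<lambda>n. n = 1) \<omega> = 0" "I (\<lambda>n. n > 1) \<omega> = 1" by (auto simp: I_def)
        then show ?thesis using W_C[OF \<omega>] by simp
      qed
    qed
    then have "expectation (\<lambda>\<omega>. \<bar>W \<omega> - Y0 \<omega> * I (\<lambda>n. n = 0) \<omega> - Y1 \<omega> * I (\<lambda>n. n = 1) \<omega>\<bar>)
        \<le> expectation (\<lambda>\<omega>. c2 * (\<beta> * \<delta> * K) * (Y2 \<omega> * I (\<lambda>n. n = 1) \<omega>) + C * I (\<lambda>n. n > 1) \<omega>)"
      using int int_W by (intro integral_mono) auto
    also have "\<dots> = c2 * (\<beta> * \<delta> * K) * expectation (\<lambda>\<omega>. Y2 \<omega> * I (\<lambda>n. n = 1) \<omega>) + C * expectation (I (\<lambda>n. n > 1))"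
      using int by simp
    also have "\<dots> \<le> c2 * (\<beta> * \<delta> * K) * (\<beta> * K * \<delta> + e) + C * e"
    proof (intro add_mono mult_left_mono)
      have "\<bar>expectation (\<lambda>\<omega>. Y2 \<omega> * I (\<lambda>n. n = 1) \<omega>) - expectation (\<lambda>\<omega>. Y2 \<omega> * (\<beta> * X t \<omega> * \<delta>))\<bar> \<le> 1 * e"
        unfolding I_def by (rule expectation_increment[where L = "\<lambda>\<omega>. \<beta> * X t \<omega> * \<delta>" and D = "1 * (\<beta> * K * \<delta>)"])
          (use R1 Y2_F Y2_1 e Y2_L in \<open>auto simp: e_def\<close>)
      moreover have "\<bar>expectation (\<lambda>\<omega>. Y2 \<omega> * (\<beta> * X t \<omega> * \<delta>))\<bar> \<le> 1 * (\<beta> * K * \<delta>)"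
        using Y2_L by (rule abs_expectation_le)
      ultimately show "expectation (\<lambda>\<omega>. Y2 \<omega> * I (\<lambda>n. n = 1) \<omega>) \<le> \<beta> * K * \<delta> + e" by linarith
      have "\<bar>expectation (\<lambda>\<omega>. 1 * I (\<lambda>n. n > 1) \<omega>) - expectation (\<lambda>\<omega>. 1 * 0)\<bar> \<le> 1 * e"
        unfolding I_def by (rule expectation_increment[where D = 0]) (use R2 e in \<open>auto simp: e_def\<close>)
      then show "expectation (I (\<lambda>n. n > 1)) \<le> e" by simp
    qed (use c2 beta_pos \<delta> K C in auto)
    finally have "\<bar>expectation (\<lambda>\<omega>. W \<omega> - Y0 \<omega> * I (\<lambda>n. n = 0) \<omega> - Y1 \<omega> * I (\<lambda>n. n = 1) \<omega>)\<bar>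
        \<le> c2 * (\<beta> * \<delta> * K) * (\<beta> * K * \<delta> + e) + C * e"
      using integral_abs_bound[of M "\<lambda>\<omega>. W \<omega> - Y0 \<omega> * I (\<lambda>n. n = 0) \<omega> - Y1 \<omega> * I (\<lambda>n. n = 1) \<omega>"] by linarith
    then have 1: "\<bar>expectation W - expectation (\<lambda>\<omega>. Y0 \<omega> * I (\<lambda>n. n = 0) \<omega>) - expectation (\<lambda>\<omega>. Y1 \<omega> * I (\<lambda>n. n = 1) \<omega>)\<bar>
        \<le> c2 * (\<beta> * \<delta> * K) * (\<beta> * K * \<delta> + e) + C * e"
      using int int_W by simp
    have 2: "\<bar>expectation (\<lambda>\<omega>. Y0 \<omega> * I (\<lambda>n. n = 0) \<omega>) - expectation (\<lambda>\<omega>. Y0 \<omega> * (1 - \<beta> * X t \<omega> * \<delta>))\<bar> \<le> C * e"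
      unfolding I_def
    proof (rule expectation_increment[where D = "C + C * (\<beta> * K * \<delta>)"])
      fix \<omega> assume \<omega>: "\<omega> \<in> space M"
      show "\<bar>Y0 \<omega> * (1 - \<beta> * X t \<omega> * \<delta>)\<bar> \<le> C + C * (\<beta> * K * \<delta>)"
        using Y0_C[OF \<omega>] Y0_L[OF \<omega>] unfolding right_diff_distrib by linarith
    qed (use R0 Y0_F Y0_C e in \<open>auto simp: e_def\<close>)
    have 3: "\<bar>expectation (\<lambda>\<omega>. Y1 \<omega> * I (\<lambda>n. n = 1) \<omega>) - expectation (\<lambda>\<omega>. Y1 \<omega> * (\<beta> * X t \<omega> * \<delta>))\<bar> \<le> C * e"
      unfolding I_def
      by (rule expectation_increment[where D = "C * (\<beta> * K * \<delta>)"])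
        (use R1 Y1_F Y1_C e Y1_L in \<open>auto simp: e_def\<close>)
    have Y1_eq: "expectation (\<lambda>\<omega>. Y1 \<omega> * (\<beta> * X t \<omega> * \<delta>)) = \<delta> * U B j (\<lambda>x. \<beta> * x * f (x + \<rho>)) t"
      unfolding U_def Bochner_Integration.integral_mult_right_zero[symmetric]
      by (intro Bochner_Integration.integral_cong refl) (auto simp: Y1_def)
    \<comment> \<open>First order expansion of the product of the decayed value and the probability
      of no event.\<close>
    have "\<bar>Y0 \<omega> * (1 - \<beta> * X t \<omega> * \<delta>) - V \<omega> - \<delta> * V' \<omega>\<bar> \<le> (c1 * \<beta>\<^sup>2 + \<beta> * K * c2 * K * \<beta>) * \<delta>\<^sup>2"
      if \<omega>: "\<omega> \<in> space M" for \<omega>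
    proof (cases "\<omega> \<in> B \<and> N t \<omega> = Suc j")
      case True
      define x where "x = X t \<omega>"
      have x: "x \<in> {0..K}" "q * x \<in> {0..K}" using X_K[OF \<omega>] True by (auto simp: x_def)
      have a: "\<bar>f (q * x) - f x + \<beta> * \<delta> * (x * f1 x)\<bar> \<le> c1 * (\<beta> * \<delta>)\<^sup>2"
        unfolding q_def using x beta_pos \<delta> by (intro c1) auto
      have "\<bar>f (q * x) - f x\<bar> \<le> c2 * \<bar>q * x - x\<bar>" using x by (intro c2) auto
      also have "\<bar>q * x - x\<bar> = (1 - q) * x" using x q by (simp add: algebra_simps mult_left_le_one_le)
      also have "\<dots> \<le> \<beta> * \<delta> * K" using x q beta_pos \<delta> by (intro mult_mono) auto
      finally have b: "\<bar>f (q * x) - f x\<bar> \<le> c2 * (\<beta> * \<delta> * K)" using c2 by (auto intro: mult_left_mono)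
      have "\<bar>\<beta> * x * \<delta> * (f (q * x) - f x)\<bar> = \<beta> * x * \<delta> * \<bar>f (q * x) - f x\<bar>"
        using x beta_pos \<delta> by (simp add: abs_mult)
      also have "\<dots> \<le> \<beta> * K * \<delta> * (c2 * (\<beta> * \<delta> * K))"
        using x b beta_pos \<delta> by (intro mult_mono) auto
      finally have c: "\<bar>\<beta> * x * \<delta> * (f (q * x) - f x)\<bar> \<le> \<beta> * K * \<delta> * (c2 * (\<beta> * \<delta> * K))" .
      have "Y0 \<omega> * (1 - \<beta> * X t \<omega> * \<delta>) - V \<omega> - \<delta> * V' \<omega>
          = (f (q * x) - f x + \<beta> * \<delta> * (x * f1 x)) - \<beta> * x * \<delta> * (f (q * x) - f x)"
        using True by (simp add: Y0_def V_def V'_def x_def algebra_simps)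
      also have "\<bar>\<dots>\<bar> \<le> c1 * (\<beta> * \<delta>)\<^sup>2 + \<beta> * K * \<delta> * (c2 * (\<beta> * \<delta> * K))" using a c by linarith
      also have "\<dots> = (c1 * \<beta>\<^sup>2 + \<beta> * K * c2 * K * \<beta>) * \<delta>\<^sup>2" by (simp add: power2_eq_square algebra_simps)
      finally show ?thesis .
    next
      case False
      then have "Y0 \<omega> = 0" "V \<omega> = 0" "V' \<omega> = 0" by (auto simp: Y0_def V_def V'_def)
      then show ?thesis using c1 c2 beta_pos K by simp
    qed
    then have "\<bar>expectation (\<lambda>\<omega>. Y0 \<omega> * (1 - \<beta> * X t \<omega> * \<delta>) - V \<omega> - \<delta> * V' \<omega>)\<bar> \<le> (c1 * \<beta>\<^sup>2 + \<beta> * K * c2 * K * \<beta>) * \<delta>\<^sup>2"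
      by (rule abs_expectation_le)
    moreover have "expectation (\<lambda>\<omega>. Y0 \<omega> * (1 - \<beta> * X t \<omega> * \<delta>) - V \<omega> - \<delta> * V' \<omega>)
        = expectation (\<lambda>\<omega>. Y0 \<omega> * (1 - \<beta> * X t \<omega> * \<delta>)) - expectation V - \<delta> * expectation V'"
    proof -
      have "integrable M (\<lambda>\<omega>. Y0 \<omega> * (1 - \<beta> * X t \<omega> * \<delta>))"
        using int by (simp add: right_diff_distrib)
      then show ?thesis using int_V int_V' by simp
    qed
    ultimately have 4: "\<bar>expectation (\<lambda>\<omega>. Y0 \<omega> * (1 - \<beta> * X t \<omega> * \<delta>)) - expectation V - \<delta> * expectation V'\<bar>
        \<le> (c1 * \<beta>\<^sup>2 + \<beta> * K * c2 * K * \<beta>) * \<delta>\<^sup>2" by simp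
    have eqs: "U B (Suc j) f (t + \<delta>) = expectation W" "U B (Suc j) f t = expectation V"
      "U B (Suc j) (\<lambda>x. - \<beta> * x * (f1 x + f x)) t = expectation V'"
      unfolding U_def W_def V_def V'_def by simp_all
    have "\<bar>U B (Suc j) f (t + \<delta>) - U B (Suc j) f t
        - \<delta> * (U B (Suc j) (\<lambda>x. - \<beta> * x * (f1 x + f x)) t + U B j (\<lambda>x. \<beta> * x * f (x + \<rho>)) t)\<bar>
      \<le> (c2 * (\<beta> * \<delta> * K) * (\<beta> * K * \<delta> + e) + C * e) + C * e + C * e + (c1 * \<beta>\<^sup>2 + \<beta> * K * c2 * K * \<beta>) * \<delta>\<^sup>2"
      unfolding eqs distrib_left[of \<delta> "expectation V'"] using 1 2 3 4 unfolding Y1_eq by linarith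
    also have "\<dots> = 3 * C * e + (c1 * \<beta>\<^sup>2 + \<beta> * K * c2 * K * \<beta>) * \<delta>\<^sup>2 + c2 * \<beta> * K * \<delta>\<^sup>2 * (\<beta> * K + \<epsilon>)"
      by (simp add: e_def power2_eq_square algebra_simps)
    also have "\<dots> \<le> 3 * C * e + D * \<delta>\<^sup>2 * (1 + \<epsilon>)"
    proof -
      have "(c1 * \<beta>\<^sup>2 + \<beta> * K * c2 * K * \<beta>) * \<delta>\<^sup>2 * 1 \<le> (c1 * \<beta>\<^sup>2 + \<beta> * K * c2 * K * \<beta>) * \<delta>\<^sup>2 * (1 + \<epsilon>)"
        using c1 c2 beta_pos K \<epsilon> by (intro mult_left_mono) auto
      moreover have "c2 * \<beta> * K * \<delta>\<^sup>2 * (\<beta> * K + \<epsilon>) \<le> c2 * \<beta> * K * \<delta>\<^sup>2 * ((\<beta> * K + 1) * (1 + \<epsilon>))"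
        using c2 beta_pos K \<epsilon> by (intro mult_left_mono) (auto simp: algebra_simps)
      ultimately show ?thesis by (simp add: D_def algebra_simps)
    qed
    finally show "\<bar>U B (Suc j) f (t + \<delta>) - U B (Suc j) f t
        - \<delta> * (U B (Suc j) (\<lambda>x. - \<beta> * x * (f1 x + f x)) t + U B j (\<lambda>x. \<beta> * x * f (x + \<rho>)) t)\<bar>
      \<le> 3 * C * (\<epsilon> * \<delta>) + D * \<delta>\<^sup>2 * (1 + \<epsilon>)" by (simp add: e_def)
  qed (use C D in auto)
qed

lemma U_expansion:
  fixes f f1 f2 :: "real \<Rightarrow> real"
  assumes t0: "0 \<le> t0" and B: "B \<in> sets (\<F> t0)"
    and f: "\<And>x. (f has_real_derivative f1 x) (at x)"
    and f1: "\<And>x. (f1 has_real_derivative f2 x) (at x)"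
    and f2: "continuous_on UNIV f2" and \<epsilon>: "\<epsilon> > 0"
  shows "\<forall>\<^sub>F \<delta> in at_right 0. \<forall>t\<in>{t0..T}.
      \<bar>U B (Suc j) f (t + \<delta>) - U B (Suc j) f t
        - \<delta> * (U B (Suc j) (\<lambda>x. - \<beta> * x * (f1 x + f x)) t + U B j (\<lambda>x. \<beta> * x * f (x + \<rho>)) t)\<bar> \<le> \<epsilon> * \<delta>"
proof -
  obtain C D where CD: "C \<ge> 0" "D \<ge> 0" and
    bound: "\<And>t \<delta> \<epsilon>. t0 \<le> t \<Longrightarrow> 0 < \<delta> \<Longrightarrow> \<epsilon> \<ge> 0 \<Longrightarrow>
      (\<integral>\<^sup>+ \<omega>. ennreal \<bar>increment_prob M A (\<lambda>n. n = 1) t \<delta> \<omega> - \<beta> * X t \<omega> * \<delta>\<bar> \<partial>M) \<le> ennreal (\<epsilon> * \<delta>) \<Longrightarrow>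
      (\<integral>\<^sup>+ \<omega>. ennreal \<bar>increment_prob M A (\<lambda>n. n = 0) t \<delta> \<omega> - (1 - \<beta> * X t \<omega> * \<delta>)\<bar> \<partial>M) \<le> ennreal (\<epsilon> * \<delta>) \<Longrightarrow>
      (\<integral>\<^sup>+ \<omega>. ennreal \<bar>increment_prob M A (\<lambda>n. n > 1) t \<delta> \<omega> - 0\<bar> \<partial>M) \<le> ennreal (\<epsilon> * \<delta>) \<Longrightarrow>
      \<bar>U B (Suc j) f (t + \<delta>) - U B (Suc j) f t
        - \<delta> * (U B (Suc j) (\<lambda>x. - \<beta> * x * (f1 x + f x)) t + U B j (\<lambda>x. \<beta> * x * f (x + \<rho>)) t)\<bar>
      \<le> C * (\<epsilon> * \<delta>) + D * \<delta>\<^sup>2 * (1 + \<epsilon>)"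
    by (rule U_increment_bound[OF t0 B f f1 f2, where j = j]) (rule that, assumption+)
  \<comment> \<open>Half of \<epsilon> pays for the remainders, the other half for the second order
    terms through the bound \<open>d\<close> on the step.\<close>
  define \<epsilon>' where "\<epsilon>' = \<epsilon> / (2 * (C + 1))"
  have \<epsilon>': "\<epsilon>' > 0" "C * \<epsilon>' \<le> \<epsilon> / 2"
    using CD \<epsilon> by (auto simp: \<epsilon>'_def field_simps mult_left_mono)
  define d where "d = \<epsilon> / (2 * (D + 1) * (1 + \<epsilon>'))"
  have d: "d > 0" "D * d * (1 + \<epsilon>') \<le> \<epsilon> / 2"
  proof -
    show "d > 0" using CD \<epsilon> \<epsilon>' unfolding d_def by (intro divide_pos_pos mult_pos_pos) auto
    have "D * d * (1 + \<epsilon>') = \<epsilon> * D / (2 * (D + 1))" using \<epsilon>'(1) by (simp add: d_def)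
    also have "\<dots> \<le> \<epsilon> / 2" using CD \<epsilon> by (simp add: field_simps)
    finally show "D * d * (1 + \<epsilon>') \<le> \<epsilon> / 2" .
  qed
  have "\<forall>\<^sub>F \<delta> in at_right 0. 0 < \<delta> \<and> \<delta> < d"
    using d(1) by (auto simp: eventually_at_right_field)
  with remainder_bounds[OF \<epsilon>'(1), of T] show ?thesis
  proof eventually_elim
    case (elim \<delta>)
    then have \<delta>: "0 < \<delta>" "\<delta> < d" by auto
    show ?case
    proof
      fix t assume t: "t \<in> {t0..T}"
      then have "t \<in> {0..T}" using t0 by auto
      with elim t \<epsilon>' have "\<bar>U B (Suc j) f (t + \<delta>) - U B (Suc j) f t
        - \<delta> * (U B (Suc j) (\<lambda>x. - \<beta> * x * (f1 x + f x)) t + U B j (\<lambda>x. \<beta> * x * f (x + \<rho>)) t)\<bar>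
          \<le> C * (\<epsilon>' * \<delta>) + D * \<delta>\<^sup>2 * (1 + \<epsilon>')" by (intro bound) auto
      also have "\<dots> = (C * \<epsilon>') * \<delta> + (D * \<delta> * (1 + \<epsilon>')) * \<delta>" by (simp add: power2_eq_square)
      also have "\<dots> \<le> \<epsilon> / 2 * \<delta> + \<epsilon> / 2 * \<delta>"
      proof (intro add_mono mult_right_mono)
        have "D * \<delta> * (1 + \<epsilon>') \<le> D * d * (1 + \<epsilon>')"
          using CD \<delta> \<epsilon>' by (intro mult_right_mono mult_left_mono) auto
        with d show "D * \<delta> * (1 + \<epsilon>') \<le> \<epsilon> / 2" by simp
      qed (use \<epsilon>' \<delta> in auto)
      finally show "\<bar>U B (Suc j) f (t + \<delta>) - U B (Suc j) f t
        - \<delta> * (U B (Suc j) (\<lambda>x. - \<beta> * x * (f1 x + f x)) t + U B j (\<lambda>x. \<beta> * x * f (x + \<rho>)) t)\<bar> \<le> \<epsilon> * \<delta>"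
        by (simp add: mult.commute)
    qed
  qed
qed

end

section \<open>The Kolmogorov equations and their solution\<close>

text \<open>A class closed under derivatives, multiplication by \<open>x\<close> and shifts of the
  argument. It contains the Poisson weights and, with \<open>c = 0\<close>, the polynomials of the
  martingale argument.\<close>

definition poly_exp :: "real poly \<Rightarrow> real \<Rightarrow> real \<Rightarrow> real" where
  "poly_exp p c x = poly p x * exp (- (c * x))"

lemma poly_exp_derivative:
  "(poly_exp p c has_real_derivative poly_exp (pderiv p - smult c p) c x) (at x)"
  unfolding poly_exp_def[abs_def]
  by (auto intro!: derivative_eq_intros simp: algebra_simps)

lemma poly_exp_continuous: "continuous_on S (poly_exp p c)"
  unfolding poly_exp_def[abs_def] by (intro continuous_intros)

section \<open>Poisson weights as test functions\<close>

definition active_prob :: "nat \<Rightarrow> real \<Rightarrow> real" where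
  "active_prob a = poly_exp (monom (1 / fact a) a) 1"

lemma active_prob_eq: "active_prob a x = x ^ a / fact a * exp (- x)"
  by (simp add: active_prob_def poly_exp_def poly_monom)

lemma active_prob_continuous: "continuous_on S (active_prob a)"
  unfolding active_prob_def by (rule poly_exp_continuous)

text \<open>The operator x (f' + f) cancels the derivative of \<open>exp (- x)\<close> and
  multiplies \<open>x ^ a\<close> by \<open>a\<close>, so the Poisson weights are its
  eigenfunctions.\<close>

lemma active_prob_decay: "x * (poly_exp (pderiv (monom (1 / fact a) a) - smult 1 (monom (1 / fact a) a)) 1 x + active_prob a x)
    = real a * active_prob a x"
  by (cases a) (simp_all add: active_prob_def poly_exp_def poly_monom pderiv_monom algebra_simps)

text \<open>The binomial theorem writes a Poisson law with mean \<open>x + r\<close> as a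
  convolution, and \<open>x * active_prob i x = (i + 1) * active_prob (i + 1) x\<close> produces the
  birth rate \<open>b = i + 1\<close>. The other factor is the probability that the newborn has
  \<open>a + 1 - b\<close> children.\<close>

lemma active_prob_jump:
  "x * active_prob a (x + r) = (\<Sum>b=1..a+1. exp (- r) * r ^ (a + 1 - b) / fact (a + 1 - b) * (real b * active_prob b x))"
proof -
  have "x * active_prob a (x + r) = (\<Sum>i\<le>a. x * real (a choose i) * x ^ i * r ^ (a - i) / fact a * exp (- (x + r)))"
    unfolding active_prob_eq binomial_ring sum_distrib_left sum_distrib_right sum_divide_distrib
    by (simp add: mult.assoc)
  also have "\<dots> = (\<Sum>i\<le>a. exp (- r) * r ^ (a - i) / fact (a - i) * (real (Suc i) * active_prob (Suc i) x))"
  proof (intro sum.cong refl)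
    fix i assume "i \<in> {..a}"
    then have choose: "real (a choose i) / fact a = 1 / (fact i * fact (a - i))"
      by (simp add: binomial_fact)
    have "x * real (a choose i) * x ^ i * r ^ (a - i) / fact a * exp (- (x + r))
        = x * x ^ i * r ^ (a - i) * (real (a choose i) / fact a) * exp (- (x + r))"
      by (simp add: mult_ac)
    also have "\<dots> = exp (- r) * r ^ (a - i) / fact (a - i) * (real (Suc i) * active_prob (Suc i) x)"
      unfolding choose by (simp add: active_prob_eq exp_diff exp_minus field_simps exp_add del: of_nat_Suc)
    finally show "x * real (a choose i) * x ^ i * r ^ (a - i) / fact a * exp (- (x + r))
        = exp (- r) * r ^ (a - i) / fact (a - i) * (real (Suc i) * active_prob (Suc i) x)" .
  qed
  also have "\<dots> = (\<Sum>b=1..a+1. exp (- r) * r ^ (a + 1 - b) / fact (a + 1 - b) * (real b * active_prob b x))"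
    by (rule sum.reindex_bij_witness[of _ "\<lambda>b. b - 1" Suc]) auto
  finally show ?thesis .
qed

text \<open>The probability that the stages before the head of the list are over at time \<open>t\<close> but the stage
  of the head is not.\<close>

definition gap :: "real list \<Rightarrow> real \<Rightarrow> real" where
  "gap rs t = hypoexp_cdf (tl rs) t - hypoexp_cdf rs t"

lemma hypoexp_scaled_derivative:
  assumes "b > 0" "t \<ge> 0"
  shows "((\<lambda>t. hypoexp_cdf (r # rs) (b * t)) has_real_derivative b * (r * (hypoexp_cdf rs (b * t) - hypoexp_cdf (r # rs) (b * t))))
    (at t within {0..})"
proof -
  have "(hypoexp_cdf (r # rs) has_real_derivative r * (hypoexp_cdf rs (b * t) - hypoexp_cdf (r # rs) (b * t)))
      (at (b * t) within (*) b ` {0..})"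
    using assms by (intro DERIV_subset[OF hypoexp_derivative]) auto
  moreover have "((*) b has_real_derivative b) (at t within {0..})"
    by (auto intro!: derivative_eq_intros)
  ultimately have "(hypoexp_cdf (r # rs) \<circ> (*) b has_real_derivative
      r * (hypoexp_cdf rs (b * t) - hypoexp_cdf (r # rs) (b * t)) * b) (at t within {0..})"
    by (rule DERIV_image_chain)
  then show ?thesis by (simp only: o_def mult.commute[of "r * (hypoexp_cdf rs (b * t) - hypoexp_cdf (r # rs) (b * t))" b])
qed

text \<open>A stage is entered when the preceding one ends, at rate \<open>hd rs\<close>, and left
  at rate \<open>r\<close>; the first stage has no inflow.\<close>

lemma gap_scaled_derivative:
  assumes "b > 0" "t \<ge> 0"
  shows "((\<lambda>t. gap (r # rs) (b * t)) has_real_derivative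
      b * ((if rs = [] then 0 else hd rs * gap rs (b * t)) - r * gap (r # rs) (b * t))) (at t within {0..})"
proof (cases rs)
  case Nil
  then show ?thesis
    using DERIV_minus[OF hypoexp_scaled_derivative[OF assms, of r "[]"]]
    by (auto simp: gap_def intro!: derivative_eq_intros hypoexp_scaled_derivative[OF assms])
next
  case (Cons r' rs')
  then show ?thesis
    using DERIV_diff[OF hypoexp_scaled_derivative[OF assms, of r' rs'] hypoexp_scaled_derivative[OF assms, of r rs]]
    by (simp add: gap_def right_diff_distrib)
qed

context exponential_hawkes_cluster
begin

section \<open>Differential equations for restricted expectations\<close>

lemma U_0:
  assumes "0 \<le> t"
  shows "U B 0 f t = 0"
proof -
  have "U B 0 f t = expectation (\<lambda>_. 0)"
    unfolding U_def using event_count_pos[OF _ assms(1)]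
    by (intro Bochner_Integration.integral_cong refl) (metis less_irrefl)
  then show ?thesis by simp
qed

text \<open>A bounded right side already yields continuity. This comes before differentiability,
  where the right side must be continuous.\<close>

lemma U_continuous:
  assumes t0: "0 \<le> t0" and B: "B \<in> sets (\<F> t0)"
  shows "continuous_on {t0..} (U B k (poly_exp p c))"
proof (cases k)
  case 0
  have "continuous_on {t0..} (\<lambda>_. 0 :: real)" by simp
  then show ?thesis
    unfolding 0 using t0 by (subst continuous_on_cong[OF refl U_0]) auto
next
  case (Suc j)
  let ?f = "poly_exp p c" and ?f1 = "poly_exp (pderiv p - smult c p) c"
  have cont: "continuous_on UNIV (\<lambda>x. - \<beta> * x * (?f1 x + ?f x))" "continuous_on UNIV (\<lambda>x. \<beta> * x * ?f (x + \<rho>))"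
    by (intro continuous_intros poly_exp_continuous continuous_on_compose2[OF poly_exp_continuous[of UNIV]]; simp)+
  obtain C1 C2 where "\<And>t B. \<bar>U B (Suc j) (\<lambda>x. - \<beta> * x * (?f1 x + ?f x)) t\<bar> \<le> C1"
    "\<And>t B. \<bar>U B j (\<lambda>x. \<beta> * x * ?f (x + \<rho>)) t\<bar> \<le> C2"
    using U_bounded[OF cont(1)] U_bounded[OF cont(2)] by metis
  then have bound: "\<bar>U B (Suc j) (\<lambda>x. - \<beta> * x * (?f1 x + ?f x)) t + U B j (\<lambda>x. \<beta> * x * ?f (x + \<rho>)) t\<bar> \<le> C1 + C2" for t
    by (meson abs_triangle_ineq add_mono order_trans)
  show ?thesis
    unfolding Suc
    by (rule increments_continuous[OF U_expansion[OF t0 B poly_exp_derivative poly_exp_derivative poly_exp_continuous] bound])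
qed

text \<open>Both functions on the right side are again of the form \<open>poly_exp\<close>, so
  \<open>U_continuous\<close> supplies the continuity that the derivative criterion asks
  for.\<close>

lemma U_derivative:
  assumes t0: "0 \<le> t0" and B: "B \<in> sets (\<F> t0)" and t: "t0 \<le> t"
  shows "(U B (Suc j) (poly_exp p c) has_real_derivative
      U B (Suc j) (\<lambda>x. - \<beta> * x * (poly_exp (pderiv p - smult c p) c x + poly_exp p c x)) t
      + U B j (\<lambda>x. \<beta> * x * poly_exp p c (x + \<rho>)) t) (at t within {t0..})"
proof (rule increments_derivative[OF U_expansion[OF t0 B poly_exp_derivative poly_exp_derivative poly_exp_continuous] _ t])
  have 1: "(\<lambda>x. - \<beta> * x * (poly_exp (pderiv p - smult c p) c x + poly_exp p c x))
      = poly_exp ([:0, - \<beta>:] * (pderiv p - smult c p + p)) c"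
    by (simp add: fun_eq_iff poly_exp_def algebra_simps)
  have 2: "(\<lambda>x. \<beta> * x * poly_exp p c (x + \<rho>))
      = poly_exp (smult (exp (- (c * \<rho>))) ([:0, \<beta>:] * pcompose p [:\<rho>, 1:])) c"
    by (simp add: fun_eq_iff poly_exp_def poly_pcompose distrib_left exp_diff exp_minus exp_add field_simps add.commute)
  show "continuous_on {t0..} (\<lambda>t. U B (Suc j) (\<lambda>x. - \<beta> * x * (poly_exp (pderiv p - smult c p) c x + poly_exp p c x)) t
      + U B j (\<lambda>x. \<beta> * x * poly_exp p c (x + \<rho>)) t)"
    unfolding 1 2 by (intro continuous_on_add U_continuous[OF t0 B])
qed

lemma U_integrable:
  fixes f :: "real \<Rightarrow> real"
  assumes "0 \<le> t0" "t0 \<le> t" "B \<in> sets (\<F> t0)" "continuous_on UNIV f"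
  shows "integrable M (\<lambda>\<omega>. if \<omega> \<in> B \<and> N t \<omega> = k then f (X t \<omega>) else 0)"
proof -
  obtain c where "c \<ge> 0" "\<And>x. 0 \<le> x \<Longrightarrow> x \<le> \<rho> * real k \<Longrightarrow> \<bar>f x\<bar> \<le> c"
    using bounded_on_interval[OF assms(4), of "\<rho> * real k"] by blast
  then show ?thesis
    using X_le[of _ t] X_nonneg assms
    by (intro bounded_integrable[where C = c] restricted_measurable(2)[OF assms(1-3)])
      (auto intro: borel_measurable_continuous_onI)
qed

lemma U_mult: "U B k (\<lambda>x. a * f x) t = a * U B k f t"
  unfolding U_def Bochner_Integration.integral_mult_right_zero[symmetric]
  by (intro Bochner_Integration.integral_cong) auto

lemma U_sum:
  fixes f :: "'i \<Rightarrow> real \<Rightarrow> real"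
  assumes "0 \<le> t0" "t0 \<le> t" "B \<in> sets (\<F> t0)" "\<And>i. i \<in> I \<Longrightarrow> continuous_on UNIV (f i)"
  shows "U B k (\<lambda>x. \<Sum>i\<in>I. f i x) t = (\<Sum>i\<in>I. U B k (f i) t)"
  unfolding U_def
  by (subst Bochner_Integration.integral_sum[symmetric])
    (auto intro!: U_integrable[OF assms(1-3)] assms(4) Bochner_Integration.integral_cong)

text \<open>The forward equation of the chain: a birth among \<open>b\<close> active individuals, at
  rate \<open>\<beta> * b\<close>, leads to \<open>a\<close> of them if the newborn has
  \<open>a + 1 - b\<close> children, and the state is left at rate
  \<open>\<beta> * a\<close>.\<close>

lemma U_active_derivative:
  assumes t0: "0 \<le> t0" and B: "B \<in> sets (\<F> t0)" and t: "t0 \<le> t"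
  shows "(U B (Suc j) (active_prob a) has_real_derivative
      \<beta> * (\<Sum>b=1..a+1. exp (- \<rho>) * \<rho> ^ (a + 1 - b) / fact (a + 1 - b) * (real b * U B j (active_prob b) t))
      - \<beta> * real a * U B (Suc j) (active_prob a) t) (at t within {t0..})"
proof -
  let ?m = "monom (1 / fact a) a :: real poly"
  have 1: "(\<lambda>x. - \<beta> * x * (poly_exp (pderiv ?m - smult 1 ?m) 1 x + poly_exp ?m 1 x)) = (\<lambda>x. (- \<beta> * real a) * active_prob a x)"
    using active_prob_decay[of _ a] by (simp add: fun_eq_iff mult.assoc flip: active_prob_def)
  have 2: "(\<lambda>x. \<beta> * x * poly_exp ?m 1 (x + \<rho>))
      = (\<lambda>x. \<beta> * (\<Sum>b=1..a+1. exp (- \<rho>) * \<rho> ^ (a + 1 - b) / fact (a + 1 - b) * (real b * active_prob b x)))"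
    using active_prob_jump[of _ a \<rho>] by (simp only: fun_eq_iff mult.assoc flip: active_prob_def) simp
  have cont: "continuous_on UNIV (\<lambda>x. exp (- \<rho>) * \<rho> ^ (a + 1 - b) / fact (a + 1 - b) * (real b * active_prob b x))" for b
    by (intro continuous_intros active_prob_continuous) auto
  have "U B j (\<lambda>x. \<beta> * (\<Sum>b=1..a+1. exp (- \<rho>) * \<rho> ^ (a + 1 - b) / fact (a + 1 - b) * (real b * active_prob b x))) t
      = \<beta> * (\<Sum>b=1..a+1. exp (- \<rho>) * \<rho> ^ (a + 1 - b) / fact (a + 1 - b) * (real b * U B j (active_prob b) t))"
    unfolding U_mult U_sum[OF t0 t B cont] by (rule refl)
  with U_derivative[OF t0 B t, of j ?m 1] show ?thesis
    unfolding 1 2 U_mult by (simp add: active_prob_def algebra_simps)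
qed

lemma space_in_filtration: "space M \<in> sets (\<F> t)"
  using sets.top[of "\<F> t"] by (simp only: space_filtration)

lemma U_at_0: "U (space M) k f 0 = (if k = 1 then f \<rho> else 0)"
proof -
  have "U (space M) k f 0 = expectation (\<lambda>_. if k = 1 then f \<rho> else 0)"
    unfolding U_def by (intro Bochner_Integration.integral_cong refl) (auto simp: event_count_0 X_0)
  then show ?thesis by (simp add: prob_space)
qed

text \<open>Induction on the number of births: each function solves a linear first order equation
  whose inhomogeneity is known from the previous level. The sum over paths solves the same equation,
  with outflow given by the head of the list of active counts and inflow by the entry after
  it.\<close>

lemma U_active_eq:
  assumes "0 \<le> t"
  shows "U (space M) (Suc j) (active_prob a) t =
    exp (- \<rho>) ^ Suc j * \<rho> ^ (a + j) * (\<Sum>c\<in>paths (Suc j) a. weight c * gap (map real (active_counts c)) (\<beta> * t))"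
  using assms
proof (induction j arbitrary: a t)
  case 0
  have paths: "paths (Suc 0) a = {[a]}" for a by (auto split: if_splits)
  have U: "(U (space M) (Suc 0) (active_prob a) has_real_derivative 0 - \<beta> * real a * U (space M) (Suc 0) (active_prob a) t) (at t within {0..})"
    if "t \<ge> 0" for t
    using U_active_derivative[OF order_refl space_in_filtration that, of 0 a] that by (simp add: U_0)
  define z where "z t = exp (- \<rho>) * \<rho> ^ a / fact a * gap [real a] (\<beta> * t)" for t
  have z: "(z has_real_derivative 0 - \<beta> * real a * z t) (at t within {0..})" if "t \<ge> 0" for t
    using DERIV_cmult[OF gap_scaled_derivative[OF beta_pos that, of "real a" "[]"], of "exp (- \<rho>) * \<rho> ^ a / fact a"]
    unfolding z_def[abs_def] by (simp add: algebra_simps)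
  \<comment> \<open>The initial values agree: \<open>gap [real a] 0 = 1\<close>, and what remains is
    the Poisson probability that the root has \<open>a\<close> children.\<close>
  have "U (space M) (Suc 0) (active_prob a) t = z t"
    by (rule linear_ode_unique[OF U z _ 0]) (simp_all add: U_at_0 z_def gap_def active_prob_eq)
  then show ?case unfolding paths z_def by simp
next
  case (Suc j)
  define \<kappa> where "\<kappa> = exp (- \<rho>) ^ Suc (Suc j) * \<rho> ^ (a + Suc j)"
  define u where "u b t = (\<Sum>c\<in>paths (Suc j) b. weight c * gap (map real (active_counts c)) (\<beta> * t))" for b t
  define z where "z t = \<kappa> * (\<Sum>b=1..a+1. \<Sum>c\<in>paths (Suc j) b. weight c / fact (a + 1 - b) *
      gap (real a # map real (active_counts c)) (\<beta> * t))" for t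
  define h where "h t = \<beta> * (\<Sum>b=1..a+1. exp (- \<rho>) * \<rho> ^ (a + 1 - b) / fact (a + 1 - b) *
      (real b * U (space M) (Suc j) (active_prob b) t))" for t
  have h: "h t = \<beta> * \<kappa> * (\<Sum>b=1..a+1. real b * u b t / fact (a + 1 - b))" if "t \<ge> 0" for t
  proof -
    have eq: "exp (- \<rho>) * \<rho> ^ (a + 1 - b) / fact (a + 1 - b) * (real b * U (space M) (Suc j) (active_prob b) t)
        = \<kappa> * (real b * u b t / fact (a + 1 - b))" if b: "b \<in> {1..a+1}" for b
    proof -
      \<comment> \<open>The exponent of \<rho> is the total number of children; those of the last
        individual are split off.\<close>
      have "a + Suc j = (a + 1 - b) + (b + j)" using b by auto
      then show ?thesis
        unfolding Suc.IH[OF \<open>t \<ge> 0\<close>] \<kappa>_def u_def by (simp only: power_add power_Suc) simp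
    qed
    have "h t = \<beta> * (\<Sum>b=1..a+1. \<kappa> * (real b * u b t / fact (a + 1 - b)))"
      unfolding h_def by (intro arg_cong[where f = "(*) \<beta>"] sum.cong[OF refl] eq)
    then show ?thesis by (simp only: sum_distrib_left[symmetric] mult.assoc)
  qed
  have inner: "(\<Sum>c\<in>P. w c / F * (\<beta> * (x * g c - y * G c)))
      = \<beta> * (x * (\<Sum>c\<in>P. w c * g c) / F) - \<beta> * y * (\<Sum>c\<in>P. w c / F * G c)"
    for P :: "nat list set" and w g G :: "nat list \<Rightarrow> real" and F x y
    by (simp add: right_diff_distrib diff_divide_distrib sum_subtractf sum_distrib_left sum_divide_distrib mult_ac)
  have z: "(z has_real_derivative h t - \<beta> * real a * z t) (at t within {0..})" if t: "t \<ge> 0" for t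
  proof -
    have "((\<lambda>t. gap (real a # map real (active_counts c)) (\<beta> * t)) has_real_derivative
        \<beta> * (real b * gap (map real (active_counts c)) (\<beta> * t) - real a * gap (real a # map real (active_counts c)) (\<beta> * t))) (at t within {0..})"
      if "c \<in> paths (Suc j) b" for b c
      using gap_scaled_derivative[OF beta_pos t, of "real a" "map real (active_counts c)"] active_counts_Cons[OF that] by simp
    then have "(z has_real_derivative \<kappa> * (\<Sum>b=1..a+1. \<Sum>c\<in>paths (Suc j) b. weight c / fact (a + 1 - b) *
        (\<beta> * (real b * gap (map real (active_counts c)) (\<beta> * t) - real a * gap (real a # map real (active_counts c)) (\<beta> * t))))) (at t within {0..})"
      unfolding z_def[abs_def] by (intro DERIV_cmult DERIV_sum) auto
    also have "(\<Sum>b=1..a+1. \<Sum>c\<in>paths (Suc j) b. weight c / fact (a + 1 - b) *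
        (\<beta> * (real b * gap (map real (active_counts c)) (\<beta> * t) - real a * gap (real a # map real (active_counts c)) (\<beta> * t))))
      = (\<Sum>b=1..a+1. \<beta> * (real b * u b t / fact (a + 1 - b))
          - \<beta> * real a * (\<Sum>c\<in>paths (Suc j) b. weight c / fact (a + 1 - b) * gap (real a # map real (active_counts c)) (\<beta> * t)))"
      unfolding u_def inner by (rule refl)
    also have "\<kappa> * \<dots> = \<kappa> * (\<beta> * (\<Sum>b=1..a+1. real b * u b t / fact (a + 1 - b))
          - \<beta> * real a * (\<Sum>b=1..a+1. \<Sum>c\<in>paths (Suc j) b. weight c / fact (a + 1 - b) * gap (real a # map real (active_counts c)) (\<beta> * t)))"
      by (simp only: sum_subtractf sum_distrib_left)
    also have "\<dots> = h t - \<beta> * real a * z t"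
      unfolding h[OF t] z_def by (simp only: right_diff_distrib mult_ac)
    finally show ?thesis .
  qed
  have "U (space M) (Suc (Suc j)) (active_prob a) t = z t"
  proof (rule linear_ode_unique[OF _ z _ \<open>0 \<le> t\<close>])
    show "(U (space M) (Suc (Suc j)) (active_prob a) has_real_derivative
        h t - \<beta> * real a * U (space M) (Suc (Suc j)) (active_prob a) t) (at t within {0..})" if "t \<ge> 0" for t
      using U_active_derivative[OF order_refl space_in_filtration that, of "Suc j" a] by (simp add: h_def)
    have "gap (real a # map real (active_counts c)) 0 = 0" if "c \<in> paths (Suc j) b" for b c
      using active_counts_Cons[OF that] by (simp add: gap_def)
    then show "U (space M) (Suc (Suc j)) (active_prob a) 0 = z 0" by (simp add: U_at_0 z_def)
  qed
  also have "z t = \<kappa> * (\<Sum>c\<in>paths (Suc (Suc j)) a. weight c * gap (map real (active_counts c)) (\<beta> * t))"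
  proof -
    have "active_counts ((a + 1 - b) # c) = a # active_counts c" if "b \<in> {1..a+1}" "c \<in> paths (Suc j) b" for b c
      using that by (auto simp: paths_iff simp del: paths.simps)
    then show ?thesis
      unfolding z_def sum_paths_Suc[of _ "Suc j"] by (intro arg_cong[where f = "(*) \<kappa>"] sum.cong refl) simp
  qed
  finally show ?case by (simp only: \<kappa>_def)
qed

text \<open>With nobody active the head of the list is \<open>0\<close>; this stage never ends, so
  only the distribution function of the completed stages is left in the gap.\<close>

lemma U_active_0_eq:
  assumes "0 \<le> t"
  shows "U (space M) (Suc j) (active_prob 0) t = parking_cdf \<rho> (Suc j) (\<beta> * t)"
proof -
  have "gap (map real (active_counts c)) s = hypoexp_cdf (map real (active_counts (tl c))) s" if "c \<in> paths (Suc j) 0" for c s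
    using active_counts_Cons[OF that] by (simp add: gap_def)
  moreover have "exp (- \<rho>) ^ Suc j = exp (- \<rho> * real (Suc j))"
    by (simp only: exp_of_nat_mult[symmetric] mult.commute)
  ultimately show ?thesis
    unfolding U_active_eq[OF assms] parking_cdf_def by simp
qed

end

section \<open>Size and duration of the cluster\<close>

context exponential_hawkes_cluster
begin

section \<open>Probability of no further event\<close>

text \<open>Countably many times keep the event measurable; since the count is monotone they decide
  all times after \<open>t\<close>.\<close>

definition extinct :: "nat \<Rightarrow> real \<Rightarrow> 'a set" where
  "extinct k t = {\<omega> \<in> space M. \<forall>n::nat. N (t + real n) \<omega> = k}"

lemma extinct_measurable [measurable]: "extinct k t \<in> sets M"
  unfolding extinct_def by measurable

lemma extinctD:
  assumes "\<omega> \<in> extinct k t" "t \<le> s"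
  shows "N s \<omega> = k"
proof -
  have \<omega>: "\<omega> \<in> space M" and eq: "N (t + real n) \<omega> = k" for n using assms by (auto simp: extinct_def)
  obtain n :: nat where "s \<le> t + real n" using real_arch_simple[of "s - t"] by (auto simp: algebra_simps)
  then have "N s \<omega> \<le> k" using event_count_mono[OF \<omega>, of s "t + real n"] eq by simp
  moreover have "k \<le> N s \<omega>" using event_count_mono[OF \<omega> assms(2)] eq[of 0] by simp
  ultimately show ?thesis by simp
qed

text \<open>The function \<open>x \<mapsto> exp (- x)\<close> is harmonic up to the next event, which makes \<open>exp (- X)\<close> the
  probability of no further event.\<close>

lemma prob_extinct:
  assumes t: "0 \<le> t"
  shows "prob (extinct (Suc j) t) = U (space M) (Suc j) (active_prob 0) t"
proof -
  define B where "B = {\<omega> \<in> space M. N t \<omega> = Suc j}"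
  have B: "B \<in> sets (\<F> t)"
    unfolding sets_filtration B_def using t by (intro sigma_sets.Basic) auto
  have zero: "U B j f s = 0" if "t \<le> s" for f s
  proof -
    have "U B j f s = expectation (\<lambda>_. 0)"
      unfolding U_def
    proof (intro Bochner_Integration.integral_cong refl)
      fix \<omega> assume "\<omega> \<in> space M"
      then show "(if \<omega> \<in> B \<and> N s \<omega> = j then f (X s \<omega>) else 0) = 0"
        using event_count_mono[OF _ that, of \<omega>] by (auto simp: B_def)
    qed
    then show ?thesis by simp
  qed
  \<comment> \<open>On \<open>B\<close> there is no inflow after time \<open>t\<close>, and the
    state \<open>a = 0\<close> has outflow rate \<open>0\<close>.\<close>
  have "(U B (Suc j) (active_prob 0) has_real_derivative 0) (at s within {t..})" if "s \<in> {t..}" for s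
    using U_active_derivative[OF t B, of s j 0] that by (simp add: zero)
  then obtain c where c: "U B (Suc j) (active_prob 0) s = c" if "t \<le> s" for s
    using has_field_derivative_zero_constant[of "{t..}" "U B (Suc j) (active_prob 0)"]
    by (metis atLeast_iff convex_real_interval(1))
  \<comment> \<open>The constant is identified in the limit: without further events \<open>X\<close>
    decays to \<open>0\<close> and the integrand tends to \<open>1\<close>; otherwise it is
    eventually \<open>0\<close>.\<close>
  let ?W = "\<lambda>n \<omega>. if \<omega> \<in> B \<and> N (t + real n) \<omega> = Suc j then active_prob 0 (X (t + real n) \<omega>) else 0"
  have "(\<lambda>n. expectation (?W n)) \<longlonglongrightarrow> expectation (indicator (extinct (Suc j) t))"
  proof (rule integral_dominated_convergence[where w = "\<lambda>_. 1"])
    show "AE \<omega> in M. (\<lambda>n. ?W n \<omega>) \<longlonglongrightarrow> indicator (extinct (Suc j) t) \<omega>"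
    proof (rule AE_I2)
      fix \<omega> assume \<omega>: "\<omega> \<in> space M"
      show "(\<lambda>n. ?W n \<omega>) \<longlonglongrightarrow> indicator (extinct (Suc j) t) \<omega>"
      proof (cases "\<omega> \<in> extinct (Suc j) t")
        case True
        then have N: "N (t + real n) \<omega> = Suc j" for n by (simp add: extinct_def)
        then have "\<omega> \<in> B" using N[of 0] \<omega> by (simp add: B_def)
        have X: "X (t + real n) \<omega> = exp (- (\<beta> * real n)) * X t \<omega>" for n
          using N[of n] N[of 0] by (intro X_no_event) simp
        have "(\<lambda>n. exp (- \<beta>) ^ n) \<longlonglongrightarrow> 0" using beta_pos by (intro LIMSEQ_realpow_zero) auto
        then have "(\<lambda>n. exp (- (\<beta> * real n))) \<longlonglongrightarrow> 0"
          by (simp add: mult.commute flip: exp_of_nat_mult)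
        then have "(\<lambda>n. exp (- (exp (- (\<beta> * real n)) * X t \<omega>))) \<longlonglongrightarrow> exp (- (0 * X t \<omega>))"
          by (intro tendsto_intros)
        then show ?thesis using True \<open>\<omega> \<in> B\<close> by (simp add: N X active_prob_eq)
      next
        case False
        then obtain m where m: "N (t + real m) \<omega> \<noteq> Suc j" using \<omega> by (auto simp: extinct_def)
        have "\<forall>\<^sub>F n in sequentially. ?W n \<omega> = 0"
          using eventually_ge_at_top[of m]
        proof eventually_elim
          case (elim n)
          have "N t \<omega> \<le> N (t + real m) \<omega>" "N (t + real m) \<omega> \<le> N (t + real n) \<omega>"
            using elim by (auto intro!: event_count_mono[OF \<omega>])
          then show ?case using m by (auto simp: B_def)
        qed
        then show ?thesis using False by (auto intro: tendsto_eventually)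
      qed
    qed
    show "?W n \<in> borel_measurable M" for n
      using t by (intro restricted_measurable(2)[OF t _ B])
        (auto intro: borel_measurable_continuous_onI active_prob_continuous)
    show "AE \<omega> in M. norm (?W n \<omega>) \<le> 1" for n
      using X_nonneg by (intro AE_I2) (auto simp: active_prob_eq)
  qed auto
  moreover have "expectation (?W n) = c" for n
    using c[of "t + real n"] by (simp add: U_def)
  ultimately have "expectation (indicator (extinct (Suc j) t)) = c"
    by (simp add: LIMSEQ_const_iff)
  also have "c = U B (Suc j) (active_prob 0) t" using c[of t] by simp
  also have "\<dots> = U (space M) (Suc j) (active_prob 0) t"
    unfolding U_def by (intro Bochner_Integration.integral_cong) (auto simp: B_def)
  finally show ?thesis by simp
qed

text \<open>The process \<open>N + X / (1 - \<rho>)\<close> is a martingale, since an event raises it by \<open>1 / (1 - \<rho>)\<close>, at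
  rate \<open>\<beta> X\<close>, while \<open>X\<close> decays at rate \<open>\<beta>\<close>.\<close>

lemma truncated_martingale_le:
  assumes t: "0 \<le> t"
  shows "(\<Sum>k=1..m. U (space M) k (\<lambda>x. real k + x / (1 - \<rho>)) t) \<le> 1 / (1 - \<rho>)"
proof -
  define r where "r = 1 / (1 - \<rho>)"
  \<comment> \<open>The fixed point property makes the inflow into level \<open>Suc j\<close> equal
    to the outflow \<open>H j\<close> of level \<open>j\<close>.\<close>
  have r: "r > 0" "1 + \<rho> * r = r" using rho_less_1 by (auto simp: r_def field_simps)
  define G where "G k x = real k + x * r" for k x
  define H where "H k x = \<beta> * x * (G k x + r)" for k x
  define Z where "Z t = (\<Sum>j<m. U (space M) (Suc j) (G (Suc j)) t)" for t
  have G: "G k = poly_exp [:real k, r:] 0" for k by (simp add: fun_eq_iff G_def poly_exp_def)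
  have "(Z has_real_derivative - U (space M) m (H m) s) (at s within {0..})" if s: "0 \<le> s" for s
  proof -
    have "(U (space M) (Suc j) (G (Suc j)) has_real_derivative - U (space M) (Suc j) (H (Suc j)) s + U (space M) j (H j) s)
        (at s within {0..})" for j
    proof -
      have 1: "(\<lambda>x. - \<beta> * x * (poly_exp (pderiv [:real (Suc j), r:] - smult 0 [:real (Suc j), r:]) 0 x
          + poly_exp [:real (Suc j), r:] 0 x)) = (\<lambda>x. (- 1) * H (Suc j) x)"
        by (simp add: fun_eq_iff poly_exp_def H_def G_def pderiv_pCons algebra_simps)
      have "\<beta> * x * (G (Suc j) (x + \<rho>)) = H j x" for x
      proof -
        have "G (Suc j) (x + \<rho>) = G j x + (1 + \<rho> * r)" by (simp add: G_def algebra_simps)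
        then show ?thesis unfolding r(2) H_def by simp
      qed
      then have 2: "(\<lambda>x. \<beta> * x * poly_exp [:real (Suc j), r:] 0 (x + \<rho>)) = H j"
        by (simp only: G[symmetric] fun_eq_iff) simp
      show ?thesis
        using U_derivative[OF order_refl space_in_filtration s, of j "[:real (Suc j), r:]" 0]
        unfolding 1 2 unfolding U_mult G[of "Suc j", symmetric] by simp
    qed
    then have "(Z has_real_derivative (\<Sum>j<m. - U (space M) (Suc j) (H (Suc j)) s + U (space M) j (H j) s)) (at s within {0..})"
      unfolding Z_def[abs_def] by (intro DERIV_sum) auto
    \<comment> \<open>Flows between neighbouring levels telescope. Only the outflow from the top
      level survives, so truncation can only lower the sum.\<close>
    also have "(\<Sum>j<m. - U (space M) (Suc j) (H (Suc j)) s + U (space M) j (H j) s) = U (space M) 0 (H 0) s - U (space M) m (H m) s"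
      by (induction m) auto
    finally show ?thesis using s by (simp add: U_0)
  qed
  note deriv = this
  have H_nonneg: "0 \<le> U (space M) m (H m) s" for s
    unfolding U_def using X_nonneg beta_pos r
    by (intro Bochner_Integration.integral_nonneg) (auto simp: H_def G_def intro!: mult_nonneg_nonneg add_nonneg_nonneg)
  have "Z t \<le> Z 0"
  proof (rule DERIV_nonpos_imp_decreasing_open[OF t])
    show "continuous_on {0..t} Z"
      using DERIV_continuous_on[of "{0..}" Z, OF deriv] by (auto intro: continuous_on_subset)
    fix s assume s: "0 < s" "s < t"
    then have "(Z has_real_derivative - U (space M) m (H m) s) (at s)"
      using deriv[of s] at_within_interior[of s "{0..}"] by (simp add: interior_real_atLeast)
    then show "\<exists>y. (Z has_real_derivative y) (at s) \<and> y \<le> 0" using H_nonneg by auto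
  qed
  also have "Z 0 \<le> r"
  proof -
    have "Z 0 = (\<Sum>j<m. if j = 0 then r else 0)"
      unfolding Z_def by (intro sum.cong refl) (use r in \<open>auto simp: U_at_0 G_def\<close>)
    also have "\<dots> \<le> r" using r by (simp add: sum.delta)
    finally show ?thesis .
  qed
  also have "Z t = (\<Sum>k=1..m. U (space M) k (\<lambda>x. real k + x / (1 - \<rho>)) t)"
    unfolding Z_def by (rule sum.reindex_bij_witness[of _ "\<lambda>k. k - 1" Suc]) (auto simp: G_def[abs_def] r_def)
  finally show ?thesis by (simp add: r_def)
qed

section \<open>Almost sure finiteness of the cluster\<close>

lemma prob_incseq_le:
  assumes "\<And>n. S n \<in> sets M" "incseq S" "\<And>n. prob (S n) \<le> c"
  shows "prob (\<Union>n. S n) \<le> c"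
proof (rule LIMSEQ_le_const2)
  show "(\<lambda>n. prob (S n)) \<longlonglongrightarrow> prob (\<Union>n. S n)"
    using assms by (intro finite_Lim_measure_incseq) auto
qed (use assms in auto)

text \<open>Markov's inequality for the truncated sum, whose bound depends on neither the truncation
  nor the time; both are then removed by monotone unions.\<close>

lemma prob_large_size:
  assumes k: "k > 0"
  shows "prob {\<omega> \<in> space M. \<exists>n::nat. k \<le> N (real n) \<omega>} \<le> 1 / (1 - \<rho>) / real k"
proof -
  have bound: "prob {\<omega> \<in> space M. k \<le> N t \<omega> \<and> N t \<omega> \<le> m} \<le> 1 / (1 - \<rho>) / real k" if t: "0 \<le> t" for t m
  proof -
    let ?f = "\<lambda>i x. real i + x / (1 - \<rho>)"
    let ?E = "{\<omega> \<in> space M. k \<le> N t \<omega> \<and> N t \<omega> \<le> m}"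
    have int: "integrable M (\<lambda>\<omega>. if \<omega> \<in> space M \<and> N t \<omega> = i then ?f i (X t \<omega>) else 0)" for i
      by (rule U_integrable[OF order_refl t space_in_filtration])
        (use rho_less_1 in \<open>intro continuous_intros; simp\<close>)
    have "real k * prob ?E = expectation (\<lambda>\<omega>. real k * indicator ?E \<omega>)" by simp
    also have "\<dots> \<le> expectation (\<lambda>\<omega>. \<Sum>i=1..m. if \<omega> \<in> space M \<and> N t \<omega> = i then ?f i (X t \<omega>) else 0)"
    proof (rule integral_mono)
      show "integrable M (\<lambda>\<omega>. real k * indicator ?E \<omega>)" by (intro integrable_mult_right integrable_real_indicator) (auto simp: emeasure_eq_measure)
      show "integrable M (\<lambda>\<omega>. \<Sum>i=1..m. if \<omega> \<in> space M \<and> N t \<omega> = i then ?f i (X t \<omega>) else 0)"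
        by (intro Bochner_Integration.integrable_sum int)
      fix \<omega> assume \<omega>: "\<omega> \<in> space M"
      have pos: "0 \<le> X t \<omega> / (1 - \<rho>)" using X_nonneg rho_less_1 by simp
      have eq: "(\<Sum>i=1..m. if \<omega> \<in> space M \<and> N t \<omega> = i then ?f i (X t \<omega>) else 0)
          = (if N t \<omega> \<in> {1..m} then ?f (N t \<omega>) (X t \<omega>) else 0)"
        using \<omega> by (simp add: sum.delta')
      show "real k * indicator ?E \<omega> \<le> (\<Sum>i=1..m. if \<omega> \<in> space M \<and> N t \<omega> = i then ?f i (X t \<omega>) else 0)"
        unfolding eq using pos k by (auto split: split_indicator)
    qed
    also have "\<dots> = (\<Sum>i=1..m. U (space M) i (?f i) t)"
      unfolding U_def by (rule Bochner_Integration.integral_sum) (rule int)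
    also have "\<dots> \<le> 1 / (1 - \<rho>)" by (rule truncated_martingale_le[OF t])
    finally show ?thesis using k by (subst pos_le_divide_eq) (auto simp: mult.commute)
  qed
  have 1: "prob {\<omega> \<in> space M. k \<le> N t \<omega>} \<le> 1 / (1 - \<rho>) / real k" if t: "0 \<le> t" for t
  proof -
    have "{\<omega> \<in> space M. k \<le> N t \<omega>} = (\<Union>m. {\<omega> \<in> space M. k \<le> N t \<omega> \<and> N t \<omega> \<le> m})" by auto
    moreover have "prob (\<Union>m. {\<omega> \<in> space M. k \<le> N t \<omega> \<and> N t \<omega> \<le> m}) \<le> 1 / (1 - \<rho>) / real k"
      using bound[OF t] by (intro prob_incseq_le) (auto simp: incseq_def)
    ultimately show ?thesis by (simp only:)
  qed
  have "{\<omega> \<in> space M. \<exists>n::nat. k \<le> N (real n) \<omega>} = (\<Union>n. {\<omega> \<in> space M. k \<le> N (real n) \<omega>})" by auto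
  moreover have "prob (\<Union>n. {\<omega> \<in> space M. k \<le> N (real n) \<omega>}) \<le> 1 / (1 - \<rho>) / real k"
  proof (rule prob_incseq_le)
    show "incseq (\<lambda>n. {\<omega> \<in> space M. k \<le> N (real n) \<omega>})"
      using event_count_mono by (auto simp: incseq_def) (meson of_nat_le_iff order_trans)
  qed (use 1 in auto)
  ultimately show ?thesis by (simp only:)
qed

definition finite_size :: "nat \<Rightarrow> 'a set" where
  "finite_size k = (\<Union>n::nat. extinct k (real n))"

lemma finite_size_measurable [measurable]: "finite_size k \<in> sets M"
  unfolding finite_size_def by measurable

lemma bounded_imp_finite_size:
  assumes \<omega>: "\<omega> \<in> space M" and b: "\<And>n::nat. N (real n) \<omega> \<le> b"
  shows "\<exists>k. \<omega> \<in> finite_size k"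
proof -
  let ?S = "range (\<lambda>n::nat. N (real n) \<omega>)"
  have fin: "finite ?S" using b by (intro finite_subset[of ?S "{..b}"]) auto
  then have "Max ?S \<in> ?S" by (intro Max_in) auto
  then obtain n :: nat where n: "Max ?S = N (real n) \<omega>" by (rule rangeE)
  have "N (real n + real m) \<omega> = Max ?S" for m
  proof (rule antisym)
    have "N (real (n + m)) \<omega> \<le> Max ?S" using fin by (intro Max_ge rangeI)
    then show "N (real n + real m) \<omega> \<le> Max ?S" by simp
    show "Max ?S \<le> N (real n + real m) \<omega>" unfolding n by (rule event_count_mono[OF \<omega>]) simp
  qed
  then have "\<omega> \<in> extinct (Max ?S) (real n)" using \<omega> by (simp add: extinct_def)
  then show ?thesis unfolding finite_size_def by blast
qed

text \<open>The bound of order \<open>1 / k\<close> on the probability of reaching size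
  \<open>k\<close> leaves nothing for unbounded counts.\<close>

lemma AE_finite_size: "AE \<omega> in M. \<exists>k. \<omega> \<in> finite_size k"
proof -
  define V where "V k = {\<omega> \<in> space M. \<exists>n::nat. k \<le> N (real n) \<omega>}" for k
  have [measurable]: "V k \<in> sets M" for k unfolding V_def by measurable
  have "prob (\<Inter>k. V k) \<le> 0"
  proof (rule LIMSEQ_le_const)
    show "(\<lambda>k. 1 / (1 - \<rho>) / real (Suc k)) \<longlonglongrightarrow> 0"
      using tendsto_mult_right_zero[OF LIMSEQ_inverse_real_of_nat, of "1 / (1 - \<rho>)"] by (simp add: divide_inverse)
    have "prob (\<Inter>k. V k) \<le> 1 / (1 - \<rho>) / real (Suc k)" for k
      using finite_measure_mono[of "\<Inter>k. V k" "V (Suc k)"] prob_large_size[of "Suc k"]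
      by (fastforce simp: V_def)
    then show "\<exists>n0. \<forall>k\<ge>n0. prob (\<Inter>k. V k) \<le> 1 / (1 - \<rho>) / real (Suc k)" by blast
  qed
  then have "prob (\<Inter>k. V k) = 0" by (simp add: measure_le_0_iff)
  then have "AE \<omega> in M. \<omega> \<notin> (\<Inter>k. V k)"
    by (intro AE_not_in) (auto simp: null_sets_def emeasure_eq_measure)
  with AE_space show ?thesis
  proof eventually_elim
    case (elim \<omega>)
    then obtain k where "\<And>n::nat. \<not> k \<le> N (real n) \<omega>" by (auto simp: V_def)
    then show ?case using elim by (intro bounded_imp_finite_size[of \<omega> k]) (auto simp: not_le less_imp_le)
  qed
qed

section \<open>Measurability and distribution function of the duration\<close>

lemma finite_sizeD:
  assumes "\<omega> \<in> finite_size k"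
  shows "\<omega> \<in> space M" "k \<ge> 1" "cluster_size A \<omega> = k" "N t \<omega> \<le> k" "A (k - 1) \<omega> < \<infinity>"
proof -
  obtain n :: nat where n: "\<omega> \<in> extinct k (real n)" using assms by (auto simp: finite_size_def)
  then show \<omega>: "\<omega> \<in> space M" by (simp add: extinct_def)
  have N_k: "N s \<omega> = k" if "real n \<le> s" for s using extinctD[OF n that] .
  show k: "k \<ge> 1" using event_count_pos[OF \<omega>, of "real n"] N_k[of "real n"] by simp
  have "((\<lambda>t. N t \<omega>) \<longlongrightarrow> k) at_top"
    by (intro tendsto_eventually eventually_mono[OF eventually_ge_at_top[of "real n"]] N_k)
  then show "cluster_size A \<omega> = k"
    unfolding cluster_size_def by (intro tendsto_Lim) auto
  show "N t \<omega> \<le> k" using event_count_mono[OF \<omega>, of t "max t (real n)"] N_k[of "max t (real n)"] by simp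
  have "A (k - 1) \<omega> \<le> ereal (real n)"
    using less_event_count_iff[OF \<omega>, of "k - 1" "real n"] N_k[of "real n"] k by simp
  then show "A (k - 1) \<omega> < \<infinity>" by auto
qed

text \<open>On the null set of infinite clusters \<open>Lim\<close> is a definite description of nothing, hence constant,
  which is needed for measurability.\<close>

lemma cluster_size_infinite:
  assumes \<omega>: "\<omega> \<in> space M" and "\<And>k. \<omega> \<notin> finite_size k"
  shows "cluster_size A \<omega> = (THE l. False)"
proof -
  have "\<not> ((\<lambda>t. N t \<omega>) \<longlongrightarrow> l) at_top" for l
  proof
    assume "((\<lambda>t. N t \<omega>) \<longlongrightarrow> l) at_top"
    then have "\<forall>\<^sub>F t in at_top. N t \<omega> = l"
      by (simp add: tendsto_discrete)
    then obtain T where T: "\<And>t. T \<le> t \<Longrightarrow> N t \<omega> = l" by (auto simp: eventually_at_top_linorder)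
    obtain n :: nat where "T \<le> real n" using real_arch_simple by blast
    then have "\<omega> \<in> extinct l (real n)" using \<omega> T by (auto simp: extinct_def)
    with assms(2)[of l] show False by (auto simp: finite_size_def)
  qed
  then show ?thesis by (simp add: cluster_size_def t2_space_class.Lim_def)
qed

lemma cluster_size_measurable: "cluster_size A \<in> measurable M (count_space UNIV)"
proof (subst measurable_count_space_eq2_countable, intro conjI ballI)
  fix k :: nat
  let ?S = "finite_size k \<union> (if k = (THE l. False) then space M - (\<Union>k. finite_size k) else {})"
  have "cluster_size A -` {k} \<inter> space M = ?S"
  proof (intro equalityI subsetI)
    fix \<omega> assume "\<omega> \<in> cluster_size A -` {k} \<inter> space M"
    then show "\<omega> \<in> ?S" using finite_sizeD(3)[of \<omega>] cluster_size_infinite[of \<omega>] by auto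
  next
    fix \<omega> assume "\<omega> \<in> ?S"
    then show "\<omega> \<in> cluster_size A -` {k} \<inter> space M"
      using finite_sizeD(1,3)[of \<omega> k] cluster_size_infinite[of \<omega>] by (auto split: if_splits)
  qed
  also have "?S \<in> sets M" by auto
  finally show "cluster_size A -` {k} \<inter> space M \<in> sets M" .
qed auto

lemma cluster_duration_measurable: "cluster_duration A \<in> borel_measurable M"
proof -
  note [measurable] = epoch_measurable cluster_size_measurable
  have "(\<lambda>\<omega>. real_of_ereal (A (cluster_size A \<omega> - 1) \<omega>)) \<in> borel_measurable M"
    by (rule measurable_compose_countable[of "\<lambda>n \<omega>. real_of_ereal (A (n - 1) \<omega>)"]) measurable
  then show ?thesis by (simp add: cluster_duration_def[abs_def])
qed

text \<open>The last epoch has passed exactly when the count has reached its final value. This turns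
  a condition on a random epoch into events of known probability.\<close>

lemma duration_le_iff:
  assumes \<omega>: "\<omega> \<in> finite_size k"
  shows "cluster_duration A \<omega> \<le> t \<longleftrightarrow> (\<exists>j. \<omega> \<in> extinct (Suc j) t)"
proof -
  note fs = finite_sizeD[OF \<omega>]
  obtain r where r: "A (k - 1) \<omega> = ereal r"
    using fs(5) epoch_nonneg[OF fs(1), of "k - 1"] by (cases "A (k - 1) \<omega>") auto
  have "cluster_duration A \<omega> \<le> t \<longleftrightarrow> A (k - 1) \<omega> \<le> ereal t"
    using r by (simp add: cluster_duration_def fs(3))
  also have "\<dots> \<longleftrightarrow> k \<le> N t \<omega>"
    using less_event_count_iff[OF fs(1), of "k - 1" t] fs(2) by auto
  also have "\<dots> \<longleftrightarrow> (\<exists>j. \<omega> \<in> extinct (Suc j) t)"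
  proof
    assume k: "k \<le> N t \<omega>"
    have "N (t + real n) \<omega> = k" for n
      using k event_count_mono[OF fs(1), of t "t + real n"] fs(4)[of "t + real n"] by simp
    then show "\<exists>j. \<omega> \<in> extinct (Suc j) t"
      using fs(1,2) by (intro exI[of _ "k - 1"]) (simp add: extinct_def)
  next
    assume "\<exists>j. \<omega> \<in> extinct (Suc j) t"
    then obtain l where l: "\<omega> \<in> extinct l t" by blast
    obtain n where n: "\<omega> \<in> extinct k (real n)" using \<omega> by (auto simp: finite_size_def)
    have "l = k" using extinctD[OF l, of "max t (real n)"] extinctD[OF n, of "max t (real n)"] by simp
    then show "k \<le> N t \<omega>" using extinctD[OF l order_refl] by simp
  qed
  finally show ?thesis .
qed

lemma emeasure_duration:
  "emeasure (distr M borel (cluster_duration A)) {..t} =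
    (if t \<ge> 0 then \<Sum>j. ennreal (parking_cdf \<rho> (Suc j) (\<beta> * t)) else 0)"
proof -
  note [measurable] = cluster_duration_measurable
  have "emeasure (distr M borel (cluster_duration A)) {..t} = emeasure M {\<omega> \<in> space M. cluster_duration A \<omega> \<le> t}"
    by (subst emeasure_distr) (auto intro!: arg_cong[where f = "emeasure M"])
  also have "\<dots> = (if t \<ge> 0 then \<Sum>j. ennreal (parking_cdf \<rho> (Suc j) (\<beta> * t)) else 0)"
  proof (cases "t \<ge> 0")
    case False
    have "0 \<le> cluster_duration A \<omega>" if "\<omega> \<in> space M" for \<omega>
      using epoch_nonneg[OF that] by (simp add: cluster_duration_def real_of_ereal_pos)
    then have empty: "{\<omega> \<in> space M. cluster_duration A \<omega> \<le> t} = {}" using False by force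
    show ?thesis unfolding empty using False by simp
  next
    case True
    have "emeasure M {\<omega> \<in> space M. cluster_duration A \<omega> \<le> t} = emeasure M (\<Union>j. extinct (Suc j) t)"
    proof (rule emeasure_eq_AE)
      show "AE \<omega> in M. \<omega> \<in> {\<omega> \<in> space M. cluster_duration A \<omega> \<le> t} \<longleftrightarrow> \<omega> \<in> (\<Union>j. extinct (Suc j) t)"
        using AE_finite_size by eventually_elim (auto simp: duration_le_iff finite_sizeD(1))
    qed measurable
    also have "\<dots> = (\<Sum>j. emeasure M (extinct (Suc j) t))"
    proof (rule suminf_emeasure[symmetric])
      have "i = j" if "\<omega> \<in> extinct (Suc i) t" "\<omega> \<in> extinct (Suc j) t" for i j \<omega>
        using that[THEN extinctD, OF order_refl] by simp
      then show "disjoint_family (\<lambda>j. extinct (Suc j) t)" unfolding disjoint_family_on_def by blast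
    qed auto
    also have "\<dots> = (\<Sum>j. ennreal (parking_cdf \<rho> (Suc j) (\<beta> * t)))"
      using True by (simp add: emeasure_eq_measure prob_extinct U_active_0_eq)
    finally show ?thesis using True by simp
  qed
  finally show ?thesis .
qed

end

theorem theorem2:
  fixes M :: "'a measure" and A :: "nat \<Rightarrow> 'a \<Rightarrow> ereal" and \<alpha> \<beta> \<rho> :: real
  assumes "0 < \<alpha>" and "\<alpha> < \<beta>" and "\<rho> = \<alpha> / \<beta>"
    and "hawkes_cluster M A (\<lambda>x. \<alpha> * exp (- \<beta> * x))"
  shows "distr M borel (cluster_duration A) = parking_exp_sum_law \<rho> (1 / \<beta>)"
proof -
  interpret E: exponential_hawkes_cluster M A \<alpha> \<beta>
    using assms by (simp add: exponential_hawkes_cluster_def exponential_hawkes_cluster_axioms_def)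
  have \<rho>: "E.\<rho> = \<rho>" using assms by (simp add: E.\<rho>_def)
  note law = emeasure_parking_exp_sum_law[of \<rho> "1 / \<beta>"]
  show ?thesis
  \<comment> \<open>Closed half lines form an intersection stable generator; the required finiteness
    on the exhausting sequence comes from the law of the duration, a probability measure.\<close>
  proof (rule measure_eqI_generator_eq[where \<Omega> = UNIV and E = "range (\<lambda>a. {..a})" and A = "\<lambda>n. {..real n}"])
    show "Int_stable (range (\<lambda>a::real. {..a}))"
      by (auto simp: Int_stable_def)
    show "(\<Union>n. {..real n}) = UNIV" using real_arch_simple by auto
    show "emeasure (distr M borel (cluster_duration A)) X = emeasure (parking_exp_sum_law \<rho> (1 / \<beta>)) X"
      if "X \<in> range (\<lambda>a. {..a})" for X
      using that E.emeasure_duration law(1) E.rho_pos E.beta_pos unfolding \<rho> by (auto simp: mult.commute)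
    have sets_borel: "sets (borel :: real measure) = sigma_sets UNIV (range (\<lambda>a. {..a}))"
      by (subst borel_eq_atMost) (simp add: sets_measure_of)
    then show "sets (distr M borel (cluster_duration A)) = sigma_sets UNIV (range (\<lambda>a. {..a}))" by simp
    show "sets (parking_exp_sum_law \<rho> (1 / \<beta>)) = sigma_sets UNIV (range (\<lambda>a. {..a}))"
      using law(2) sets_borel E.rho_pos E.beta_pos unfolding \<rho> by simp
    show "emeasure (distr M borel (cluster_duration A)) {..real i} \<noteq> \<infinity>" for i
      using prob_space.emeasure_le_1[OF E.prob_space_distr[OF E.cluster_duration_measurable], of "{..real i}"]
      by (auto simp: top_unique)
  qed auto
qed

end
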